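(* Let $n\ge 1$, let $\mathbb{D}^n$ be the unit polydisc of $\mathbb{C}^n$, and let $S\subset\mathbb{D}^n$ be a Carleson sequence which is dual bounded in $H^p(\mathbb{D}^n)$, where either $p=\infty$ or $1<p\le 2$. Then for every $s$ with $1\le s<p$ the sequence $S$ is $H^s(\mathbb{D}^n)$-interpolating with the linear extension property: there is a bounded linear operator $E:\ell^s(S)\to H^s(\mathbb{D}^n)$ such that $(E\lambda)(a)=\lambda_a\|k_a\|_{s'}$ for all $\lambda\in\ell^s(S)$ and all $a\in S$, where $\frac1s+\frac1{s'}=1$.
   Context: $H^p(\mathbb{D}^n)$, $1\le p\le\infty$, is the usual Hardy space of holomorphic functions on the polydisc; $\|\cdot\|_p$ is its norm, i.e. the $L^p$ norm of boundary values with respect to the normalized Lebesgue measure $\sigma$ on the torus $\mathbb{T}^n$. A sequence $S$ is a finite or countable family of distinct points. For $a\in\mathbb{D}^n$, $k_a(z)=\prod_{i=1}^n\frac{1}{1-\overline a_i z_i}$ is the reproducing kernel at $a$, $\|k_a\|_r$ is its $H^r(\mathbb{D}^n)$ norm for $1\le r\le\infty$, and $k_{r,a}=k_a/\|k_a\|_r$. $p'$ denotes the conjugate exponent of $p$. Carleson sequence: for $1<q<\infty$, $S$ is $q$-Carleson if there is $D_q>0$ such that $\left\|\sum_{a\in S}\mu_a k_{q,a}\right\|_q\le D_q\|\mu\|_{\ell^q}$ for all $\mu\in\ell^q(S)$. In the polydisc this condition is the same for all $q\in\,]1,\infty[$, and $S$ is called a Carleson sequence if it is $q$-Carleson for one (equivalently,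 every) $q\in\,]1,\infty[$. Interpolation ($1\le s<\infty$): $S$ is $H^s(\mathbb{D}^n)$-interpolating if for every $\lambda\in\ell^s(S)$ there is $f\in H^s(\mathbb{D}^n)$ with $f(a)=\lambda_a\|k_a\|_{s'}$ for all $a\in S$. Dual boundedness: for $1<p<\infty$, $S$ is dual bounded in $H^p(\mathbb{D}^n)$ if there are $\{\rho_a\}_{a\in S}\subset H^p(\mathbb{D}^n)$ with $\sup_{a\in S}\|\rho_a\|_p<\infty$ and $\langle\rho_a,k_{p',b}\rangle=\delta_{ab}$ for all $a,b\in S$; equivalently $\rho_a(b)=\delta_{ab}\|k_b\|_{p'}$. For $p=\infty$, $S$ is dual bounded in $H^\infty(\mathbb{D}^n)$ if there are $\{\rho_a\}_{a\in S}\subset H^\infty(\mathbb{D}^n)$ with $\sup_{a\in S}\|\rho_a\|_\infty<\infty$ and $\rho_a(b)=\delta_{ab}$ for all $a,b\in S$. *)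

theory Defs
  imports "HOL-Analysis.Analysis" "HOL-Probability.Essential_Supremum"
begin

section \<open>Polydisc, torus and Lebesgue norms\<close>

definition polydisc :: "(complex ^ 'n) set" where
  "polydisc = {z. \<forall>i. norm (z $ i) < 1}"

definition torus :: "(complex ^ 'n) set" where
  "torus = {z. \<forall>i. norm (z $ i) = 1}"

text \<open>The normalized Lebesgue measure on the torus: the image of the normalized Lebesgue
  measure on the cube of side \<open>2 * pi\<close> under the coordinatewise exponential map.\<close>

definition torus_measure :: "(complex ^ 'n) measure" where
  "torus_measure =
     distr (uniform_measure lborel (cbox 0 (\<chi> i. 2 * pi) :: (real ^ 'n) set))
       (restrict_space borel torus) (\<lambda>t. \<chi> i. cis (t $ i))"

definition holomorphic_polydisc :: "(complex ^ 'n \<Rightarrow> complex) \<Rightarrow> bool" where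
  "holomorphic_polydisc f \<longleftrightarrow>
     (\<forall>z\<in>polydisc. \<exists>f'. (f has_derivative f') (at z) \<and> (\<forall>c v. f' (c *s v) = c * f' v))"

text \<open>Exponents of function spaces are extended nonnegative reals, so that \<open>\<infinity>\<close> is included;
  norms take values in the same type, hence finiteness is a genuine condition.\<close>

definition Lp_norm :: "ennreal \<Rightarrow> (complex ^ 'n \<Rightarrow> complex) \<Rightarrow> ennreal" where
  "Lp_norm p g =
     (if p = \<infinity> then esssup torus_measure (\<lambda>\<zeta>. ennreal (norm (g \<zeta>)))
      else let I = (\<integral>\<^sup>+ \<zeta>. ennreal (norm (g \<zeta>) powr enn2real p) \<partial>torus_measure)
           in if I = \<infinity> then \<infinity> else ennreal (enn2real I powr (1 / enn2real p)))"

text \<open>With the conventions \<open>inverse \<infinity> = 0\<close> and \<open>inverse 0 = \<infinity>\<close> this is correct for all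
  \<open>1 \<le> p \<le> \<infinity>\<close>, including the end points.\<close>

definition conj_exponent :: "ennreal \<Rightarrow> ennreal" where
  "conj_exponent p = inverse (1 - inverse p)"

section \<open>Hardy spaces\<close>

definition hardy_space :: "ennreal \<Rightarrow> (complex ^ 'n \<Rightarrow> complex) set" where
  "hardy_space p =
     {f. holomorphic_polydisc f \<and>
         (if p = \<infinity> then bounded (f ` polydisc)
          else (SUP r\<in>{0..<1}. Lp_norm p (\<lambda>\<zeta>. f (r *\<^sub>R \<zeta>))) < \<infinity>)}"

text \<open>The boundary function of \<open>f\<close> is the limit of its dilates in \<open>L\<^sup>1\<close> of the torus. For \<open>f\<close> in a
  Hardy space with exponent at least \<open>1\<close> the limit exists, is unique almost everywhere, and agrees
  almost everywhere with the radial limit.\<close>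

definition has_boundary_value :: "(complex ^ 'n \<Rightarrow> complex) \<Rightarrow> (complex ^ 'n \<Rightarrow> complex) \<Rightarrow> bool" where
  "has_boundary_value f g \<longleftrightarrow>
     g \<in> borel_measurable torus_measure \<and>
     ((\<lambda>r. \<integral>\<^sup>+ \<zeta>. ennreal (norm (f (r *\<^sub>R \<zeta>) - g \<zeta>)) \<partial>torus_measure) \<longlongrightarrow> 0) (at_left (1::real))"

definition boundary_value :: "(complex ^ 'n \<Rightarrow> complex) \<Rightarrow> complex ^ 'n \<Rightarrow> complex" where
  "boundary_value f = (SOME g. has_boundary_value f g)"

definition hardy_norm :: "ennreal \<Rightarrow> (complex ^ 'n \<Rightarrow> complex) \<Rightarrow> ennreal" where
  "hardy_norm p f = Lp_norm p (boundary_value f)"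

definition hardy_pairing :: "(complex ^ 'n \<Rightarrow> complex) \<Rightarrow> (complex ^ 'n \<Rightarrow> complex) \<Rightarrow> complex" where
  "hardy_pairing f g =
     (LINT \<zeta>|torus_measure. boundary_value f \<zeta> * cnj (boundary_value g \<zeta>))"

section \<open>Reproducing kernels\<close>

definition szego_kernel :: "complex ^ 'n \<Rightarrow> complex ^ 'n \<Rightarrow> complex" where
  "szego_kernel a z = (\<Prod>i\<in>UNIV. 1 / (1 - cnj (a $ i) * z $ i))"

definition kernel_norm :: "ennreal \<Rightarrow> complex ^ 'n \<Rightarrow> real" where
  "kernel_norm r a = enn2real (hardy_norm r (szego_kernel a))"

definition normalized_kernel :: "ennreal \<Rightarrow> complex ^ 'n \<Rightarrow> complex ^ 'n \<Rightarrow> complex" where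
  "normalized_kernel r a z = szego_kernel a z / complex_of_real (kernel_norm r a)"

section \<open>Sequences of points\<close>

text \<open>A sequence is a countable set \<open>S\<close> of points; elements of \<open>\<ell>\<^sup>q(S)\<close> are functions on \<open>S\<close>,
  extended by \<open>0\<close>.\<close>

definition ell :: "real \<Rightarrow> 'a set \<Rightarrow> ('a \<Rightarrow> complex) set" where
  "ell q S = {\<mu>. (\<forall>a. a \<notin> S \<longrightarrow> \<mu> a = 0) \<and> (\<lambda>a. norm (\<mu> a) powr q) summable_on S}"

definition ell_norm :: "real \<Rightarrow> 'a set \<Rightarrow> ('a \<Rightarrow> complex) \<Rightarrow> real" where
  "ell_norm q S \<mu> = (\<Sum>\<^sub>\<infinity>a\<in>S. norm (\<mu> a) powr q) powr (1 / q)"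

definition q_carleson :: "real \<Rightarrow> (complex ^ 'n) set \<Rightarrow> bool" where
  "q_carleson q S \<longleftrightarrow>
     (\<exists>D>0. \<forall>\<mu>\<in>ell q S. \<exists>F\<in>hardy_space (ennreal q).
        (\<forall>z\<in>polydisc. ((\<lambda>a. \<mu> a * normalized_kernel (ennreal q) a z) has_sum F z) S) \<and>
        hardy_norm (ennreal q) F \<le> ennreal (D * ell_norm q S \<mu>))"

text \<open>On the polydisc the condition does not depend on \<open>q\<close>; a Carleson sequence satisfies it for
  every \<open>q\<close> strictly between \<open>1\<close> and \<open>\<infinity>\<close>.\<close>

definition carleson_sequence :: "(complex ^ 'n) set \<Rightarrow> bool" where
  "carleson_sequence S \<longleftrightarrow> (\<forall>q>1. q_carleson q S)"

definition dual_bounded :: "ennreal \<Rightarrow> (complex ^ 'n) set \<Rightarrow> bool" where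
  "dual_bounded p S \<longleftrightarrow>
     (\<exists>\<rho>. (\<forall>a\<in>S. \<rho> a \<in> hardy_space p) \<and>
          (SUP a\<in>S. hardy_norm p (\<rho> a)) < \<infinity> \<and>
          (\<forall>a\<in>S. \<forall>b\<in>S.
             (if p = \<infinity> then \<rho> a b
              else hardy_pairing (\<rho> a) (normalized_kernel (conj_exponent p) b))
             = (if a = b then 1 else 0)))"

definition hardy_interpolating :: "real \<Rightarrow> (complex ^ 'n) set \<Rightarrow> bool" where
  "hardy_interpolating s S \<longleftrightarrow>
     (\<forall>l\<in>ell s S. \<exists>f\<in>hardy_space (ennreal s).
        \<forall>a\<in>S. f a = l a * complex_of_real (kernel_norm (conj_exponent (ennreal s)) a))"

text \<open>Elements of a Hardy space are functions on the polydisc, so linearity is required there only.\<close>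

definition bounded_linear_ell_hardy ::
  "real \<Rightarrow> (complex ^ 'n) set \<Rightarrow> ((complex ^ 'n \<Rightarrow> complex) \<Rightarrow> complex ^ 'n \<Rightarrow> complex) \<Rightarrow> bool" where
  "bounded_linear_ell_hardy s S E \<longleftrightarrow>
     (\<forall>l\<in>ell s S. E l \<in> hardy_space (ennreal s)) \<and>
     (\<forall>l\<in>ell s S. \<forall>m\<in>ell s S. \<forall>z\<in>polydisc. E (\<lambda>a. l a + m a) z = E l z + E m z) \<and>
     (\<forall>c. \<forall>l\<in>ell s S. \<forall>z\<in>polydisc. E (\<lambda>a. c * l a) z = c * E l z) \<and>
     (\<exists>C. \<forall>l\<in>ell s S. hardy_norm (ennreal s) (E l) \<le> ennreal (C * ell_norm s S l))"

end

theory Submission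
  imports Defs "HOL-Complex_Analysis.Cauchy_Integral_Formula" "HOL-Probability.Probability_Measure"
begin

text \<open>
  Choose \<open>q\<close> with \<open>1/s = 1/p + 1/q\<close> and put \<open>E \<lambda> = \<Sum>a. c\<^sub>a \<lambda>\<^sub>a \<rho>\<^sub>a k\<^bsub>q,a\<^esub>\<close>, where \<open>\<rho>\<close> is the dual
  system. The constants \<open>c\<^sub>a\<close> which make \<open>E \<lambda>\<close> take the right values are bounded, because
  \<open>\<parallel>k\<^sub>a\<parallel>\<^sub>r\<close> is comparable to \<open>k\<^sub>a(a)\<close> to the power \<open>1 - 1/r\<close>. By the Cauchy-Schwarz inequality the
  sum is dominated by the product of the square functions of \<open>\<alpha>\<^sub>a \<rho>\<^sub>a\<close> and of \<open>\<beta>\<^sub>a k\<^bsub>q,a\<^esub>\<close>, where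
  \<open>\<alpha> = |\<lambda>|\<close> to the power \<open>s/p\<close> and \<open>\<beta> = |\<lambda>|\<close> to the power \<open>s/q\<close>. The second square function lies in
  \<open>L\<^sup>q\<close>: average the Carleson inequality over random signs and apply Jensen's inequality, which is
  legitimate since \<open>q \<ge> 2\<close> holds automatically when \<open>p \<le> 2\<close>. The first one lies in \<open>L\<^sup>p\<close> because
  \<open>\<ell>\<^sup>p\<close> is contained in \<open>\<ell>\<^sup>2\<close> for \<open>p \<le> 2\<close>. When \<open>p = \<infinity>\<close>, replace \<open>\<rho>\<^sub>a\<close> by
  \<open>\<rho>\<^sub>a k\<^bsub>2s,a\<^esub>\<close> and take \<open>p = q = 2s\<close>; the first square function is then controlled like the second.

  Boundary values of functions in a Hardy space with exponent \<open>p > 1\<close> exist because the dilates are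
  Cauchy in \<open>L\<^sup>1\<close>: the integrals of the strictly convex function \<open>|(1, f)|\<close> over the dilates increase to a
  finite limit, so its convexity defect at two dilates tends to \<open>0\<close>, and uniform integrability turns
  this into convergence in \<open>L\<^sup>1\<close>.
\<close>

section \<open>The torus measure and its rotations\<close>

text \<open>The obstacle is that all estimates live on the torus while the functions live inside it,
  and boundary functions are only L^1 limits of dilates. The bridge is Cauchy's formula: for the
  product of f with the kernel at z, taken at z, it becomes a Poisson formula with weight |k_z|^2 /
  k_z(z), and Jensen's inequality then shows that dilation does not increase integral means.

  The comparison of kernel norms rests on one exact value, the squared L^2 norm k_a(a). Upper bounds
  for other finite exponents come from dominating a power of |k_a| by a combination of squares of
  kernels at points moved towards 0; lower bounds for exponents r >= 2 come from interpolating the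
  exponent 2 between 3/2 and r.

  For s = 1 the existence theorem for boundary values does not cover the extension itself. Its
  boundary function is obtained instead by summing the boundary functions of the terms, which is
  possible because the estimate behind the operator bounds the sum of the moduli of the terms and
  not only the modulus of their sum.\<close>

lemma space_torus_measure [simp]: "space torus_measure = torus"
  by (simp add: torus_measure_def space_restrict_space)

lemma sets_torus_measure [measurable_cong]:
  "sets torus_measure = sets (restrict_space borel torus)"
  by (simp add: torus_measure_def)

lemma closed_torus: "closed (torus :: (complex ^ 'n) set)"
proof -
  have "(torus :: (complex ^ 'n) set) = (\<Inter>i. {z. norm (z $ i) = 1})"
    by (auto simp: torus_def)
  moreover have "closed (\<Inter>i. {z :: complex ^ 'n. norm (z $ i) = 1})"
    by (intro closed_INT ballI closed_Collect_eq continuous_intros)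
  ultimately show ?thesis by simp
qed

lemma compact_torus: "compact (torus :: (complex ^ 'n) set)"
proof -
  have "norm z \<le> real CARD('n)" if "z \<in> torus" for z :: "complex ^ 'n"
    using that L2_set_le_sum[of UNIV "\<lambda>i. norm (z $ i)"] by (simp add: norm_vec_def torus_def)
  then have "bounded (torus :: (complex ^ 'n) set)"
    by (auto simp: bounded_iff)
  then show ?thesis
    using closed_torus compact_eq_bounded_closed by blast
qed

lemma measurable_torus_continuous:
  fixes f :: "complex ^ 'n \<Rightarrow> 'b::topological_space"
  assumes "continuous_on torus f"
  shows "f \<in> borel_measurable torus_measure"
proof -
  have "f \<in> borel_measurable (restrict_space borel torus)"
    by (rule borel_measurable_continuous_on_restrict[OF assms])
  then show ?thesis
    by (simp cong: measurable_cong_sets add: sets_torus_measure)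
qed

definition torus_exp :: "real ^ 'n \<Rightarrow> complex ^ 'n" where
  "torus_exp t = (\<chi> i. cis (t $ i))"

definition cube :: "(real ^ 'n) set" where
  "cube = cbox 0 (\<chi> i. 2 * pi)"

lemma mem_cube: "t \<in> cube \<longleftrightarrow> (\<forall>i. 0 \<le> t $ i \<and> t $ i \<le> 2 * pi)"
  by (simp add: cube_def mem_box_cart)

lemma torus_measure_eq:
  "torus_measure = distr (uniform_measure lborel cube) (restrict_space borel torus) torus_exp"
  by (simp add: torus_measure_def torus_exp_def[abs_def] cube_def)

lemma continuous_torus_exp: "continuous_on UNIV (torus_exp :: real ^ 'n \<Rightarrow> _)"
  unfolding torus_exp_def[abs_def]
  by (intro continuous_on_vec_lambda continuous_intros)

lemma measurable_torus_exp: "torus_exp \<in> borel \<rightarrow>\<^sub>M restrict_space borel torus"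
  by (intro measurable_restrict_space2 borel_measurable_continuous_onI continuous_torus_exp)
     (auto simp: torus_exp_def torus_def)

lemma emeasure_cube: "emeasure lborel (cube :: (real ^ 'n) set) \<noteq> 0"
  "emeasure lborel (cube :: (real ^ 'n) set) \<noteq> \<infinity>"
proof -
  have "emeasure lborel (box 0 (\<chi> i. 2 * pi) :: (real ^ 'n) set) > 0"
    unfolding emeasure_lborel_box_eq
    by (auto simp: Basis_vec_def inner_axis intro!: prod_pos)
  moreover have "emeasure lborel (box 0 (\<chi> i. 2 * pi) :: (real ^ 'n) set) \<le> emeasure lborel (cube :: (real ^ 'n) set)"
    unfolding cube_def by (intro emeasure_mono box_subset_cbox) auto
  ultimately show "emeasure lborel (cube :: (real ^ 'n) set) \<noteq> 0" by auto
  show "emeasure lborel (cube :: (real ^ 'n) set) \<noteq> \<infinity>"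
    unfolding cube_def using emeasure_lborel_cbox_finite by (metis infinity_ennreal_def less_irrefl)
qed

lemma cube_sets [measurable]: "cube \<in> sets borel"
  by (simp add: cube_def)

interpretation torus: prob_space "torus_measure :: (complex ^ 'n) measure"
  unfolding torus_measure_eq
  by (intro prob_space.prob_space_distr prob_space_uniform_measure emeasure_cube)
     (use measurable_torus_exp in \<open>simp cong: measurable_cong_sets\<close>)

lemma nn_integral_torus:
  fixes h :: "complex ^ 'n \<Rightarrow> ennreal"
  assumes "h \<in> borel_measurable torus_measure"
  shows "(\<integral>\<^sup>+\<zeta>. h \<zeta> \<partial>torus_measure) =
    (\<integral>\<^sup>+t. h (torus_exp t) * indicator cube t \<partial>lborel) / emeasure lborel (cube :: (real ^ 'n) set)"
proof -
  have [measurable]: "h \<in> borel_measurable (restrict_space borel torus)"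
    using assms by (simp cong: measurable_cong_sets add: sets_torus_measure)
  have [measurable]: "torus_exp \<in> borel \<rightarrow>\<^sub>M restrict_space borel torus"
    by (rule measurable_torus_exp)
  show ?thesis
    unfolding torus_measure_eq
    by (subst nn_integral_distr) (auto simp: nn_integral_uniform_measure)
qed

lemma nn_integral_lborel_shift:
  fixes c :: "'a::euclidean_space"
  assumes "f \<in> borel_measurable borel"
  shows "(\<integral>\<^sup>+x. f (c + x) \<partial>lborel) = (\<integral>\<^sup>+x. f x \<partial>lborel)"
proof -
  have "(\<integral>\<^sup>+x. f x \<partial>lborel) = (\<integral>\<^sup>+x. f x \<partial>distr lborel borel ((+) c))"
    by (simp add: lborel_distr_plus)
  also have "\<dots> = (\<integral>\<^sup>+x. f (c + x) \<partial>lborel)"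
    using assms by (subst nn_integral_distr) auto
  finally show ?thesis by simp
qed

lemma AE_lborel_component_neq:
  fixes i :: "'n::finite"
  shows "AE t in lborel. (t :: real ^ 'n) $ i \<noteq> c"
proof -
  have "{t :: real ^ 'n. t $ i = c} \<in> sets borel"
    by (intro borel_closed closed_Collect_eq continuous_intros)
  moreover have "{t :: real ^ 'n. t $ i = c} \<in> null_sets lebesgue"
    using negligible_standard_hyperplane[of "axis i (1::real)" c]
    by (simp add: negligible_iff_null_sets cart_eq_inner_axis)
  ultimately have "{t :: real ^ 'n. t $ i = c} \<in> null_sets lborel"
    by (simp add: null_sets_completion_iff)
  then show ?thesis
    by (rule AE_I') auto
qed

lemma nn_integral_cube_shift:
  fixes g :: "real ^ 'n \<Rightarrow> ennreal"
  assumes [measurable]: "g \<in> borel_measurable borel"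
    and per: "\<And>t. g (axis i (2 * pi) + t) = g t"
    and \<theta>: "0 \<le> \<theta>" "\<theta> \<le> 2 * pi"
  shows "(\<integral>\<^sup>+t. g (axis i \<theta> + t) * indicator cube t \<partial>lborel) =
    (\<integral>\<^sup>+t. g t * indicator cube t \<partial>lborel)"
proof -
  \<comment> \<open>Half open in direction \<open>i\<close>, so that its translates by multiples of
    \<open>2 * pi\<close> along that axis do not overlap; it differs from \<open>cube\<close> by a
    null set.\<close>
  define C where "C = {t :: real ^ 'n. t \<in> cube \<and> t $ i < 2 * pi}"
  have comp [measurable]: "(\<lambda>t :: real ^ 'n. t $ i) \<in> borel_measurable borel"
    by (intro borel_measurable_continuous_onI continuous_intros)
  have [measurable]: "C \<in> sets borel"
    unfolding C_def by measurable
  have aeC: "AE t in lborel. indicator cube t = (indicator C t :: ennreal)"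
    using AE_lborel_component_neq[of i "2 * pi"]
  proof eventually_elim
    case (elim t)
    then have "t \<in> C \<longleftrightarrow> t \<in> cube"
      by (auto simp: C_def mem_cube intro: order_le_neq_trans)
    then show ?case
      by (simp add: indicator_def)
  qed
  have toC: "(\<integral>\<^sup>+t. k t * indicator cube t \<partial>lborel) = (\<integral>\<^sup>+t. k t * indicator C t \<partial>lborel)" for k
    by (intro nn_integral_cong_AE) (use aeC in auto)
  \<comment> \<open>The translate of \<open>C\<close> by \<open>\<theta>\<close> is the disjoint
    union of \<open>P\<close> and of \<open>Q\<close> moved by \<open>2 * pi\<close>; periodicity of
    \<open>g\<close> brings the second piece back.\<close>
  define P where "P = C \<inter> {t. \<theta> \<le> t $ i}"
  define Q where "Q = C \<inter> {t. t $ i < \<theta>}"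
  have [measurable]: "P \<in> sets borel" "Q \<in> sets borel"
    unfolding P_def Q_def by measurable
  have split: "indicator C (axis i (-\<theta>) + t) =
      indicator P t + (indicator Q (axis i (- 2 * pi) + t) :: ennreal)" for t
  proof -
    define T where "T \<longleftrightarrow> (\<forall>j. j \<noteq> i \<longrightarrow> 0 \<le> t $ j \<and> t $ j \<le> 2 * pi)"
    have ax: "(axis i c + t) $ j = (if j = i then c + t $ i else t $ j)" for c j
      by (simp add: axis_def)
    have at_i: "(\<forall>j. R j) \<longleftrightarrow> R i \<and> (\<forall>j. j \<noteq> i \<longrightarrow> R j)" for R
      by auto
    have cube_iff: "axis i c + t \<in> cube \<longleftrightarrow> 0 \<le> c + t $ i \<and> c + t $ i \<le> 2 * pi \<and> T" for c
      unfolding mem_cube T_def at_i[of "\<lambda>j. 0 \<le> (axis i c + t) $ j \<and> (axis i c + t) $ j \<le> 2 * pi"]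
      by (simp add: axis_def)
    have "t \<in> cube \<longleftrightarrow> 0 \<le> t $ i \<and> t $ i \<le> 2 * pi \<and> T"
      unfolding mem_cube T_def at_i[of "\<lambda>j. 0 \<le> t $ j \<and> t $ j \<le> 2 * pi"] by simp
    then have "t \<in> P \<longleftrightarrow> \<theta> \<le> t $ i \<and> t $ i < 2 * pi \<and> T"
      unfolding C_def P_def mem_Collect_eq Int_iff using \<theta> by (safe; linarith)
    moreover have "axis i (-\<theta>) + t \<in> C \<longleftrightarrow> \<theta> \<le> t $ i \<and> t $ i < 2 * pi + \<theta> \<and> T"
      unfolding C_def mem_Collect_eq cube_iff ax if_True simp_thms by (safe; linarith)
    moreover have "axis i (- 2 * pi) + t \<in> Q \<longleftrightarrow> 2 * pi \<le> t $ i \<and> t $ i < 2 * pi + \<theta> \<and> T"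
      unfolding C_def Q_def mem_Collect_eq Int_iff cube_iff ax if_True simp_thms using \<theta> by (safe; linarith)
    ultimately show ?thesis
      using \<theta> by (auto simp: indicator_def split: if_splits)
  qed
  have "(\<integral>\<^sup>+t. g (axis i \<theta> + t) * indicator C t \<partial>lborel)
      = (\<integral>\<^sup>+t. g (axis i \<theta> + (axis i (-\<theta>) + t)) * indicator C (axis i (-\<theta>) + t) \<partial>lborel)"
    by (rule nn_integral_lborel_shift[symmetric]) measurable
  also have "\<dots> = (\<integral>\<^sup>+t. g t * indicator P t + g t * indicator Q (axis i (- 2 * pi) + t) \<partial>lborel)"
  proof (intro nn_integral_cong)
    fix t :: "real ^ 'n"
    have "axis i \<theta> + (axis i (-\<theta>) + t) = t"
      by (simp add: vec_eq_iff axis_def)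
    then show "g (axis i \<theta> + (axis i (-\<theta>) + t)) * indicator C (axis i (-\<theta>) + t)
        = g t * indicator P t + g t * indicator Q (axis i (- 2 * pi) + t)"
      by (simp only: split distrib_left)
  qed
  also have "\<dots> = (\<integral>\<^sup>+t. g t * indicator P t \<partial>lborel) + (\<integral>\<^sup>+t. g t * indicator Q (axis i (- 2 * pi) + t) \<partial>lborel)"
    by (intro nn_integral_add) measurable
  also have "(\<integral>\<^sup>+t. g t * indicator Q (axis i (- 2 * pi) + t) \<partial>lborel)
      = (\<integral>\<^sup>+t. g (axis i (2 * pi) + t) * indicator Q (axis i (- 2 * pi) + (axis i (2 * pi) + t)) \<partial>lborel)"
    by (rule nn_integral_lborel_shift[symmetric]) measurable
  also have "\<dots> = (\<integral>\<^sup>+t. g t * indicator Q t \<partial>lborel)"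
  proof (intro nn_integral_cong)
    fix t :: "real ^ 'n"
    have "axis i (- 2 * pi) + (axis i (2 * pi) + t) = t"
      by (simp add: vec_eq_iff axis_def)
    then show "g (axis i (2 * pi) + t) * indicator Q (axis i (- 2 * pi) + (axis i (2 * pi) + t)) = g t * indicator Q t"
      by (simp only: per)
  qed
  also have "(\<integral>\<^sup>+t. g t * indicator P t \<partial>lborel) + (\<integral>\<^sup>+t. g t * indicator Q t \<partial>lborel)
      = (\<integral>\<^sup>+t. g t * indicator P t + g t * indicator Q t \<partial>lborel)"
    by (intro nn_integral_add[symmetric]) measurable
  also have "\<dots> = (\<integral>\<^sup>+t. g t * indicator C t \<partial>lborel)"
    by (intro nn_integral_cong) (auto simp: P_def Q_def indicator_def)
  finally show ?thesis
    by (simp add: toC)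
qed

section \<open>Rotations of one coordinate and averages over them\<close>

definition rot :: "'n \<Rightarrow> real \<Rightarrow> complex ^ 'n \<Rightarrow> complex ^ 'n" where
  "rot i \<theta> \<zeta> = (\<chi> j. if j = i then cis \<theta> * \<zeta> $ j else \<zeta> $ j)"

lemma rot_torus [simp]: "\<zeta> \<in> torus \<Longrightarrow> rot i \<theta> \<zeta> \<in> torus"
  by (simp add: torus_def rot_def norm_mult)

text \<open>Measurability jointly in the point and the angle is what Fubini's theorem requires in
  \<open>integral_torus_average\<close>.\<close>

lemma rot_measurable2:
  fixes i :: "'n::finite"
  shows "(\<lambda>(\<zeta>, \<theta>). rot i \<theta> \<zeta>) \<in> torus_measure \<Otimes>\<^sub>M borel \<rightarrow>\<^sub>M torus_measure"
proof -
  have "continuous_on UNIV (\<lambda>x. rot i (snd x) (fst x) :: complex ^ 'n)"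
    unfolding rot_def
  proof (rule continuous_on_vec_lambda)
    show "continuous_on UNIV (\<lambda>x. if j = i then cis (snd x) * fst x $ j else (fst x :: complex ^ 'n) $ j)" for j
      by (cases "j = i") (auto intro!: continuous_intros)
  qed
  then have *: "(\<lambda>(\<zeta>, \<theta>). rot i \<theta> \<zeta>) \<in> borel \<Otimes>\<^sub>M borel \<rightarrow>\<^sub>M (borel :: (complex ^ 'n) measure)"
    by (subst borel_prod) (auto intro!: borel_measurable_continuous_onI simp: case_prod_unfold)
  have "(\<lambda>x. x) \<in> torus_measure \<rightarrow>\<^sub>M (borel :: (complex ^ 'n) measure)"
    by (intro measurable_torus_continuous continuous_intros)
  then have "(\<lambda>x. (fst x, snd x)) \<in> torus_measure \<Otimes>\<^sub>M borel \<rightarrow>\<^sub>M (borel :: (complex ^ 'n) measure) \<Otimes>\<^sub>M (borel :: real measure)"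
    by (intro measurable_Pair) (auto intro: measurable_compose[OF measurable_fst])
  from measurable_compose[OF this *]
  have "(\<lambda>(\<zeta>, \<theta>). rot i \<theta> \<zeta>) \<in> torus_measure \<Otimes>\<^sub>M borel \<rightarrow>\<^sub>M (borel :: (complex ^ 'n) measure)"
    by (simp add: case_prod_unfold)
  then have "(\<lambda>(\<zeta>, \<theta>). rot i \<theta> \<zeta>) \<in> torus_measure \<Otimes>\<^sub>M borel \<rightarrow>\<^sub>M restrict_space borel (torus :: (complex ^ 'n) set)"
    by (intro measurable_restrict_space2) (auto simp: space_pair_measure)
  then show ?thesis
    by (simp cong: measurable_cong_sets add: sets_torus_measure)
qed

lemma rot_measurable [measurable]: "rot i \<theta> \<in> torus_measure \<rightarrow>\<^sub>M torus_measure"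
  using measurable_compose[OF measurable_Pair2'[of \<theta>] rot_measurable2[of i]]
  by (simp cong: measurable_cong_sets)

text \<open>In angular coordinates a rotation is a translation along one axis, so invariance follows
  from \<open>nn_integral_cube_shift\<close>. Angles between 0 and \<open>2 * pi\<close> carry all
  the mass of \<open>circle_measure\<close>.\<close>

lemma nn_integral_torus_rot:
  assumes [measurable]: "h \<in> borel_measurable torus_measure" and "0 \<le> \<theta>" "\<theta> \<le> 2 * pi"
  shows "(\<integral>\<^sup>+\<zeta>. h (rot i \<theta> \<zeta>) \<partial>torus_measure) = (\<integral>\<^sup>+\<zeta>. h \<zeta> \<partial>torus_measure)"
proof -
  have eq: "rot i \<theta> (torus_exp t) = torus_exp (axis i \<theta> + t)" for t
    by (auto simp: rot_def torus_exp_def vec_eq_iff axis_def cis_mult)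
  have per: "torus_exp (axis i (2 * pi) + t) = torus_exp t" for t
    by (auto simp: torus_exp_def vec_eq_iff axis_def simp flip: cis_mult)
  have [measurable]: "(\<lambda>t. h (torus_exp t)) \<in> borel_measurable borel"
    by (rule measurable_compose[OF measurable_torus_exp])
       (use assms(1) in \<open>simp cong: measurable_cong_sets add: sets_torus_measure\<close>)
  show ?thesis
    using nn_integral_cube_shift[of "\<lambda>t. h (torus_exp t)" i \<theta>] assms
    by (simp add: nn_integral_torus[OF assms(1)] nn_integral_torus[of "\<lambda>\<zeta>. h (rot i \<theta> \<zeta>)"] eq per)
qed

definition circle_measure :: "real measure" where
  "circle_measure = uniform_measure lborel {0..2 * pi}"

lemma sets_circle_measure [simp, measurable_cong]: "sets circle_measure = sets borel"
  and space_circle_measure [simp]: "space circle_measure = UNIV"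
  by (simp_all add: circle_measure_def)

interpretation circle: prob_space circle_measure
  unfolding circle_measure_def by (intro prob_space_uniform_measure) simp_all

lemma AE_circle: "AE \<theta> in circle_measure. 0 \<le> \<theta> \<and> \<theta> \<le> 2 * pi"
  unfolding circle_measure_def by (subst AE_uniform_measure) auto

interpretation torus_circle: pair_sigma_finite "torus_measure :: (complex ^ 'n) measure" circle_measure ..

lemma rot_measurable_circle [measurable]:
  "(\<lambda>(\<zeta>, \<theta>). rot i \<theta> \<zeta>) \<in> torus_measure \<Otimes>\<^sub>M circle_measure \<rightarrow>\<^sub>M torus_measure"
  using rot_measurable2[of i] by (simp cong: measurable_cong_sets sets_pair_measure_cong)

lemma distr_torus_rot:
  assumes "0 \<le> \<theta>" "\<theta> \<le> 2 * pi"
  shows "distr torus_measure torus_measure (rot i \<theta>) = torus_measure"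
proof (rule measure_eqI)
  fix A assume "A \<in> sets (distr torus_measure torus_measure (rot i \<theta>))"
  then have [measurable]: "A \<in> sets torus_measure" by simp
  have "emeasure (distr torus_measure torus_measure (rot i \<theta>)) A
     = (\<integral>\<^sup>+\<zeta>. indicator A \<zeta> \<partial>distr torus_measure torus_measure (rot i \<theta>))"
    by simp
  also have "\<dots> = (\<integral>\<^sup>+\<zeta>. indicator A \<zeta> \<partial>torus_measure)"
    by (subst nn_integral_distr) (auto simp: nn_integral_torus_rot[OF _ assms])
  finally show "emeasure (distr torus_measure torus_measure (rot i \<theta>)) A = emeasure torus_measure A"
    by simp
qed simp

text \<open>Rotation invariance and Fubini. This replaces a decomposition of the torus into a
  product of circles: a formula in one variable can be applied inside the integral, one coordinate
  after another.\<close>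

lemma integral_torus_average:
  fixes h :: "complex ^ 'n \<Rightarrow> complex"
  assumes meas [measurable]: "h \<in> borel_measurable torus_measure" and bd: "\<And>\<zeta>. \<zeta> \<in> torus \<Longrightarrow> norm (h \<zeta>) \<le> B"
  shows "(LINT \<zeta>|torus_measure. h \<zeta>) =
    (LINT \<zeta>|torus_measure. (LINT \<theta>|circle_measure. h (rot i \<theta> \<zeta>)))"
proof -
  have "finite_measure ((torus_measure :: (complex ^ 'n) measure) \<Otimes>\<^sub>M circle_measure)"
    by (intro finite_measure_pair_measure torus.finite_measure circle.finite_measure)
  then have "integrable (torus_measure \<Otimes>\<^sub>M circle_measure) (\<lambda>(\<zeta>, \<theta>). h (rot i \<theta> \<zeta>))"
    by (intro finite_measure.integrable_const_bound[where B=B])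
       (auto simp: space_pair_measure intro!: AE_I2 bd)
  then have "(LINT \<zeta>|torus_measure. (LINT \<theta>|circle_measure. h (rot i \<theta> \<zeta>))) =
      (LINT \<theta>|circle_measure. (LINT \<zeta>|torus_measure. h (rot i \<theta> \<zeta>)))"
    by (rule torus_circle.Fubini_integral[symmetric])
  also have "\<dots> = (LINT \<theta>|circle_measure. (LINT \<zeta>|torus_measure. h \<zeta>))"
  proof (intro integral_cong_AE)
    show "AE \<theta> in circle_measure. (LINT \<zeta>|torus_measure. h (rot i \<theta> \<zeta>)) = (LINT \<zeta>|torus_measure. h \<zeta>)"
      using AE_circle
    proof eventually_elim
      case (elim \<theta>)
      then show ?case
        by (subst (2) distr_torus_rot[of \<theta> i, symmetric]) (auto simp: integral_distr)
    qed
  qed measurable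
  finally show ?thesis
    using circle.prob_space by simp
qed

section \<open>Cauchy's formula on the torus\<close>

lemma circle_measure_density: "circle_measure = density lborel (\<lambda>x. ennreal (indicator {0..2 * pi} x / (2 * pi)))"
  unfolding circle_measure_def uniform_measure_def
  by (intro density_cong)
     (auto simp: indicator_def divide_ennreal[symmetric] ennreal_mult' ennreal_zero_divide)

lemma integral_circle:
  fixes f :: "real \<Rightarrow> complex"
  assumes "continuous_on UNIV f"
  shows "(LINT \<theta>|circle_measure. f \<theta>) = integral {0..2 * pi} f / (2 * pi)"
proof -
  have [measurable]: "f \<in> borel_measurable borel"
    by (rule borel_measurable_continuous_onI[OF assms])
  have int: "set_integrable lborel {0..2 * pi} f"
    unfolding set_integrable_def
    by (rule borel_integrable_compact) (auto intro: continuous_on_subset[OF assms])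
  have "(LINT \<theta>|circle_measure. f \<theta>) =
      (LINT \<theta>|lborel. (indicator {0..2 * pi} \<theta> / (2 * pi)) *\<^sub>R f \<theta>)"
    unfolding circle_measure_density by (subst integral_density) auto
  also have "\<dots> = (LINT \<theta>|lborel. (1 / (2 * pi)) *\<^sub>R (indicator {0..2 * pi} \<theta> *\<^sub>R f \<theta>))"
    by simp
  also have "\<dots> = (1 / (2 * pi)) *\<^sub>R (LINT \<theta>:{0..2 * pi}|lborel. f \<theta>)"
    unfolding set_lebesgue_integral_def by (rule integral_scaleR_right)
  also have "(LINT \<theta>:{0..2 * pi}|lborel. f \<theta>) = integral {0..2 * pi} f"
    by (rule set_borel_integral_eq_integral[OF int])
  finally show ?thesis
    by (simp add: scaleR_conv_of_real)
qed

text \<open>On the unit circle \<open>1 / (u - a) = cnj u / (1 - a * cnj u)\<close>, and the line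
  element is \<open>\<i> * u\<close> times that of the angle. So Cauchy's integral becomes a mean
  against the conjugate of the one-variable kernel.\<close>

lemma integral_circle_cauchy:
  fixes g :: "complex \<Rightarrow> complex"
  assumes cont: "continuous_on (cball 0 1) g" and hol: "g holomorphic_on ball 0 1" and a: "norm a < 1"
  shows "(LINT \<theta>|circle_measure. g (cis \<theta>) / (1 - a * cnj (cis \<theta>))) = g a"
proof -
  have nz: "1 - a * cnj (cis \<theta>) \<noteq> 0" for \<theta>
  proof
    assume "1 - a * cnj (cis \<theta>) = 0"
    then have "norm (a * cnj (cis \<theta>)) = 1" by (metis eq_iff_diff_eq_0 norm_one)
    then show False using a by (simp add: norm_mult)
  qed
  have "((\<lambda>u. g u / (u - a)) has_contour_integral (2 * of_real pi * \<i> * g a)) (circlepath 0 1)"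
    using Cauchy_integral_circlepath[OF cont hol, of a] a by simp
  then have "((\<lambda>t. g (cis t) / (cis t - a) * \<i> * cis t) has_integral (2 * of_real pi * \<i> * g a)) {0..2 * pi}"
    unfolding circlepath_def by (subst (asm) has_contour_integral_part_circlepath_iff) auto
  moreover have "g (cis t) / (cis t - a) * \<i> * cis t = \<i> * (g (cis t) / (1 - a * cnj (cis t)))" for t
  proof -
    define D where "D = 1 - a * cnj (cis t)"
    have "cis t - a = cis t * D"
      by (simp add: D_def algebra_simps cis_cnj cis_mult)
    moreover have "D \<noteq> 0"
      using nz[of t] by (simp add: D_def)
    ultimately show ?thesis
      by (simp add: D_def[symmetric])
  qed
  ultimately have "((\<lambda>t. \<i> * (g (cis t) / (1 - a * cnj (cis t)))) has_integral (\<i> * (2 * of_real pi * g a))) {0..2 * pi}"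
    by (simp add: mult_ac)
  then have "((\<lambda>t. - \<i> * (\<i> * (g (cis t) / (1 - a * cnj (cis t))))) has_integral - \<i> * (\<i> * (2 * of_real pi * g a))) {0..2 * pi}"
    by (rule has_integral_mult_right)
  then have "integral {0..2 * pi} (\<lambda>t. g (cis t) / (1 - a * cnj (cis t))) = 2 * of_real pi * g a"
    by (intro integral_unique) (simp add: mult.assoc[symmetric])
  moreover have "continuous_on UNIV (\<lambda>t. g (cis t) / (1 - a * cnj (cis t)))"
    by (intro continuous_intros continuous_on_compose2[OF cont]) (use nz in auto)
  ultimately show ?thesis
    by (simp add: integral_circle)
qed

section \<open>The closed polydisc, and the reduction of Cauchy's formula to one variable\<close>

definition cpolydisc :: "(complex ^ 'n) set" where
  "cpolydisc = {z. \<forall>i. norm (z $ i) \<le> 1}"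

definition upd :: "complex ^ 'n \<Rightarrow> 'n \<Rightarrow> complex \<Rightarrow> complex ^ 'n" where
  "upd z i w = (\<chi> j. if j = i then w else z $ j)"

lemma continuous_on_upd [continuous_intros]:
  assumes "continuous_on A f" "continuous_on A g"
  shows "continuous_on A (\<lambda>x. upd (f x) i (g x))"
proof -
  have "continuous_on A (\<lambda>x. if j = i then g x else f x $ j)" for j
    using assms by (cases "j = i") (auto intro!: continuous_intros)
  then show ?thesis
    unfolding upd_def by (intro continuous_on_vec_lambda)
qed

lemma torus_cpolydisc: "torus \<subseteq> cpolydisc"
  by (auto simp: torus_def cpolydisc_def)

lemma polydisc_cpolydisc: "polydisc \<subseteq> cpolydisc"
  by (auto simp: polydisc_def cpolydisc_def less_imp_le)

lemma bounded_on_torus: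
  fixes h :: "complex ^ 'n \<Rightarrow> complex"
  assumes "continuous_on torus h"
  obtains B where "B > 0" "\<And>\<zeta>. \<zeta> \<in> torus \<Longrightarrow> norm (h \<zeta>) \<le> B"
  using compact_imp_bounded[OF compact_continuous_image[OF assms compact_torus]]
  unfolding bounded_pos by auto

lemma one_minus_nonzero: "norm (a * b :: complex) < 1 \<Longrightarrow> 1 - a * b \<noteq> 0"
  by (metis eq_iff_diff_eq_0 norm_one less_irrefl)

lemma kernel_factor_nonzero:
  assumes "a \<in> polydisc" "z \<in> cpolydisc"
  shows "1 - cnj (a $ i) * z $ i \<noteq> 0"
proof (rule one_minus_nonzero)
  have "norm (a $ i) < 1" "norm (z $ i) \<le> 1"
    using assms by (auto simp: polydisc_def cpolydisc_def)
  then have "norm (a $ i) * norm (z $ i) \<le> norm (a $ i)"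
    using mult_left_mono[of "norm (z $ i)" 1 "norm (a $ i)"] by simp
  then show "norm (cnj (a $ i) * z $ i) < 1"
    using \<open>norm (a $ i) < 1\<close> by (simp add: norm_mult)
qed

lemma kernel_factor_cnj_nonzero:
  assumes "a \<in> polydisc" "z \<in> cpolydisc"
  shows "1 - a $ i * cnj (z $ i) \<noteq> 0"
  using kernel_factor_nonzero[OF assms, of i] by (metis complex_cnj_cnj complex_cnj_diff complex_cnj_mult complex_cnj_one complex_cnj_zero)

text \<open>\<open>J\<close> collects the coordinates already evaluated: \<open>h J\<close> has
  \<open>a\<close> inserted there and keeps the kernel factors of the others. Averaging over
  rotations of one more coordinate, together with the formula on the circle, shows that the integral
  of \<open>h J\<close> does not depend on \<open>J\<close>. For \<open>J = {}\<close> it is the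
  left side; for \<open>J = UNIV\<close> the integrand is the constant \<open>F a\<close>.\<close>

lemma torus_cauchy:
  fixes F :: "complex ^ 'n \<Rightarrow> complex"
  assumes a: "a \<in> polydisc" and cont: "continuous_on cpolydisc F"
    and hol: "\<And>z i. z \<in> cpolydisc \<Longrightarrow> (\<lambda>w. F (upd z i w)) holomorphic_on ball 0 1"
  shows "(LINT \<zeta>|torus_measure. F \<zeta> * cnj (szego_kernel a \<zeta>)) = F a"
proof -
  define mix where "mix J \<zeta> = (\<chi> j. if j \<in> J then a $ j else \<zeta> $ j)" for J and \<zeta> :: "complex ^ 'n"
  define R where "R J \<zeta> = (\<Prod>j\<in>-J. 1 / (1 - a $ j * cnj (\<zeta> $ j)))" for J and \<zeta> :: "complex ^ 'n"
  define h where "h J \<zeta> = F (mix J \<zeta>) * R J \<zeta>" for J \<zeta>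
  have norm_a: "norm (a $ j) < 1" for j
    using a by (simp add: polydisc_def)
  have mix_in: "mix J \<zeta> \<in> cpolydisc" if "\<zeta> \<in> torus" for J \<zeta>
    using that norm_a by (auto simp: mix_def cpolydisc_def torus_def less_imp_le)
  have cont_h: "continuous_on torus (h J)" for J
  proof -
    have "continuous_on torus (\<lambda>\<zeta>. mix J \<zeta> $ j)" for j
      by (cases "j \<in> J") (auto simp: mix_def intro!: continuous_intros)
    then have "continuous_on torus (mix J)"
      using continuous_on_vec_lambda[of torus "\<lambda>j \<zeta>. mix J \<zeta> $ j"] by simp
    then show ?thesis
      unfolding h_def R_def
      by (intro continuous_intros continuous_on_compose2[OF cont])
         (use mix_in kernel_factor_cnj_nonzero[OF a] torus_cpolydisc in auto)
  qed
  have step: "(LINT \<zeta>|torus_measure. h (insert i J) \<zeta>) = (LINT \<zeta>|torus_measure. h J \<zeta>)" if "i \<notin> J" for i J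
  proof -
    obtain B where B: "\<And>\<zeta>. \<zeta> \<in> torus \<Longrightarrow> norm (h J \<zeta>) \<le> B"
      using bounded_on_torus[OF cont_h] by blast
    have "(LINT \<theta>|circle_measure. h J (rot i \<theta> \<zeta>)) = h (insert i J) \<zeta>" if \<zeta>: "\<zeta> \<in> torus" for \<zeta>
    proof -
      \<comment> \<open>The circle through \<open>\<zeta>\<close> in coordinate \<open>i\<close> is
        parametrized as \<open>w * \<zeta> $ i\<close> with \<open>w\<close> unimodular. Since
        \<open>\<zeta> $ i\<close> has modulus 1, the evaluation point \<open>a $ i\<close>
        corresponds to \<open>w = b\<close>.\<close>
      define G where "G w = F (upd (mix J \<zeta>) i (w * \<zeta> $ i))" for w
      define b where "b = a $ i * cnj (\<zeta> $ i)"
      have z1: "norm (\<zeta> $ i) = 1"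
        using \<zeta> by (simp add: torus_def)
      have nb: "norm b < 1"
        using norm_a[of i] z1 by (simp add: b_def norm_mult)
      have "continuous_on (cball 0 1) G"
        unfolding G_def
        by (intro continuous_intros continuous_on_compose2[OF cont])
           (use mix_in[OF \<zeta>, of J] z1 in \<open>auto simp: upd_def cpolydisc_def norm_mult\<close>)
      moreover have "G holomorphic_on ball 0 1"
      proof -
        have "((\<lambda>w. F (upd (mix J \<zeta>) i w)) \<circ> (\<lambda>w. w * \<zeta> $ i)) holomorphic_on ball 0 1"
          by (rule holomorphic_on_compose_gen[OF _ hol[OF mix_in[OF \<zeta>]]])
             (auto intro!: holomorphic_intros simp: norm_mult z1)
        then show ?thesis
          by (simp add: G_def[abs_def] o_def)
      qed
      ultimately have "(LINT \<theta>|circle_measure. G (cis \<theta>) / (1 - b * cnj (cis \<theta>))) = G b"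
        by (rule integral_circle_cauchy) (rule nb)
      moreover have "h J (rot i \<theta> \<zeta>) = G (cis \<theta>) / (1 - b * cnj (cis \<theta>)) * R (insert i J) \<zeta>" for \<theta>
      proof -
        have m: "mix J (rot i \<theta> \<zeta>) = upd (mix J \<zeta>) i (cis \<theta> * \<zeta> $ i)"
          using \<open>i \<notin> J\<close> by (auto simp: mix_def rot_def upd_def vec_eq_iff)
        have "-J = insert i (- insert i J)"
          using \<open>i \<notin> J\<close> by auto
        then have "R J (rot i \<theta> \<zeta>) = 1 / (1 - a $ i * cnj (rot i \<theta> \<zeta> $ i)) * (\<Prod>j\<in>- insert i J. 1 / (1 - a $ j * cnj (rot i \<theta> \<zeta> $ j)))"
          unfolding R_def by (metis (no_types, lifting) ComplD finite insertI1 prod.insert)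
        also have "(\<Prod>j\<in>- insert i J. 1 / (1 - a $ j * cnj (rot i \<theta> \<zeta> $ j))) = R (insert i J) \<zeta>"
          unfolding R_def by (intro prod.cong) (auto simp: rot_def)
        finally show ?thesis
          unfolding h_def m G_def by (simp add: rot_def b_def mult_ac)
      qed
      moreover have "G b * R (insert i J) \<zeta> = h (insert i J) \<zeta>"
      proof -
        have "\<zeta> $ i * cnj (\<zeta> $ i) = 1"
          using z1 by (simp add: complex_norm_square[symmetric])
        then have "b * \<zeta> $ i = a $ i"
          by (simp add: b_def mult_ac)
        moreover have "upd (mix J \<zeta>) i (a $ i) = mix (insert i J) \<zeta>"
          by (auto simp: mix_def upd_def vec_eq_iff)
        ultimately show ?thesis
          by (simp add: h_def G_def)
      qed
      ultimately show ?thesis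
        by (simp only: integral_mult_left_zero)
    qed
    then have "(LINT \<zeta>|torus_measure. h (insert i J) \<zeta>) =
        (LINT \<zeta>|torus_measure. (LINT \<theta>|circle_measure. h J (rot i \<theta> \<zeta>)))"
      by (intro Bochner_Integration.integral_cong) auto
    also have "\<dots> = (LINT \<zeta>|torus_measure. h J \<zeta>)"
      by (rule integral_torus_average[OF measurable_torus_continuous[OF cont_h] B, symmetric])
    finally show ?thesis .
  qed
  have "(LINT \<zeta>|torus_measure. h J \<zeta>) = (LINT \<zeta>|torus_measure. h {} \<zeta>)" for J
    using finite[of J] by (induction rule: finite_induct) (auto simp: step)
  from this[of UNIV] have "(LINT \<zeta>|torus_measure. h {} \<zeta>) = measure torus_measure (space (torus_measure :: (complex ^ 'n) measure)) *\<^sub>R F a"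
    by (simp add: h_def mix_def R_def)
  then have "(LINT \<zeta>|torus_measure. h {} \<zeta>) = F a"
    unfolding torus.prob_space by simp
  then show ?thesis
    by (simp add: h_def mix_def R_def szego_kernel_def)
qed

text \<open>Homogeneity of the real derivative over complex scalars is what makes the restriction to
  a complex line complex differentiable; this gives access to the theory of one variable.\<close>

lemma holomorphic_polydisc_line:
  fixes f :: "complex ^ 'n \<Rightarrow> complex"
  assumes "(f has_derivative f') (at (b + w *s v))" "\<And>c v. f' (c *s v) = c * f' v"
  shows "((\<lambda>w. f (b + w *s v)) has_field_derivative f' v) (at w)"
proof -
  have "linear (\<lambda>h. h *s v)"
    by (intro linearI) (auto simp: vec_eq_iff algebra_simps)
  then have "((\<lambda>w. b + w *s v) has_derivative (\<lambda>h. 0 + h *s v)) (at w)"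
    by (intro has_derivative_add has_derivative_const linear_imp_has_derivative)
  from has_derivative_compose[OF this assms(1)]
  have "((\<lambda>w. f (b + w *s v)) has_derivative (\<lambda>h. h * f' v)) (at w)"
    by (simp add: assms(2))
  moreover have "(\<lambda>h. h * f' v) = (*) (f' v)"
    by auto
  ultimately show ?thesis
    by (simp add: has_field_derivative_def)
qed

lemma holomorphic_polydisc_continuous:
  "holomorphic_polydisc f \<Longrightarrow> continuous_on polydisc f"
  unfolding holomorphic_polydisc_def
  by (metis continuous_at_imp_continuous_on has_derivative_continuous)

lemma scaled_in_polydisc: "z \<in> cpolydisc \<Longrightarrow> 0 \<le> r \<Longrightarrow> r < 1 \<Longrightarrow> r *\<^sub>R z \<in> polydisc"
  unfolding polydisc_def cpolydisc_def
  by (auto intro!: le_less_trans[of _ r 1] mult_left_le)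

lemma holomorphic_dilate_continuous:
  assumes "holomorphic_polydisc f" "0 \<le> r" "r < 1"
  shows "continuous_on cpolydisc (\<lambda>z. f (r *\<^sub>R z))"
  by (rule continuous_on_compose2[OF holomorphic_polydisc_continuous[OF assms(1)]])
     (auto intro!: continuous_intros scaled_in_polydisc assms)

lemma holomorphic_dilate_slice:
  fixes f :: "complex ^ 'n \<Rightarrow> complex"
  assumes f: "holomorphic_polydisc f" "0 \<le> r" "r < 1" and z: "z \<in> cpolydisc"
  shows "(\<lambda>w. f (r *\<^sub>R upd z i w)) holomorphic_on ball 0 1"
proof -
  have eq: "r *\<^sub>R upd z i w = r *\<^sub>R upd z i 0 + w *s (axis i (of_real r))" for w
    by (auto simp: vec_eq_iff upd_def axis_def) (simp add: scaleR_conv_of_real)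
  have "\<exists>d. ((\<lambda>w. f (r *\<^sub>R upd z i w)) has_field_derivative d) (at w)" if "w \<in> ball 0 1" for w
  proof -
    have "upd z i w \<in> cpolydisc"
      using that z by (auto simp: upd_def cpolydisc_def)
    then have "r *\<^sub>R upd z i w \<in> polydisc"
      using f by (intro scaled_in_polydisc)
    then obtain f' where f': "(f has_derivative f') (at (r *\<^sub>R upd z i w))" "\<And>c v. f' (c *s v) = c * f' v"
      using f(1) unfolding holomorphic_polydisc_def by blast
    have "((\<lambda>w. f (r *\<^sub>R upd z i 0 + w *s axis i (of_real r))) has_field_derivative f' (axis i (of_real r))) (at w)"
      by (rule holomorphic_polydisc_line) (use f' in \<open>simp_all only: eq[symmetric]\<close>)
    then show ?thesis
      by (auto simp only: eq[symmetric])
  qed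
  then show ?thesis
    by (metis holomorphic_on_open open_ball)
qed

lemma torus_cauchy_dilate:
  assumes "holomorphic_polydisc f" "0 \<le> r" "r < 1" "a \<in> polydisc"
  shows "(LINT \<zeta>|torus_measure. f (r *\<^sub>R \<zeta>) * cnj (szego_kernel a \<zeta>)) = f (r *\<^sub>R a)"
  using assms
  by (intro torus_cauchy holomorphic_dilate_continuous holomorphic_dilate_slice)

section \<open>Closure properties of holomorphy, and regularity of the kernel\<close>

lemma holomorphic_polydiscE:
  assumes "holomorphic_polydisc f" "z \<in> polydisc"
  obtains f' where "(f has_derivative f') (at z)" "\<And>c v. f' (c *s v) = c * f' v"
  using assms unfolding holomorphic_polydisc_def by blast

lemma holomorphic_polydisc_const: "holomorphic_polydisc (\<lambda>z. c)"
  unfolding holomorphic_polydisc_def by (auto intro!: exI[of _ "\<lambda>_. 0"] has_derivative_const)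

lemma holomorphic_polydisc_add:
  assumes "holomorphic_polydisc f" "holomorphic_polydisc g"
  shows "holomorphic_polydisc (\<lambda>z. f z + g z)"
  unfolding holomorphic_polydisc_def
proof
  fix z :: "complex ^ 'a" assume z: "z \<in> polydisc"
  obtain f' where f': "(f has_derivative f') (at z)" "\<And>c v. f' (c *s v) = c * f' v"
    using holomorphic_polydiscE[OF assms(1) z] by blast
  obtain g' where g': "(g has_derivative g') (at z)" "\<And>c v. g' (c *s v) = c * g' v"
    using holomorphic_polydiscE[OF assms(2) z] by blast
  show "\<exists>h. ((\<lambda>z. f z + g z) has_derivative h) (at z) \<and> (\<forall>c v. h (c *s v) = c * h v)"
    by (intro exI conjI, rule has_derivative_add[OF f'(1) g'(1)])
       (simp add: f'(2) g'(2) distrib_left)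
qed

lemma holomorphic_polydisc_mult:
  assumes "holomorphic_polydisc f" "holomorphic_polydisc g"
  shows "holomorphic_polydisc (\<lambda>z. f z * g z)"
  unfolding holomorphic_polydisc_def
proof
  fix z :: "complex ^ 'a" assume z: "z \<in> polydisc"
  obtain f' where f': "(f has_derivative f') (at z)" "\<And>c v. f' (c *s v) = c * f' v"
    using holomorphic_polydiscE[OF assms(1) z] by blast
  obtain g' where g': "(g has_derivative g') (at z)" "\<And>c v. g' (c *s v) = c * g' v"
    using holomorphic_polydiscE[OF assms(2) z] by blast
  show "\<exists>h. ((\<lambda>z. f z * g z) has_derivative h) (at z) \<and> (\<forall>c v. h (c *s v) = c * h v)"
    by (intro exI conjI, rule has_derivative_mult[OF f'(1) g'(1)])
       (simp add: f'(2) g'(2) algebra_simps)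
qed

lemma holomorphic_polydisc_prod:
  "finite A \<Longrightarrow> (\<And>a. a \<in> A \<Longrightarrow> holomorphic_polydisc (f a)) \<Longrightarrow> holomorphic_polydisc (\<lambda>z. \<Prod>a\<in>A. f a z)"
  by (induction A rule: finite_induct) (auto intro: holomorphic_polydisc_const holomorphic_polydisc_mult)

lemma szego_kernel_holomorphic:
  assumes a: "a \<in> polydisc"
  shows "holomorphic_polydisc (szego_kernel a)"
proof -
  have "holomorphic_polydisc (\<lambda>z. 1 / (1 - cnj (a $ i) * z $ i))" for i
    unfolding holomorphic_polydisc_def
  proof
    fix z :: "complex ^ 'a" assume "z \<in> polydisc"
    then have "1 - cnj (a $ i) * z $ i \<noteq> 0"
      using kernel_factor_nonzero[OF a] polydisc_cpolydisc by blast
    then have "(\<lambda>u. 1 / (1 - cnj (a $ i) * u)) field_differentiable at (z $ i)"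
      by (intro derivative_intros)
    then obtain d where "((\<lambda>u. 1 / (1 - cnj (a $ i) * u)) has_field_derivative d) (at (z $ i))"
      unfolding field_differentiable_def by blast
    then have "((\<lambda>u. 1 / (1 - cnj (a $ i) * u)) has_derivative (*) d) (at (z $ i))"
      by (simp add: has_field_derivative_def)
    moreover have "((\<lambda>z :: complex ^ 'a. z $ i) has_derivative (\<lambda>z. z $ i)) (at z)"
      by (rule bounded_linear.has_derivative[OF bounded_linear_vec_nth has_derivative_ident])
    ultimately have "((\<lambda>z. 1 / (1 - cnj (a $ i) * z $ i)) has_derivative (\<lambda>h. d * h $ i)) (at z)"
      by (rule has_derivative_compose[rotated])
    then show "\<exists>h. ((\<lambda>z. 1 / (1 - cnj (a $ i) * z $ i)) has_derivative h) (at z) \<and> (\<forall>c v. h (c *s v) = c * h v)"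
      by (intro exI conjI) auto
  qed
  then show ?thesis
    unfolding szego_kernel_def[abs_def] by (intro holomorphic_polydisc_prod) auto
qed

lemma szego_kernel_continuous:
  assumes a: "a \<in> polydisc"
  shows "continuous_on cpolydisc (szego_kernel a)"
  unfolding szego_kernel_def[abs_def]
  by (intro continuous_intros) (use kernel_factor_nonzero[OF a] in auto)

lemma szego_kernel_slice:
  assumes a: "a \<in> polydisc" and z: "z \<in> cpolydisc"
  shows "(\<lambda>w. szego_kernel a (upd z i w)) holomorphic_on ball 0 1"
proof -
  have "(\<lambda>w. 1 / (1 - cnj (a $ j) * upd z i w $ j)) holomorphic_on ball 0 1" for j
  proof (cases "j = i")
    case True
    have "1 - cnj (a $ i) * w \<noteq> 0" if "w \<in> ball 0 1" for w
      using kernel_factor_nonzero[OF a, of "upd z i w" i] that z by (auto simp: upd_def cpolydisc_def)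
    with True show ?thesis
      by (auto simp: upd_def intro!: holomorphic_intros)
  qed (simp add: upd_def)
  then show ?thesis
    unfolding szego_kernel_def by (intro holomorphic_on_prod)
qed

text \<open>The value of the kernel on the diagonal, by \<open>szego_kernel_diag\<close>, and the
  square of its L^2 norm, by \<open>integral_szego_kernel_sq\<close>. All other kernel norms are
  compared with powers of it.\<close>

definition kdiag :: "complex ^ 'n \<Rightarrow> real" where
  "kdiag a = (\<Prod>i\<in>UNIV. 1 / (1 - (norm (a $ i))\<^sup>2))"

lemma szego_kernel_diag: "szego_kernel a a = of_real (kdiag a)"
  by (simp add: szego_kernel_def kdiag_def mult.commute[of "cnj _"] complex_norm_square[symmetric])

lemma norm_sq_less_1: "a \<in> polydisc \<Longrightarrow> (norm (a $ i))\<^sup>2 < 1"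
  by (simp add: polydisc_def abs_square_less_1)

lemma kdiag_ge_1: "a \<in> polydisc \<Longrightarrow> 1 \<le> kdiag a"
  unfolding kdiag_def using norm_sq_less_1[of a] by (intro prod_ge_1) (simp add: field_simps)

lemma kdiag_pos: "a \<in> polydisc \<Longrightarrow> 0 < kdiag a"
  using kdiag_ge_1[of a] by simp

text \<open>With \<open>x = norm (a $ i)\<close>, each denominator has modulus at least
  \<open>1 - x\<close>, and \<open>1 - x\<^sup>2 \<le> 2 * (1 - x)\<close>; hence one factor 2 per
  coordinate.\<close>

lemma norm_szego_kernel_le:
  fixes a :: "complex ^ 'n"
  assumes a: "a \<in> polydisc" and z: "z \<in> cpolydisc"
  shows "norm (szego_kernel a z) \<le> 2 ^ CARD('n) * kdiag a"
proof -
  have "norm (1 / (1 - cnj (a $ i) * z $ i)) \<le> 2 * (1 / (1 - (norm (a $ i))\<^sup>2))" for i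
  proof -
    define x where "x = norm (a $ i)"
    have x: "0 \<le> x" "x < 1"
      using a by (auto simp: x_def polydisc_def)
    have "norm (cnj (a $ i) * z $ i) \<le> x"
      using z by (simp add: x_def norm_mult cpolydisc_def mult_left_le)
    then have "1 - x \<le> norm (1 - cnj (a $ i) * z $ i)"
      using norm_triangle_ineq2[of 1 "cnj (a $ i) * z $ i"] by simp
    then have "1 / norm (1 - cnj (a $ i) * z $ i) \<le> 1 / (1 - x)"
      using x by (intro divide_left_mono mult_pos_pos) auto
    also have "\<dots> \<le> 2 / (1 - x\<^sup>2)"
    proof -
      have "1 - x\<^sup>2 = (1 - x) * (1 + x)"
        by (simp add: power2_eq_square algebra_simps)
      moreover have "0 < (1 - x) * (1 + x)"
        using x by (intro mult_pos_pos) auto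
      ultimately show ?thesis
        using x by (simp add: divide_simps)
    qed
    finally show ?thesis
      by (simp add: norm_divide x_def)
  qed
  then have "norm (szego_kernel a z) \<le> (\<Prod>i\<in>UNIV. 2 * (1 / (1 - (norm (a $ i))\<^sup>2)))"
    unfolding szego_kernel_def prod_norm[symmetric] by (intro prod_mono) auto
  then show ?thesis
    by (simp only: prod.distrib kdiag_def prod_constant)
qed

text \<open>Cauchy's formula applied to the kernel itself evaluates the integral as
  \<open>szego_kernel a a\<close>.\<close>

lemma integral_szego_kernel_sq:
  fixes a :: "complex ^ 'n"
  assumes a: "a \<in> polydisc"
  shows "(LINT \<zeta>|torus_measure. (norm (szego_kernel a \<zeta>))\<^sup>2) = kdiag a"
proof -
  have "(LINT \<zeta>|torus_measure. szego_kernel a \<zeta> * cnj (szego_kernel a \<zeta>)) = szego_kernel a a"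
    using a by (intro torus_cauchy szego_kernel_continuous szego_kernel_slice)
  then have "(LINT \<zeta>|torus_measure. complex_of_real ((norm (szego_kernel a \<zeta>))\<^sup>2)) = of_real (kdiag a)"
    by (simp add: complex_norm_square szego_kernel_diag del: of_real_power)
  then show ?thesis
    by (metis integral_complex_of_real of_real_eq_iff)
qed

lemma szego_kernel_measurable: "a \<in> polydisc \<Longrightarrow> szego_kernel a \<in> borel_measurable torus_measure"
  by (intro measurable_torus_continuous continuous_on_subset[OF szego_kernel_continuous torus_cpolydisc])

lemma nn_integral_szego_kernel_sq:
  assumes a: "a \<in> polydisc"
  shows "(\<integral>\<^sup>+ \<zeta>. ennreal ((norm (szego_kernel a \<zeta>))\<^sup>2) \<partial>torus_measure) = ennreal (kdiag a)"
proof -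
  \<comment> \<open>A nonzero value forces integrability, because the integral of a function that is
    not integrable is 0 by convention.\<close>
  have "integrable torus_measure (\<lambda>\<zeta>. (norm (szego_kernel a \<zeta>))\<^sup>2)"
    using integral_szego_kernel_sq[OF a] kdiag_pos[OF a] not_integrable_integral_eq by force
  then show ?thesis
    using integral_szego_kernel_sq[OF a] by (simp add: nn_integral_eq_integral)
qed

text \<open>Together with \<open>kdiag_dilate_torus\<close> this makes
  \<open>poisson_weight (r *\<^sub>R \<zeta>) \<eta>\<close> symmetric in two points of the torus,
  so that its mass is 1 in either variable.\<close>

lemma norm_szego_kernel_commute:
  "norm (szego_kernel (r *\<^sub>R a) z) = norm (szego_kernel (r *\<^sub>R z) a)"
proof -
  have "norm (1 - cnj ((r *\<^sub>R a) $ i) * z $ i) = norm (1 - cnj ((r *\<^sub>R z) $ i) * a $ i)" for i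
  proof -
    have "1 - cnj ((r *\<^sub>R a) $ i) * z $ i = cnj (1 - cnj ((r *\<^sub>R z) $ i) * a $ i)"
      by (simp add: mult_ac)
    then show ?thesis
      by (metis complex_mod_cnj)
  qed
  then show ?thesis
    unfolding szego_kernel_def prod_norm[symmetric] norm_divide by simp
qed

lemma kdiag_dilate_torus: "z \<in> torus \<Longrightarrow> kdiag (r *\<^sub>R z) = (\<Prod>i::'n\<in>UNIV. 1 / (1 - r\<^sup>2))" for z :: "complex ^ 'n"
  unfolding kdiag_def by (intro prod.cong) (auto simp: torus_def power_mult_distrib)

section \<open>Boundary values\<close>

lemma compact_cpolydisc: "compact (cpolydisc :: (complex ^ 'n) set)"
proof -
  have "(cpolydisc :: (complex ^ 'n) set) = (\<Inter>i. {z. norm (z $ i) \<le> 1})"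
    by (auto simp: cpolydisc_def)
  moreover have "closed (\<Inter>i. {z :: complex ^ 'n. norm (z $ i) \<le> 1})"
    by (intro closed_INT ballI closed_Collect_le continuous_intros)
  moreover have "norm z \<le> real CARD('n)" if "z \<in> cpolydisc" for z :: "complex ^ 'n"
  proof -
    have "norm z \<le> (\<Sum>i\<in>UNIV. norm (z $ i))"
      using L2_set_le_sum[of UNIV "\<lambda>i. norm (z $ i)"] by (simp add: norm_vec_def)
    also have "\<dots> \<le> (\<Sum>i\<in>(UNIV :: 'n set). 1)"
      using that by (intro sum_mono) (auto simp: cpolydisc_def)
    finally show ?thesis by simp
  qed
  then have "bounded (cpolydisc :: (complex ^ 'n) set)"
    by (auto simp: bounded_iff)
  ultimately show ?thesis
    by (simp add: compact_eq_bounded_closed)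
qed

lemma open_polydisc: "open (polydisc :: (complex ^ 'n) set)"
proof -
  have "(polydisc :: (complex ^ 'n) set) = (\<Inter>i. {z. norm (z $ i) < 1})"
    by (auto simp: polydisc_def)
  moreover have "open (\<Inter>i. {z :: complex ^ 'n. norm (z $ i) < 1})"
    by (intro open_INT ballI open_Collect_less continuous_intros) auto
  ultimately show ?thesis by simp
qed

lemma eventually_at_left_1: "\<forall>\<^sub>F r in at_left (1::real). 0 < r \<and> r < 1"
  using eventually_at_left_real[of 0 "1::real"] by (auto elim: eventually_mono)

lemma torus_scaled: "\<zeta> \<in> torus \<Longrightarrow> 0 \<le> r \<Longrightarrow> r < 1 \<Longrightarrow> r *\<^sub>R \<zeta> \<in> polydisc"
  using scaled_in_polydisc torus_cpolydisc by blast

lemma measurable_cpolydisc_continuous: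
  fixes f :: "complex ^ 'n \<Rightarrow> 'b::topological_space"
  shows "continuous_on cpolydisc f \<Longrightarrow> f \<in> borel_measurable torus_measure"
  by (intro measurable_torus_continuous continuous_on_subset[OF _ torus_cpolydisc])

lemma dilate_measurable:
  "holomorphic_polydisc f \<Longrightarrow> 0 \<le> r \<Longrightarrow> r < 1 \<Longrightarrow> (\<lambda>\<zeta>. f (r *\<^sub>R \<zeta>)) \<in> borel_measurable torus_measure"
  by (intro measurable_cpolydisc_continuous holomorphic_dilate_continuous)

lemma bounded_on_cpolydisc:
  fixes h :: "complex ^ 'n \<Rightarrow> complex"
  assumes "continuous_on cpolydisc h"
  obtains B where "B > 0" "\<And>\<zeta>. \<zeta> \<in> cpolydisc \<Longrightarrow> norm (h \<zeta>) \<le> B"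
  using compact_imp_bounded[OF compact_continuous_image[OF assms compact_cpolydisc]]
  unfolding bounded_pos by auto

lemma dilate_uniform:
  fixes f :: "complex ^ 'n \<Rightarrow> complex"
  assumes cont: "continuous_on cpolydisc f" and "e > 0"
  shows "\<forall>\<^sub>F r in at_left (1::real). \<forall>\<zeta>\<in>torus. norm (f (r *\<^sub>R \<zeta>) - f \<zeta>) < e"
proof -
  have "uniformly_continuous_on cpolydisc f"
    by (rule compact_uniformly_continuous[OF cont compact_cpolydisc])
  then obtain d where d: "d > 0" "\<And>x y. x \<in> cpolydisc \<Longrightarrow> y \<in> cpolydisc \<Longrightarrow> dist y x < d \<Longrightarrow> dist (f y) (f x) < e"
    using \<open>e > 0\<close> unfolding uniformly_continuous_on_def by blast
  obtain B where B: "B > 0" "\<And>\<zeta> :: complex ^ 'n. \<zeta> \<in> torus \<Longrightarrow> norm \<zeta> \<le> B"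
    using compact_imp_bounded[OF compact_torus] unfolding bounded_pos by auto
  have "((\<lambda>r. (1 - r) * B) \<longlongrightarrow> (1 - 1) * B) (at_left (1::real))"
    by (intro tendsto_intros)
  then have "\<forall>\<^sub>F r in at_left (1::real). (1 - r) * B < d"
    using d(1) by (intro order_tendstoD(2)) auto
  with eventually_at_left_1 show ?thesis
  proof eventually_elim
    case (elim r)
    show ?case
    proof
      fix \<zeta> :: "complex ^ 'n" assume \<zeta>: "\<zeta> \<in> torus"
      have "r *\<^sub>R \<zeta> - \<zeta> = (r - 1) *\<^sub>R \<zeta>"
        by (simp add: algebra_simps)
      then have "dist (r *\<^sub>R \<zeta>) \<zeta> = (1 - r) * norm \<zeta>"
        using elim by (simp add: dist_norm)
      also have "\<dots> \<le> (1 - r) * B"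
        using elim B(2)[OF \<zeta>] by (intro mult_left_mono) auto
      finally show "norm (f (r *\<^sub>R \<zeta>) - f \<zeta>) < e"
        using d(2)[of \<zeta> "r *\<^sub>R \<zeta>"] elim torus_scaled[OF \<zeta>, of r] \<zeta> torus_cpolydisc polydisc_cpolydisc
        by (auto simp: dist_norm)
    qed
  qed
qed

lemma nn_integral_torus_const: "(\<integral>\<^sup>+ \<zeta>. c \<partial>(torus_measure :: (complex ^ 'n) measure)) = c"
  by (simp only: nn_integral_const torus.emeasure_space_1 mult_1_right)

lemma has_boundary_value_iff:
  "has_boundary_value f g \<longleftrightarrow> g \<in> borel_measurable torus_measure \<and>
     (\<forall>e>0. \<forall>\<^sub>F r in at_left 1. (\<integral>\<^sup>+ \<zeta>. ennreal (norm (f (r *\<^sub>R \<zeta>) - g \<zeta>)) \<partial>torus_measure) < ennreal e)"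
  unfolding has_boundary_value_def
  by (auto intro: tendsto_zero_ennreal elim: order_tendstoD(2))

lemma has_boundary_valueD:
  assumes "has_boundary_value f g" "e > 0"
  shows "\<forall>\<^sub>F r in at_left 1. (\<integral>\<^sup>+ \<zeta>. ennreal (norm (f (r *\<^sub>R \<zeta>) - g \<zeta>)) \<partial>torus_measure) < ennreal e"
  using assms has_boundary_value_iff by blast

lemma has_boundary_value_measurable:
  "has_boundary_value f g \<Longrightarrow> g \<in> borel_measurable torus_measure"
  by (simp add: has_boundary_value_def)

lemma has_boundary_value_cong:
  assumes "\<And>z. z \<in> polydisc \<Longrightarrow> f z = f' z"
  shows "has_boundary_value f g \<longleftrightarrow> has_boundary_value f' g"
proof -
  have "\<forall>\<^sub>F r in at_left 1. (\<integral>\<^sup>+ \<zeta>. ennreal (norm (f (r *\<^sub>R \<zeta>) - g \<zeta>)) \<partial>torus_measure)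
     = (\<integral>\<^sup>+ \<zeta>. ennreal (norm (f' (r *\<^sub>R \<zeta>) - g \<zeta>)) \<partial>torus_measure)"
    using eventually_at_left_1
    by eventually_elim (auto intro!: nn_integral_cong simp: assms torus_scaled)
  then show ?thesis
    unfolding has_boundary_value_def by (simp add: filterlim_cong)
qed

lemma has_boundary_value_unique:
  assumes f: "holomorphic_polydisc f" and g: "has_boundary_value f g" and h: "has_boundary_value f h"
  shows "AE \<zeta> in torus_measure. g \<zeta> = h \<zeta>"
proof -
  note [measurable] = has_boundary_value_measurable[OF g] has_boundary_value_measurable[OF h]
  let ?D = "\<lambda>g r. \<integral>\<^sup>+ \<zeta>. ennreal (norm (f (r *\<^sub>R \<zeta>) - g \<zeta>)) \<partial>torus_measure"
  have "((\<lambda>r. ?D g r + ?D h r) \<longlongrightarrow> 0 + 0) (at_left 1)"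
    using g h unfolding has_boundary_value_def by (intro tendsto_add) auto
  moreover have "\<forall>\<^sub>F r in at_left 1. (\<integral>\<^sup>+ \<zeta>. ennreal (norm (g \<zeta> - h \<zeta>)) \<partial>torus_measure) \<le> ?D g r + ?D h r"
    using eventually_at_left_1
  proof eventually_elim
    case (elim r)
    then have [measurable]: "(\<lambda>\<zeta>. f (r *\<^sub>R \<zeta>)) \<in> borel_measurable torus_measure"
      by (intro dilate_measurable f) auto
    have "norm (g \<zeta> - h \<zeta>) \<le> norm (f (r *\<^sub>R \<zeta>) - g \<zeta>) + norm (f (r *\<^sub>R \<zeta>) - h \<zeta>)" for \<zeta>
      using norm_triangle_ineq4[of "f (r *\<^sub>R \<zeta>) - h \<zeta>" "f (r *\<^sub>R \<zeta>) - g \<zeta>"] by simp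
    then have "(\<integral>\<^sup>+ \<zeta>. ennreal (norm (g \<zeta> - h \<zeta>)) \<partial>torus_measure) \<le>
       (\<integral>\<^sup>+ \<zeta>. ennreal (norm (f (r *\<^sub>R \<zeta>) - g \<zeta>)) + ennreal (norm (f (r *\<^sub>R \<zeta>) - h \<zeta>)) \<partial>torus_measure)"
      by (intro nn_integral_mono) (simp flip: ennreal_plus)
    also have "\<dots> = ?D g r + ?D h r"
      by (rule nn_integral_add) measurable
    finally show ?case .
  qed
  ultimately have "(\<integral>\<^sup>+ \<zeta>. ennreal (norm (g \<zeta> - h \<zeta>)) \<partial>torus_measure) \<le> 0 + 0"
    by (rule tendsto_lowerbound) simp
  then show ?thesis
    by (simp add: nn_integral_0_iff_AE)
qed

text \<open>\<open>boundary_value\<close> is picked by \<open>SOME\<close>; a boundary function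
  found by other means is transferred to it through almost everywhere uniqueness.\<close>

lemma boundary_value_AE:
  assumes "holomorphic_polydisc f" "has_boundary_value f g"
  shows "has_boundary_value f (boundary_value f)" "AE \<zeta> in torus_measure. boundary_value f \<zeta> = g \<zeta>"
proof -
  show *: "has_boundary_value f (boundary_value f)"
    unfolding boundary_value_def by (rule someI[of "has_boundary_value f", OF assms(2)])
  show "AE \<zeta> in torus_measure. boundary_value f \<zeta> = g \<zeta>"
    by (rule has_boundary_value_unique[OF assms(1) * assms(2)])
qed

lemma Lp_norm_cong_AE:
  assumes "f \<in> borel_measurable torus_measure" "g \<in> borel_measurable torus_measure"
    and "AE \<zeta> in torus_measure. f \<zeta> = g \<zeta>"
  shows "Lp_norm p f = Lp_norm p g"
proof -
  have "esssup torus_measure (\<lambda>\<zeta>. ennreal (norm (f \<zeta>))) = esssup torus_measure (\<lambda>\<zeta>. ennreal (norm (g \<zeta>)))"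
    using assms by (intro esssup_AE_cong) auto
  moreover have "(\<integral>\<^sup>+ \<zeta>. ennreal (norm (f \<zeta>) powr enn2real p) \<partial>torus_measure) =
      (\<integral>\<^sup>+ \<zeta>. ennreal (norm (g \<zeta>) powr enn2real p) \<partial>torus_measure)"
    using assms(3) by (intro nn_integral_cong_AE) auto
  ultimately show ?thesis
    by (simp add: Lp_norm_def)
qed

lemma hardy_norm_eq:
  assumes "holomorphic_polydisc f" "has_boundary_value f g"
  shows "hardy_norm p f = Lp_norm p g"
  unfolding hardy_norm_def using boundary_value_AE[OF assms] has_boundary_value_measurable assms(2)
  by (intro Lp_norm_cong_AE) auto

text \<open>Some dilate of \<open>f\<close> lies at finite L^1 distance from \<open>g\<close>, and a
  dilate is bounded on the torus.\<close>

lemma has_boundary_value_integrable: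
  assumes f: "holomorphic_polydisc f" and g: "has_boundary_value f g"
  shows "integrable torus_measure g"
proof -
  note [measurable] = has_boundary_value_measurable[OF g]
  have "\<forall>\<^sub>F r in at_left (1::real). (0 < r \<and> r < 1) \<and> (\<integral>\<^sup>+ \<zeta>. ennreal (norm (f (r *\<^sub>R \<zeta>) - g \<zeta>)) \<partial>torus_measure) < ennreal 1"
    by (intro eventually_conj eventually_at_left_1 has_boundary_valueD[OF g]) simp
  then obtain r where r: "0 < r" "r < 1" "(\<integral>\<^sup>+ \<zeta>. ennreal (norm (f (r *\<^sub>R \<zeta>) - g \<zeta>)) \<partial>torus_measure) < ennreal 1"
    using eventually_happens trivial_limit_at_left_real by blast
  have [measurable]: "(\<lambda>\<zeta>. f (r *\<^sub>R \<zeta>)) \<in> borel_measurable torus_measure"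
    using r by (intro dilate_measurable f) auto
  have "continuous_on cpolydisc (\<lambda>\<zeta>. f (r *\<^sub>R \<zeta>))"
    using r by (intro holomorphic_dilate_continuous f) auto
  then obtain B where B: "\<And>\<zeta>. \<zeta> \<in> cpolydisc \<Longrightarrow> norm (f (r *\<^sub>R \<zeta>)) \<le> B"
    using bounded_on_cpolydisc by blast
  have "integrable torus_measure (\<lambda>\<zeta>. f (r *\<^sub>R \<zeta>))"
    using B torus_cpolydisc by (intro torus.integrable_const_bound[where B=B] AE_I2) auto
  moreover have "integrable torus_measure (\<lambda>\<zeta>. f (r *\<^sub>R \<zeta>) - g \<zeta>)"
    by (rule integrableI_bounded) (use r(3) in \<open>auto intro: less_trans\<close>)
  ultimately have "integrable torus_measure (\<lambda>\<zeta>. f (r *\<^sub>R \<zeta>) - (f (r *\<^sub>R \<zeta>) - g \<zeta>))"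
    by (rule Bochner_Integration.integrable_diff)
  then show ?thesis by simp
qed

lemma has_boundary_value_continuous:
  assumes "continuous_on cpolydisc f"
  shows "has_boundary_value f f"
  unfolding has_boundary_value_iff
proof (intro conjI allI impI)
  show "f \<in> borel_measurable torus_measure"
    by (rule measurable_cpolydisc_continuous[OF assms])
  fix e :: real assume "e > 0"
  then have "e / 2 > 0" by simp
  from dilate_uniform[OF assms this]
  show "\<forall>\<^sub>F r in at_left 1. (\<integral>\<^sup>+ \<zeta>. ennreal (norm (f (r *\<^sub>R \<zeta>) - f \<zeta>)) \<partial>torus_measure) < ennreal e"
  proof eventually_elim
    case (elim r)
    have "(\<integral>\<^sup>+ \<zeta>. ennreal (norm (f (r *\<^sub>R \<zeta>) - f \<zeta>)) \<partial>torus_measure) \<le> (\<integral>\<^sup>+ \<zeta>. ennreal (e / 2) \<partial>(torus_measure :: (complex ^ 'a) measure))"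
      using elim by (intro nn_integral_mono ennreal_leI) (auto intro: less_imp_le)
    also have "\<dots> = ennreal (e / 2)"
      by (rule nn_integral_torus_const)
    also have "\<dots> < ennreal e"
      using \<open>e > 0\<close> by (intro ennreal_lessI) auto
    finally show ?case .
  qed
qed

lemma has_boundary_value_mult:
  assumes f: "holomorphic_polydisc f" and g: "has_boundary_value f g" and F: "continuous_on cpolydisc F"
  shows "has_boundary_value (\<lambda>z. f z * F z) (\<lambda>z. g z * F z)"
  unfolding has_boundary_value_iff
proof (intro conjI allI impI)
  note [measurable] = has_boundary_value_measurable[OF g] measurable_cpolydisc_continuous[OF F]
  show "(\<lambda>z. g z * F z) \<in> borel_measurable torus_measure"
    by measurable
  fix e :: real assume e: "e > 0"
  obtain B where B: "B > 0" "\<And>\<zeta>. \<zeta> \<in> cpolydisc \<Longrightarrow> norm (F \<zeta>) \<le> B"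
    using bounded_on_cpolydisc[OF F] by blast
  have int: "integrable torus_measure (\<lambda>\<zeta>. norm (g \<zeta>))"
    using has_boundary_value_integrable[OF f g] by auto
  define G where "G = (LINT \<zeta>|torus_measure. norm (g \<zeta>))"
  have G: "(\<integral>\<^sup>+ \<zeta>. ennreal (norm (g \<zeta>)) \<partial>torus_measure) = ennreal G" "G \<ge> 0"
    unfolding G_def using int by (auto simp: nn_integral_eq_integral)
  \<comment> \<open>The difference of the products splits into a small change of \<open>f\<close>
    times a bounded factor and a uniformly small change of \<open>F\<close> times \<open>g\<close>.
    These tolerances make each part at most \<open>e / 3\<close> in the mean; \<open>G + 1\<close>
    keeps the divisor positive when \<open>g\<close> vanishes.\<close>
  have "e / (3 * B) > 0" "e / (3 * (G + 1)) > 0"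
    using e B(1) G(2) by auto
  from has_boundary_valueD[OF g this(1)] dilate_uniform[OF F this(2)] eventually_at_left_1
  show "\<forall>\<^sub>F r in at_left 1. (\<integral>\<^sup>+ \<zeta>. ennreal (norm (f (r *\<^sub>R \<zeta>) * F (r *\<^sub>R \<zeta>) - g \<zeta> * F \<zeta>)) \<partial>torus_measure) < ennreal e"
  proof eventually_elim
    case (elim r)
    then have [measurable]: "(\<lambda>\<zeta>. f (r *\<^sub>R \<zeta>)) \<in> borel_measurable torus_measure"
      by (auto intro!: dilate_measurable f)
    have "norm (f (r *\<^sub>R \<zeta>) * F (r *\<^sub>R \<zeta>) - g \<zeta> * F \<zeta>) \<le>
        B * norm (f (r *\<^sub>R \<zeta>) - g \<zeta>) + e / (3 * (G + 1)) * norm (g \<zeta>)" if "\<zeta> \<in> torus" for \<zeta>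
    proof -
      have F1: "norm (F (r *\<^sub>R \<zeta>)) \<le> B"
        using B(2)[of "r *\<^sub>R \<zeta>"] torus_scaled[OF that, of r] elim polydisc_cpolydisc by auto
      have F2: "norm (F (r *\<^sub>R \<zeta>) - F \<zeta>) \<le> e / (3 * (G + 1))"
        using elim that by (auto intro: less_imp_le)
      have "f (r *\<^sub>R \<zeta>) * F (r *\<^sub>R \<zeta>) - g \<zeta> * F \<zeta> =
          F (r *\<^sub>R \<zeta>) * (f (r *\<^sub>R \<zeta>) - g \<zeta>) + (F (r *\<^sub>R \<zeta>) - F \<zeta>) * g \<zeta>"
        by (simp add: algebra_simps)
      then have "norm (f (r *\<^sub>R \<zeta>) * F (r *\<^sub>R \<zeta>) - g \<zeta> * F \<zeta>) \<le>
          norm (F (r *\<^sub>R \<zeta>)) * norm (f (r *\<^sub>R \<zeta>) - g \<zeta>) + norm (F (r *\<^sub>R \<zeta>) - F \<zeta>) * norm (g \<zeta>)"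
        by (metis norm_mult norm_triangle_ineq)
      also have "\<dots> \<le> B * norm (f (r *\<^sub>R \<zeta>) - g \<zeta>) + e / (3 * (G + 1)) * norm (g \<zeta>)"
        using F1 F2 by (intro add_mono mult_right_mono) auto
      finally show ?thesis .
    qed
    then have "(\<integral>\<^sup>+ \<zeta>. ennreal (norm (f (r *\<^sub>R \<zeta>) * F (r *\<^sub>R \<zeta>) - g \<zeta> * F \<zeta>)) \<partial>torus_measure) \<le>
        (\<integral>\<^sup>+ \<zeta>. ennreal B * ennreal (norm (f (r *\<^sub>R \<zeta>) - g \<zeta>)) + ennreal (e / (3 * (G + 1))) * ennreal (norm (g \<zeta>)) \<partial>torus_measure)"
      using B(1) e G(2) by (intro nn_integral_mono) (simp flip: ennreal_plus ennreal_mult)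
    also have "\<dots> = ennreal B * (\<integral>\<^sup>+ \<zeta>. ennreal (norm (f (r *\<^sub>R \<zeta>) - g \<zeta>)) \<partial>torus_measure) + ennreal (e / (3 * (G + 1))) * ennreal G"
      unfolding G(1)[symmetric] by (subst nn_integral_add) (auto simp: nn_integral_cmult)
    also have "\<dots> \<le> ennreal B * ennreal (e / (3 * B)) + ennreal (e / (3 * (G + 1))) * ennreal G"
      using elim by (intro add_mono mult_left_mono) auto
    also have "\<dots> = ennreal (e / 3 + e / 3 * (G / (G + 1)))"
      using B(1) e G(2) by (simp flip: ennreal_plus ennreal_mult)
    also have "\<dots> < ennreal e"
    proof (rule ennreal_lessI)
      have "G / (G + 1) \<le> 1"
        using G(2) by simp
      then have "e / 3 * (G / (G + 1)) \<le> e / 3 * 1"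
        using e by (intro mult_left_mono) auto
      then show "e / 3 + e / 3 * (G / (G + 1)) < e"
        using e by linarith
    qed (rule e)
    finally show ?case .
  qed
qed

lemma holomorphic_polydisc_isCont:
  assumes "holomorphic_polydisc f" "z \<in> polydisc"
  shows "isCont f z"
  using assms unfolding holomorphic_polydisc_def by (metis has_derivative_continuous)

lemma borel_measurable_cnj [measurable (raw)]:
  "f \<in> borel_measurable M \<Longrightarrow> (\<lambda>x. cnj (f x)) \<in> borel_measurable M"
  by (rule measurable_compose[OF _ borel_measurable_continuous_onI]) (auto intro: continuous_intros)

text \<open>The formula holds for dilates by \<open>torus_cauchy_dilate\<close>. As \<open>r\<close>
  tends to 1, the left side converges by continuity of \<open>f\<close> at \<open>z\<close>, the
  right side by L^1 convergence, because the kernel at \<open>z\<close> is bounded on the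
  torus.\<close>

lemma cauchy_boundary_value:
  fixes f :: "complex ^ 'n \<Rightarrow> complex"
  assumes f: "holomorphic_polydisc f" and g: "has_boundary_value f g" and z: "z \<in> polydisc"
  shows "f z = (LINT \<zeta>|torus_measure. g \<zeta> * cnj (szego_kernel z \<zeta>))"
    and "integrable torus_measure (\<lambda>\<zeta>. g \<zeta> * cnj (szego_kernel z \<zeta>))"
proof -
  note [measurable] = has_boundary_value_measurable[OF g] szego_kernel_measurable[OF z]
  define B where "B = 2 ^ CARD('n) * kdiag z"
  have B: "B > 0" "\<And>\<zeta>. \<zeta> \<in> torus \<Longrightarrow> norm (szego_kernel z \<zeta>) \<le> B"
    using norm_szego_kernel_le[OF z] torus_cpolydisc kdiag_pos[OF z] by (auto simp: B_def)
  have int: "integrable torus_measure (\<lambda>\<zeta>. h \<zeta> * cnj (szego_kernel z \<zeta>))" if "integrable torus_measure h" for h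
  proof (rule Bochner_Integration.integrable_bound[where f="\<lambda>\<zeta>. B * norm (h \<zeta>)"])
    show "AE \<zeta> in torus_measure. norm (h \<zeta> * cnj (szego_kernel z \<zeta>)) \<le> norm (B * norm (h \<zeta>))"
      using B by (intro AE_I2) (auto simp: norm_mult mult.commute[of B] intro!: mult_left_mono)
    show "(\<lambda>\<zeta>. h \<zeta> * cnj (szego_kernel z \<zeta>)) \<in> borel_measurable torus_measure"
      using borel_measurable_integrable[OF that] by measurable
  qed (use that in auto)
  show int_g: "integrable torus_measure (\<lambda>\<zeta>. g \<zeta> * cnj (szego_kernel z \<zeta>))"
    by (intro int has_boundary_value_integrable[OF f g])
  define L where "L = (LINT \<zeta>|torus_measure. g \<zeta> * cnj (szego_kernel z \<zeta>))"
  have "isCont f (1 *\<^sub>R z)"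
    using holomorphic_polydisc_isCont[OF f z] by simp
  moreover have "((\<lambda>r. r *\<^sub>R z) \<longlongrightarrow> 1 *\<^sub>R z) (at_left (1::real))"
    by (intro tendsto_intros)
  ultimately have "((\<lambda>r. f (r *\<^sub>R z)) \<longlongrightarrow> f (1 *\<^sub>R z)) (at_left (1::real))"
    by (rule isCont_tendsto_compose)
  moreover have "((\<lambda>r. f (r *\<^sub>R z)) \<longlongrightarrow> L) (at_left (1::real))"
  proof (rule tendstoI)
    fix e :: real assume e: "e > 0"
    then have "e / B > 0" using B by simp
    from has_boundary_valueD[OF g this] eventually_at_left_1
    show "\<forall>\<^sub>F r in at_left 1. dist (f (r *\<^sub>R z)) L < e"
    proof eventually_elim
      case (elim r)
      then have [measurable]: "(\<lambda>\<zeta>. f (r *\<^sub>R \<zeta>)) \<in> borel_measurable torus_measure"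
        by (auto intro!: dilate_measurable f)
      have "continuous_on cpolydisc (\<lambda>\<zeta>. f (r *\<^sub>R \<zeta>))"
        using elim by (intro holomorphic_dilate_continuous f) auto
      then obtain C where C: "\<And>\<zeta>. \<zeta> \<in> cpolydisc \<Longrightarrow> norm (f (r *\<^sub>R \<zeta>)) \<le> C"
        using bounded_on_cpolydisc by blast
      have "integrable torus_measure (\<lambda>\<zeta>. f (r *\<^sub>R \<zeta>))"
        using C torus_cpolydisc by (intro torus.integrable_const_bound[where B=C] AE_I2) auto
      note int_r = int[OF this]
      have "f (r *\<^sub>R z) - L = (LINT \<zeta>|torus_measure. f (r *\<^sub>R \<zeta>) * cnj (szego_kernel z \<zeta>)) - L"
        using elim by (subst torus_cauchy_dilate[OF f _ _ z]) auto
      also have "\<dots> = (LINT \<zeta>|torus_measure. f (r *\<^sub>R \<zeta>) * cnj (szego_kernel z \<zeta>) - g \<zeta> * cnj (szego_kernel z \<zeta>))"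
        unfolding L_def using int_r int_g by (rule Bochner_Integration.integral_diff[symmetric])
      finally have eq: "f (r *\<^sub>R z) - L = \<dots>" .
      have "ennreal (norm (f (r *\<^sub>R z) - L)) \<le>
          (\<integral>\<^sup>+ \<zeta>. ennreal (norm (f (r *\<^sub>R \<zeta>) * cnj (szego_kernel z \<zeta>) - g \<zeta> * cnj (szego_kernel z \<zeta>))) \<partial>torus_measure)"
        unfolding eq by (intro integral_norm_bound_ennreal Bochner_Integration.integrable_diff int_r int_g)
      also have "\<dots> \<le> (\<integral>\<^sup>+ \<zeta>. ennreal B * ennreal (norm (f (r *\<^sub>R \<zeta>) - g \<zeta>)) \<partial>torus_measure)"
        using B by (intro nn_integral_mono)
           (auto simp: norm_mult mult.commute[of B] intro!: mult_left_mono simp flip: ennreal_mult left_diff_distrib)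
      also have "\<dots> = ennreal B * (\<integral>\<^sup>+ \<zeta>. ennreal (norm (f (r *\<^sub>R \<zeta>) - g \<zeta>)) \<partial>torus_measure)"
        by (rule nn_integral_cmult) measurable
      also have "\<dots> < ennreal B * ennreal (e / B)"
        using elim B by (intro ennreal_mult_strict_left_mono) auto
      also have "\<dots> = ennreal e"
        using B e by (simp flip: ennreal_mult)
      finally show ?case
        using e by (simp add: dist_norm ennreal_less_iff)
    qed
  qed
  ultimately have "f (1 *\<^sub>R z) = L"
    by (rule tendsto_unique[rotated]) simp
  then show "f z = (LINT \<zeta>|torus_measure. g \<zeta> * cnj (szego_kernel z \<zeta>))"
    by (simp add: L_def)
qed

section \<open>Poisson integrals and the means of dilates\<close>

definition poisson_weight :: "complex ^ 'n \<Rightarrow> complex ^ 'n \<Rightarrow> real" where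
  "poisson_weight z \<zeta> = (norm (szego_kernel z \<zeta>))\<^sup>2 / kdiag z"

lemma poisson_weight_nonneg: "z \<in> polydisc \<Longrightarrow> 0 \<le> poisson_weight z \<zeta>"
  using kdiag_pos[of z] by (simp add: poisson_weight_def)

lemma poisson_weight_measurable: "z \<in> polydisc \<Longrightarrow> poisson_weight z \<in> borel_measurable torus_measure"
  unfolding poisson_weight_def[abs_def] using szego_kernel_measurable[of z] by measurable

lemma nn_integral_poisson_weight:
  assumes z: "z \<in> polydisc"
  shows "(\<integral>\<^sup>+ \<zeta>. ennreal (poisson_weight z \<zeta>) \<partial>torus_measure) = 1"
proof -
  note [measurable] = szego_kernel_measurable[OF z]
  have "(\<integral>\<^sup>+ \<zeta>. ennreal (poisson_weight z \<zeta>) \<partial>torus_measure) =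
      (\<integral>\<^sup>+ \<zeta>. ennreal (1 / kdiag z) * ennreal ((norm (szego_kernel z \<zeta>))\<^sup>2) \<partial>torus_measure)"
    using kdiag_pos[OF z] by (intro nn_integral_cong) (simp add: poisson_weight_def flip: ennreal_mult)
  also have "\<dots> = ennreal (1 / kdiag z) * ennreal (kdiag z)"
    by (subst nn_integral_cmult) (auto simp: nn_integral_szego_kernel_sq[OF z])
  also have "\<dots> = 1"
    using kdiag_pos[OF z] by (simp flip: ennreal_mult)
  finally show ?thesis .
qed

text \<open>Cauchy's formula for \<open>f\<close> times \<open>szego_kernel z\<close>, taken at
  \<open>z\<close>, has \<open>f z * kdiag z\<close> on the left and the squared modulus of the
  kernel under the integral. The weight is thus the Poisson kernel of the polydisc.\<close>

lemma poisson_boundary_value: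
  fixes f :: "complex ^ 'n \<Rightarrow> complex"
  assumes f: "holomorphic_polydisc f" and g: "has_boundary_value f g" and z: "z \<in> polydisc"
  shows "f z = (LINT \<zeta>|torus_measure. poisson_weight z \<zeta> *\<^sub>R g \<zeta>)"
    and "integrable torus_measure (\<lambda>\<zeta>. poisson_weight z \<zeta> *\<^sub>R g \<zeta>)"
proof -
  have h: "holomorphic_polydisc (\<lambda>w. f w * szego_kernel z w)"
    by (intro holomorphic_polydisc_mult f szego_kernel_holomorphic z)
  have bv: "has_boundary_value (\<lambda>w. f w * szego_kernel z w) (\<lambda>w. g w * szego_kernel z w)"
    by (intro has_boundary_value_mult f g szego_kernel_continuous z)
  have eq: "g \<zeta> * szego_kernel z \<zeta> * cnj (szego_kernel z \<zeta>) = kdiag z *\<^sub>R (poisson_weight z \<zeta> *\<^sub>R g \<zeta>)" for \<zeta>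
    using kdiag_pos[OF z]
    by (simp add: poisson_weight_def scaleR_conv_of_real complex_norm_square mult_ac del: of_real_power)
  have "integrable torus_measure (\<lambda>\<zeta>. kdiag z *\<^sub>R (poisson_weight z \<zeta> *\<^sub>R g \<zeta>))"
    using cauchy_boundary_value(2)[OF h bv z] unfolding eq .
  then have "integrable torus_measure (\<lambda>\<zeta>. (1 / kdiag z) *\<^sub>R (kdiag z *\<^sub>R (poisson_weight z \<zeta> *\<^sub>R g \<zeta>)))"
    by (rule integrable_scaleR_right)
  then show "integrable torus_measure (\<lambda>\<zeta>. poisson_weight z \<zeta> *\<^sub>R g \<zeta>)"
    using kdiag_pos[OF z] by simp
  have "f z * kdiag z = kdiag z *\<^sub>R (LINT \<zeta>|torus_measure. poisson_weight z \<zeta> *\<^sub>R g \<zeta>)"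
    using cauchy_boundary_value(1)[OF h bv z] unfolding eq szego_kernel_diag integral_scaleR_right .
  then show "f z = (LINT \<zeta>|torus_measure. poisson_weight z \<zeta> *\<^sub>R g \<zeta>)"
    using kdiag_pos[OF z] by (simp add: scaleR_conv_of_real mult.commute)
qed

lemma (in prob_space) powr_jensen:
  fixes u :: "'a \<Rightarrow> real"
  assumes u: "integrable M u" "\<And>x. 0 \<le> u x" and s: "1 \<le> s"
  shows "ennreal ((expectation u) powr s) \<le> (\<integral>\<^sup>+ x. ennreal (u x powr s) \<partial>M)"
\<comment> \<open>An infinite right side is trivial, and so is mean 0, where \<open>0 powr s\<close>
  is 0. In the remaining case the power is integrable and real integrals can be compared.\<close>
proof (cases "(\<integral>\<^sup>+ x. ennreal (u x powr s) \<partial>M) = \<infinity> \<or> expectation u = 0")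
  case False
  have meas [measurable]: "u \<in> borel_measurable M"
    using u by auto
  define X where "X = expectation u"
  have X: "X > 0"
    using False u(2) by (simp add: X_def less_le)
  have int: "integrable M (\<lambda>x. u x powr s)"
    by (rule integrableI_bounded) (use False in \<open>auto simp: less_top\<close>)
  \<comment> \<open>Young's inequality gives the supporting line of the convex function at \<open>X\<close>.\<close>
  have young: "u x * X powr (s - 1) \<le> u x powr s / s + (1 - 1 / s) * X powr s" for x
  proof (cases "u x = 0")
    case False
    then have "u x > 0" using u(2)[of x] by simp
    have "(u x powr s) powr (1 / s) * (X powr s) powr (1 - 1 / s) \<le> (1 / s) * (u x powr s) + (1 - 1 / s) * X powr s"
      by (rule Youngs_inequality_0) (use s X \<open>u x > 0\<close> in auto)
    moreover have "(u x powr s) powr (1 / s) = u x"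
      using s \<open>u x > 0\<close> by (simp add: powr_powr)
    moreover have "(X powr s) powr (1 - 1 / s) = X powr (s - 1)"
      using s by (simp add: powr_powr right_diff_distrib)
    ultimately show ?thesis by simp
  qed (use s X in auto)
  have "X * X powr (s - 1) = expectation (\<lambda>x. u x * X powr (s - 1))"
    by (simp add: X_def)
  also have "\<dots> \<le> expectation (\<lambda>x. u x powr s / s + (1 - 1 / s) * X powr s)"
    by (intro integral_mono young) (use u int in auto)
  also have "\<dots> = expectation (\<lambda>x. u x powr s) / s + (1 - 1 / s) * X powr s"
    using int by (simp add: prob_space)
  also have "X * X powr (s - 1) = X powr s"
    using X by (simp add: powr_diff)
  finally have "X powr s / s \<le> expectation (\<lambda>x. u x powr s) / s"
    by (simp add: algebra_simps)
  then have "X powr s \<le> expectation (\<lambda>x. u x powr s)"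
    using s by (simp add: divide_right_mono_neg field_simps)
  then show ?thesis
    using int by (simp add: nn_integral_eq_integral X_def)
qed auto

text \<open>The pair with a real constant \<open>c\<close> lets one inequality serve twice:
  \<open>c = 0\<close> gives the usual means of order \<open>s\<close>, while \<open>c = 1\<close>
  with \<open>s = 1\<close> gives the strictly convex function sqrt (1 + |x|^2) behind the existence
  of boundary values. The Poisson weight is a probability density, so convexity applies first to the
  norm and then to the power.\<close>

lemma poisson_jensen:
  fixes f :: "complex ^ 'n \<Rightarrow> complex" and c :: real
  assumes f: "holomorphic_polydisc f" and g: "has_boundary_value f g" and z: "z \<in> polydisc" and s: "1 \<le> s"
  shows "ennreal (norm (c, f z) powr s) \<le>
    (\<integral>\<^sup>+ \<zeta>. ennreal (poisson_weight z \<zeta>) * ennreal (norm (c, g \<zeta>) powr s) \<partial>torus_measure)"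
proof -
  note [measurable] = poisson_weight_measurable[OF z] has_boundary_value_measurable[OF g]
  note P = poisson_boundary_value[OF f g z]
  define M where "M = density torus_measure (\<lambda>\<zeta>. ennreal (poisson_weight z \<zeta>))"
  interpret M: prob_space M
  proof (rule prob_spaceI)
    have "emeasure M (space M) = (\<integral>\<^sup>+ \<zeta>. ennreal (poisson_weight z \<zeta>) * indicator (space torus_measure) \<zeta> \<partial>torus_measure)"
      unfolding M_def space_density by (rule emeasure_density) (simp, rule sets.top)
    also have "\<dots> = (\<integral>\<^sup>+ \<zeta>. ennreal (poisson_weight z \<zeta>) \<partial>torus_measure)"
      by (intro nn_integral_cong) simp
    finally show "emeasure M (space M) = 1"
      by (simp only: nn_integral_poisson_weight[OF z])
  qed
  have nn: "AE \<zeta> in torus_measure. 0 \<le> poisson_weight z \<zeta>"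
    by (intro AE_I2 poisson_weight_nonneg z)
  have int: "integrable M g"
    unfolding M_def by (subst integrable_density) (use P nn in auto)
  have fz: "f z = (LINT \<zeta>|M. g \<zeta>)"
    unfolding M_def P(1) by (subst integral_density) (use nn in auto)
  \<comment> \<open>Writing the pair as \<open>(c, 0) + (0, g \<zeta>)\<close> lets its integral be
    computed through a bounded linear embedding.\<close>
  have T: "bounded_linear (\<lambda>x. (0, x) :: real \<times> complex)"
    by (intro bounded_linear_intros)
  have int0: "integrable M (\<lambda>\<zeta>. (0, g \<zeta>) :: real \<times> complex)"
    by (rule integrable_bounded_linear[OF T int])
  have int1: "integrable M (\<lambda>\<zeta>. (c, 0) + ((0, g \<zeta>) :: real \<times> complex))"
    by (intro Bochner_Integration.integrable_add int0 M.integrable_const)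
  have "(LINT \<zeta>|M. (c, 0) + ((0, g \<zeta>) :: real \<times> complex)) = (LINT \<zeta>|M. (c, 0)) + (LINT \<zeta>|M. (0, g \<zeta>))"
    by (rule Bochner_Integration.integral_add[OF M.integrable_const int0])
  also have "\<dots> = (c, 0) + (0, f z)"
    by (simp only: integral_bounded_linear[OF T int] fz lebesgue_integral_const M.prob_space scaleR_one)
  finally have "(c, f z) = (LINT \<zeta>|M. (c, 0) + ((0, g \<zeta>) :: real \<times> complex))"
    by simp
  then have "norm (c, f z) \<le> (LINT \<zeta>|M. norm (c, g \<zeta>))"
    using integral_norm_bound[of M "\<lambda>\<zeta>. (c, 0) + ((0, g \<zeta>) :: real \<times> complex)"] by simp
  then have "ennreal (norm (c, f z) powr s) \<le> ennreal ((LINT \<zeta>|M. norm (c, g \<zeta>)) powr s)"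
    using s by (intro ennreal_leI powr_mono2) auto
  also have "\<dots> \<le> (\<integral>\<^sup>+ \<zeta>. ennreal (norm (c, g \<zeta>) powr s) \<partial>M)"
    using integrable_norm[OF int1] by (intro M.powr_jensen s) auto
  also have "\<dots> = (\<integral>\<^sup>+ \<zeta>. ennreal (poisson_weight z \<zeta>) * ennreal (norm (c, g \<zeta>) powr s) \<partial>torus_measure)"
    unfolding M_def by (subst nn_integral_density) (auto simp: norm_Pair)
  finally show ?thesis .
qed

interpretation torus_torus: pair_sigma_finite "torus_measure :: (complex ^ 'n) measure" "torus_measure :: (complex ^ 'n) measure" ..

lemma nth_measurable [measurable]: "(\<lambda>\<zeta>. \<zeta> $ i) \<in> borel_measurable torus_measure"
  by (intro measurable_torus_continuous continuous_intros)

lemma poisson_weight_measurable2: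
  "(\<lambda>(\<zeta>, \<eta>). poisson_weight (t *\<^sub>R \<zeta>) \<eta>) \<in> borel_measurable (torus_measure \<Otimes>\<^sub>M torus_measure)"
proof -
  have 1: "(\<lambda>x. fst x $ i) \<in> borel_measurable (torus_measure \<Otimes>\<^sub>M torus_measure)"
    and 2: "(\<lambda>x. snd x $ i) \<in> borel_measurable (torus_measure \<Otimes>\<^sub>M torus_measure)" for i
    by (auto intro!: measurable_compose[OF measurable_fst] measurable_compose[OF measurable_snd])
  note [measurable] = 1 2
  show ?thesis
    unfolding case_prod_unfold poisson_weight_def szego_kernel_def kdiag_def vector_scaleR_component
    by measurable
qed

lemma nn_integral_poisson_weight_dilate:
  fixes \<eta> :: "complex ^ 'n"
  assumes t: "0 \<le> t" "t < 1" and \<eta>: "\<eta> \<in> torus"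
  shows "(\<integral>\<^sup>+ \<zeta>. ennreal (poisson_weight (t *\<^sub>R \<zeta>) \<eta>) \<partial>torus_measure) = 1"
proof -
  have "(\<integral>\<^sup>+ \<zeta>. ennreal (poisson_weight (t *\<^sub>R \<zeta>) \<eta>) \<partial>torus_measure) =
      (\<integral>\<^sup>+ \<zeta>. ennreal (poisson_weight (t *\<^sub>R \<eta>) \<zeta>) \<partial>torus_measure)"
    by (intro nn_integral_cong)
       (simp add: poisson_weight_def norm_szego_kernel_commute[of t _ \<eta>] kdiag_dilate_torus \<eta>)
  also have "\<dots> = 1"
    by (intro nn_integral_poisson_weight torus_scaled t \<eta>)
  finally show ?thesis .
qed

text \<open>Integrate \<open>poisson_jensen\<close> over the torus and exchange the integrals; for a
  fixed boundary point the weights again have total mass 1.\<close>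

lemma dilate_contraction:
  fixes f :: "complex ^ 'n \<Rightarrow> complex" and c :: real
  assumes f: "holomorphic_polydisc f" and g: "has_boundary_value f g" and s: "1 \<le> s"
    and t: "0 \<le> t" "t < 1"
  shows "(\<integral>\<^sup>+ \<zeta>. ennreal (norm (c, f (t *\<^sub>R \<zeta>)) powr s) \<partial>torus_measure) \<le>
    (\<integral>\<^sup>+ \<zeta>. ennreal (norm (c, g \<zeta>) powr s) \<partial>torus_measure)"
proof -
  note [measurable] = has_boundary_value_measurable[OF g] poisson_weight_measurable2[of t]
  have [measurable]: "(\<lambda>\<zeta>. ennreal (norm (c, g \<zeta>) powr s)) \<in> borel_measurable torus_measure"
    unfolding norm_Pair by measurable
  have "(\<integral>\<^sup>+ \<zeta>. ennreal (norm (c, f (t *\<^sub>R \<zeta>)) powr s) \<partial>torus_measure) \<le>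
      (\<integral>\<^sup>+ \<zeta>. (\<integral>\<^sup>+ \<eta>. ennreal (poisson_weight (t *\<^sub>R \<zeta>) \<eta>) * ennreal (norm (c, g \<eta>) powr s) \<partial>torus_measure) \<partial>torus_measure)"
    using t by (intro nn_integral_mono poisson_jensen f g s torus_scaled) auto
  also have "\<dots> = (\<integral>\<^sup>+ \<eta>. (\<integral>\<^sup>+ \<zeta>. ennreal (poisson_weight (t *\<^sub>R \<zeta>) \<eta>) * ennreal (norm (c, g \<eta>) powr s) \<partial>torus_measure) \<partial>torus_measure)"
    by (rule torus_torus.Fubini'[symmetric]) measurable
  also have "\<dots> = (\<integral>\<^sup>+ \<eta>. ennreal (norm (c, g \<eta>) powr s) \<partial>torus_measure)"
  proof (intro nn_integral_cong)
    fix \<eta> :: "complex ^ 'n" assume "\<eta> \<in> space torus_measure"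
    then have \<eta>: "\<eta> \<in> torus" by simp
    have "(\<lambda>\<zeta>. ennreal (poisson_weight (t *\<^sub>R \<zeta>) \<eta>)) \<in> borel_measurable torus_measure"
      using \<eta> measurable_compose[OF measurable_Pair2'[of \<eta> torus_measure torus_measure] poisson_weight_measurable2[of t]]
      by simp
    then show "(\<integral>\<^sup>+ \<zeta>. ennreal (poisson_weight (t *\<^sub>R \<zeta>) \<eta>) * ennreal (norm (c, g \<eta>) powr s) \<partial>torus_measure) = ennreal (norm (c, g \<eta>) powr s)"
      by (simp add: nn_integral_multc nn_integral_poisson_weight_dilate[OF t \<eta>])
  qed
  finally show ?thesis .
qed

text \<open>Turns summability of L^1 norms on the torus into locally uniform convergence inside, as
  used in \<open>boundary_value_series\<close>.\<close>

lemma norm_boundary_value_le: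
  fixes f :: "complex ^ 'n \<Rightarrow> complex"
  assumes f: "holomorphic_polydisc f" and g: "has_boundary_value f g" and z: "z \<in> polydisc"
  shows "norm (f z) \<le> 2 ^ CARD('n) * kdiag z * (LINT \<zeta>|torus_measure. norm (g \<zeta>))"
proof -
  note C = cauchy_boundary_value[OF f g z]
  have "norm (f z) \<le> (LINT \<zeta>|torus_measure. norm (g \<zeta> * cnj (szego_kernel z \<zeta>)))"
    unfolding C(1) by (rule integral_norm_bound)
  also have "\<dots> \<le> (LINT \<zeta>|torus_measure. (2 ^ CARD('n) * kdiag z) * norm (g \<zeta>))"
  proof (rule integral_mono)
    show "integrable torus_measure (\<lambda>\<zeta>. (2 ^ CARD('n) * kdiag z) * norm (g \<zeta>))"
      using has_boundary_value_integrable[OF f g] by (intro integrable_mult_right) auto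
    show "norm (g \<zeta> * cnj (szego_kernel z \<zeta>)) \<le> (2 ^ CARD('n) * kdiag z) * norm (g \<zeta>)"
      if "\<zeta> \<in> space torus_measure" for \<zeta>
      using norm_szego_kernel_le[OF z, of \<zeta>] that torus_cpolydisc
      by (auto simp: norm_mult mult.commute[of "norm (g \<zeta>)"] intro!: mult_right_mono)
  qed (use C(2) in auto)
  finally show ?thesis by simp
qed

section \<open>Existence of boundary values\<close>

text \<open>Let \<open>a\<close>, \<open>b\<close>, \<open>c\<close> be the norms of the vectors (1,
  x), (1, y) and of their sum. Thanks to the coordinate 1, the squared distance of \<open>x\<close>
  and \<open>y\<close> is at most the Gram determinant of the two vectors. This determinant has the
  factor \<open>a * b - (1 + d)\<close>, which equals
  \<open>\<delta> * (a + b + c) / 2\<close>.\<close>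

lemma strict_convexity_gap:
  fixes x y :: complex
  defines "W \<equiv> norm (1::real, x) + norm (1::real, y)"
  defines "\<delta> \<equiv> W - 2 * norm (1::real, (x + y) / 2)"
  shows "0 \<le> \<delta>" and "(norm (x - y))\<^sup>2 \<le> \<delta> * W ^ 3"
proof -
  define a b c d where "a = norm (1::real, x)" and "b = norm (1::real, y)"
    and "c = norm ((1::real, x) + (1::real, y))" and "d = x \<bullet> y"
  have "2 * norm (1::real, (x + y) / 2) = norm (2 *\<^sub>R (1::real, (x + y) / 2))"
    by (simp only: norm_scaleR abs_numeral)
  also have "2 *\<^sub>R (1::real, (x + y) / 2) = (1::real, x) + (1::real, y)"
    by (simp add: scaleR_conv_of_real)
  finally have \<delta>: "\<delta> = a + b - c" and W: "W = a + b"
    by (simp_all add: \<delta>_def W_def a_def b_def c_def)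
  have c: "c \<le> a + b" "0 \<le> c"
    unfolding a_def b_def c_def by (rule norm_triangle_ineq) simp
  then show "0 \<le> \<delta>"
    using \<delta> by simp
  have a2: "a\<^sup>2 = 1 + (norm x)\<^sup>2" and b2: "b\<^sup>2 = 1 + (norm y)\<^sup>2"
    by (auto simp: a_def b_def norm_Pair)
  have ab0: "0 \<le> a" "0 \<le> b"
    by (auto simp: a_def b_def)
  have inner: "(1::real, x) \<bullet> (1::real, y) = 1 + d"
    by (simp add: inner_Pair d_def)
  have cs: "\<bar>1 + d\<bar> \<le> a * b"
    using Cauchy_Schwarz_ineq2[of "(1::real, x)" "(1::real, y)"] by (simp only: inner a_def b_def)
  have c2: "c\<^sup>2 = a\<^sup>2 + b\<^sup>2 + 2 * (1 + d)"
    unfolding c_def a_def b_def inner[symmetric] power2_norm_eq_inner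
    by (simp only: inner_add_left inner_add_right inner_commute)
  have d2: "d\<^sup>2 \<le> (norm x)\<^sup>2 * (norm y)\<^sup>2"
    using Cauchy_Schwarz_ineq[of x y] by (simp add: d_def power2_norm_eq_inner)
  have "(norm (x - y))\<^sup>2 = (norm x)\<^sup>2 + (norm y)\<^sup>2 - 2 * d"
    by (simp add: d_def power2_norm_eq_inner inner_diff_left inner_diff_right inner_commute)
  also have "\<dots> \<le> a\<^sup>2 * b\<^sup>2 - (1 + d)\<^sup>2"
    unfolding a2 b2 using d2 by (simp add: power2_eq_square algebra_simps)
  also have "\<dots> = (a * b - (1 + d)) * (a * b + (1 + d))"
    by (simp add: power2_eq_square algebra_simps)
  also have "\<dots> \<le> (a * b - (1 + d)) * (2 * (a * b))"
    using cs by (intro mult_left_mono) auto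
  \<comment> \<open>Difference of squares: \<open>\<delta> * (a + b + c)\<close> is the difference
    of the squares of \<open>a + b\<close> and \<open>c\<close>, and \<open>c2\<close> evaluates
    it.\<close>
  also have "\<dots> = (\<delta> * (a + b + c)) * (a * b)"
  proof -
    have "\<delta> * (a + b + c) = 2 * (a * b - (1 + d))"
      using c2 unfolding \<delta> by (simp add: power2_eq_square algebra_simps)
    then show ?thesis by simp
  qed
  also have "\<dots> \<le> (\<delta> * (2 * W)) * (W\<^sup>2 / 2)"
  proof (intro mult_mono)
    have "0 \<le> (a - b)\<^sup>2" by simp
    then show "a * b \<le> W\<^sup>2 / 2"
      using mult_nonneg_nonneg[OF ab0] unfolding W by (simp add: power2_eq_square algebra_simps)
    show "a + b + c \<le> 2 * W" using c W by simp
  qed (use \<open>0 \<le> \<delta>\<close> ab0 c W in auto)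
  also have "\<dots> = \<delta> * W ^ 3"
    by (simp add: power2_eq_square power3_eq_cube)
  finally show "(norm (x - y))\<^sup>2 \<le> \<delta> * W ^ 3" .
qed

text \<open>Where \<open>W\<close> is at most \<open>\<Lambda>\<close>, the gap bounds the squared
  distance, and the arithmetic-geometric mean inequality with weight \<open>\<eta>\<close> removes
  the square. Elsewhere \<open>W = W powr p * W powr (1 - p)\<close> is dominated by the last term,
  which for \<open>p > 1\<close> and large \<open>\<Lambda>\<close> is small in the mean: this is
  the uniform integrability. The base 4 comes from
  \<open>W \<le> 2 + norm x + norm y \<le> 4 * m\<close>.\<close>

lemma norm_diff_le_gap:
  fixes x y :: complex and p \<eta> \<Lambda> :: real
  assumes p: "1 \<le> p" and \<eta>: "0 < \<eta>" and \<Lambda>: "0 < \<Lambda>"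
  shows "norm (x - y) \<le> \<eta> + (norm (1::real, x) + norm (1::real, y) - 2 * norm (1::real, (x + y) / 2)) * \<Lambda> ^ 3 / \<eta>
    + 4 powr p * (1 + norm x powr p + norm y powr p) * \<Lambda> powr (1 - p)"
proof -
  define W where "W = norm (1::real, x) + norm (1::real, y)"
  define \<delta> where "\<delta> = W - 2 * norm (1::real, (x + y) / 2)"
  note gap = strict_convexity_gap[of x y, folded W_def, folded \<delta>_def]
  have Wp: "W powr p \<le> 4 powr p * (1 + norm x powr p + norm y powr p)"
  proof -
    define m where "m = max 1 (max (norm x) (norm y))"
    have "norm (1::real, x) \<le> 1 + norm x" "norm (1::real, y) \<le> 1 + norm y"
      using norm_Pair_le[of "1::real"] by auto
    then have "W \<le> 4 * m"
      by (simp add: W_def m_def)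
    then have "W powr p \<le> (4 * m) powr p"
      using p by (intro powr_mono2) (auto simp: W_def)
    also have "\<dots> = 4 powr p * m powr p"
      by (simp add: powr_mult m_def)
    also have "m powr p \<le> 1 + norm x powr p + norm y powr p"
      using p by (auto simp: m_def max_def)
    finally show ?thesis by simp
  qed
  have xy: "norm (x - y) \<le> W"
    using norm_triangle_ineq4[of x y] norm_snd_le[where x="1::real" and y=x] norm_snd_le[where x="1::real" and y=y]
    by (simp add: W_def)
  show ?thesis
    unfolding W_def[symmetric] \<delta>_def[symmetric]
  proof (cases "W \<le> \<Lambda>")
    case True
    have "2 * norm (x - y) * \<eta> \<le> \<eta>\<^sup>2 + (norm (x - y))\<^sup>2"
      using sum_squares_bound[of "norm (x - y)" \<eta>] by simp
    also have "(norm (x - y))\<^sup>2 \<le> \<delta> * \<Lambda> ^ 3"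
      using gap True by (intro order_trans[OF gap(2)] mult_left_mono power_mono) (auto simp: W_def)
    finally have "2 * norm (x - y) \<le> \<eta> + \<delta> * \<Lambda> ^ 3 / \<eta>"
      using \<eta> by (simp add: field_simps power2_eq_square)
    moreover have "0 \<le> norm (x - y)" by simp
    ultimately have "norm (x - y) \<le> \<eta> + \<delta> * \<Lambda> ^ 3 / \<eta>"
      by linarith
    moreover have "0 \<le> 4 powr p * (1 + norm x powr p + norm y powr p) * \<Lambda> powr (1 - p)"
      by (intro mult_nonneg_nonneg add_nonneg_nonneg) auto
    ultimately show "norm (x - y) \<le> \<eta> + \<delta> * \<Lambda> ^ 3 / \<eta>
        + 4 powr p * (1 + norm x powr p + norm y powr p) * \<Lambda> powr (1 - p)"
      by linarith
  next
    case False
    then have "W > 0" using \<Lambda> by simp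
    have "W = W powr p * W powr (1 - p)"
      using \<open>W > 0\<close> by (simp flip: powr_add)
    also have "\<dots> \<le> (4 powr p * (1 + norm x powr p + norm y powr p)) * \<Lambda> powr (1 - p)"
      using Wp False p \<Lambda> by (intro mult_mono powr_mono2') auto
    finally have "W \<le> 4 powr p * (1 + norm x powr p + norm y powr p) * \<Lambda> powr (1 - p)" .
    moreover have "0 \<le> \<delta> * \<Lambda> ^ 3 / \<eta>"
      using gap(1) \<eta> \<Lambda> by auto
    ultimately show "norm (x - y) \<le> \<eta> + \<delta> * \<Lambda> ^ 3 / \<eta>
        + 4 powr p * (1 + norm x powr p + norm y powr p) * \<Lambda> powr (1 - p)"
      using xy \<eta> by linarith
  qed
qed

lemma holomorphic_polydisc_dilate:
  fixes f :: "complex ^ 'n \<Rightarrow> complex"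
  assumes f: "holomorphic_polydisc f" and r: "0 \<le> r" "r < 1"
  shows "holomorphic_polydisc (\<lambda>z. f (r *\<^sub>R z))"
  unfolding holomorphic_polydisc_def
proof
  fix z :: "complex ^ 'n" assume "z \<in> polydisc"
  then have "r *\<^sub>R z \<in> polydisc"
    using scaled_in_polydisc[of z r] polydisc_cpolydisc r by blast
  then obtain f' where f': "(f has_derivative f') (at (r *\<^sub>R z))" "\<And>c v. f' (c *s v) = c * f' v"
    using holomorphic_polydiscE[OF f] by blast
  have "((\<lambda>z. r *\<^sub>R z) has_derivative (\<lambda>h. r *\<^sub>R h)) (at z)"
    by (auto intro!: derivative_eq_intros)
  from has_derivative_compose[OF this f'(1)]
  have "((\<lambda>z. f (r *\<^sub>R z)) has_derivative (\<lambda>h. f' (r *\<^sub>R h))) (at z)" .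
  moreover have "f' (r *\<^sub>R (c *s v)) = c * f' (r *\<^sub>R v)" for c v
  proof -
    have "r *\<^sub>R (c *s v) = c *s (r *\<^sub>R v)"
      by (simp add: vec_eq_iff)
    then show ?thesis by (simp only: f'(2))
  qed
  ultimately show "\<exists>h. ((\<lambda>z. f (r *\<^sub>R z)) has_derivative h) (at z) \<and> (\<forall>c v. h (c *s v) = c * h v)"
    by blast
qed

lemma integrable_torus_continuous:
  fixes h :: "complex ^ 'n \<Rightarrow> 'b::{banach, second_countable_topology}"
  assumes "continuous_on torus h"
  shows "integrable torus_measure h"
proof -
  obtain B where "\<And>\<zeta>. \<zeta> \<in> torus \<Longrightarrow> norm (h \<zeta>) \<le> B"
    using compact_imp_bounded[OF compact_continuous_image[OF assms compact_torus]]
    unfolding bounded_iff by auto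
  then show ?thesis
    by (intro torus.integrable_const_bound[where B=B] AE_I2 measurable_torus_continuous assms) auto
qed

text \<open>The argument of Riesz and Fischer: the sum of the moduli of the increments has finite
  integral, so the telescoping series converges absolutely almost everywhere.\<close>

lemma L1_fast_cauchy_limit:
  fixes u :: "nat \<Rightarrow> 'a \<Rightarrow> complex"
  assumes [measurable]: "\<And>k. u k \<in> borel_measurable M"
    and fast: "\<And>k. (\<integral>\<^sup>+ x. ennreal (norm (u (Suc k) x - u k x)) \<partial>M) \<le> ennreal ((1 / 2) ^ k)"
  obtains g where "g \<in> borel_measurable M" "AE x in M. (\<lambda>k. u k x) \<longlonglongrightarrow> g x"
proof -
  have "(\<integral>\<^sup>+ x. (\<Sum>k. ennreal (norm (u (Suc k) x - u k x))) \<partial>M) = (\<Sum>k. \<integral>\<^sup>+ x. ennreal (norm (u (Suc k) x - u k x)) \<partial>M)"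
    by (rule nn_integral_suminf) measurable
  also have "\<dots> \<le> (\<Sum>k. ennreal ((1 / 2) ^ k))"
    by (intro suminf_le fast) auto
  also have "\<dots> = ennreal (\<Sum>k. (1 / 2) ^ k)"
    by (rule suminf_ennreal2) (simp, rule summable_geometric, simp)
  also have "\<dots> < \<infinity>"
    by (simp only: infinity_ennreal_def ennreal_less_top)
  finally have "(\<integral>\<^sup>+ x. (\<Sum>k. ennreal (norm (u (Suc k) x - u k x))) \<partial>M) \<noteq> \<infinity>"
    by simp
  then have "AE x in M. (\<Sum>k. ennreal (norm (u (Suc k) x - u k x))) \<noteq> \<infinity>"
    by (intro nn_integral_PInf_AE) measurable
  then have conv: "AE x in M. convergent (\<lambda>k. u k x)"
  proof eventually_elim
    case (elim x)
    then have "summable (\<lambda>k. norm (u (Suc k) x - u k x))"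
      by (intro summable_suminf_not_top) auto
    then have "summable (\<lambda>k. u (Suc k) x - u k x)"
      by (rule summable_norm_cancel)
    then obtain L where "(\<lambda>k. u (Suc k) x - u k x) sums L"
      unfolding summable_def by blast
    then have "(\<lambda>n. u n x - u 0 x) \<longlonglongrightarrow> L"
      by (simp only: sums_def sum_lessThan_telescope[of "\<lambda>k. u k x"])
    then have "(\<lambda>n. u n x - u 0 x + u 0 x) \<longlonglongrightarrow> L + u 0 x"
      by (intro tendsto_intros)
    then show ?case
      by (auto simp: convergent_def)
  qed
  show ?thesis
  proof
    show "(\<lambda>x. lim (\<lambda>k. u k x)) \<in> borel_measurable M"
      by measurable
    show "AE x in M. (\<lambda>k. u k x) \<longlonglongrightarrow> lim (\<lambda>k. u k x)"
      using conv by eventually_elim (simp add: convergent_LIMSEQ_iff)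
  qed
qed

lemma measure_torus [simp]: "measure torus_measure torus = 1"
  using torus.prob_space by (simp only: space_torus_measure)

lemma continuous_on_norm_Pair:
  fixes f :: "'a::topological_space \<Rightarrow> complex"
  shows "continuous_on A f \<Longrightarrow> continuous_on A (\<lambda>x. norm (1::real, f x))"
  by (intro continuous_intros)

lemma hardy_boundary_value_exists:
  fixes f :: "complex ^ 'n \<Rightarrow> complex"
  assumes f: "holomorphic_polydisc f" and p: "1 < p"
    and bdd: "\<And>r. 0 \<le> r \<Longrightarrow> r < 1 \<Longrightarrow> (\<integral>\<^sup>+ \<zeta>. ennreal (norm (f (r *\<^sub>R \<zeta>)) powr p) \<partial>torus_measure) \<le> ennreal K"
  shows "\<exists>g. has_boundary_value f g"
proof -
  define F where "F r \<zeta> = f (r *\<^sub>R \<zeta>)" for r :: real and \<zeta>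
  define \<phi> where "\<phi> x = norm (1::real, x)" for x :: complex
  \<comment> \<open>\<open>ennreal K\<close> is 0 for negative \<open>K\<close>, so the real
    estimates need the truncated constant.\<close>
  define K' where "K' = max K 0"
  have cont: "continuous_on torus (F r)" if "0 \<le> r" "r < 1" for r
    unfolding F_def using holomorphic_dilate_continuous[OF f that] torus_cpolydisc continuous_on_subset by blast
  have cont_\<phi>: "continuous_on torus (\<lambda>\<zeta>. \<phi> (h \<zeta>))" if "continuous_on torus h" for h :: "complex ^ 'n \<Rightarrow> complex"
    unfolding \<phi>_def by (rule continuous_on_norm_Pair[OF that])
  have int_powr: "integrable torus_measure (\<lambda>\<zeta>. norm (F r \<zeta>) powr p)" if "0 \<le> r" "r < 1" for r
    by (intro integrable_torus_continuous continuous_on_powr' continuous_intros cont that) (use p in auto)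
  have powr_le: "(LINT \<zeta>|torus_measure. norm (F r \<zeta>) powr p) \<le> K'" if "0 \<le> r" "r < 1" for r
  proof -
    have "ennreal (LINT \<zeta>|torus_measure. norm (F r \<zeta>) powr p) = (\<integral>\<^sup>+ \<zeta>. ennreal (norm (F r \<zeta>) powr p) \<partial>torus_measure)"
      by (rule nn_integral_eq_integral[symmetric]) (use int_powr that in auto)
    also have "\<dots> \<le> ennreal K'"
      unfolding F_def using bdd[OF that] by (rule order_trans) (simp add: K'_def)
    finally show ?thesis
      by (simp add: K'_def)
  qed
  define \<Phi> where "\<Phi> r = (LINT \<zeta>|torus_measure. \<phi> (F r \<zeta>))" for r
  have int_\<phi>: "integrable torus_measure (\<lambda>\<zeta>. \<phi> (h \<zeta>))" if "continuous_on torus h" for h :: "complex ^ 'n \<Rightarrow> complex"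
    by (intro integrable_torus_continuous cont_\<phi> that)
  have \<Phi>_le: "\<Phi> r \<le> 2 + K'" if "0 \<le> r" "r < 1" for r
  proof -
    have pw: "\<phi> x \<le> 2 + norm x powr p" for x
    proof -
      have "\<phi> x \<le> 1 + norm x"
        using norm_Pair_le[of "1::real" x] by (simp add: \<phi>_def)
      moreover have "norm x \<le> 1 + norm x powr p"
      proof (cases "norm x \<le> 1")
        case False
        then have "norm x powr 1 \<le> norm x powr p"
          using p by (intro powr_mono) auto
        then show ?thesis by simp
      qed (simp add: add_increasing2)
      ultimately show ?thesis by simp
    qed
    have "\<Phi> r \<le> (LINT \<zeta>|torus_measure. 2 + norm (F r \<zeta>) powr p)"
      unfolding \<Phi>_def by (intro integral_mono int_\<phi> cont that pw) (use int_powr that in auto)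
    also have "\<dots> = 2 + (LINT \<zeta>|torus_measure. norm (F r \<zeta>) powr p)"
      using int_powr[OF that] by (subst Bochner_Integration.integral_add) auto
    also have "\<dots> \<le> 2 + K'"
      using powr_le[OF that] by simp
    finally show ?thesis .
  qed
  have contraction: "(LINT \<zeta>|torus_measure. \<phi> (h (t *\<^sub>R \<zeta>))) \<le> (LINT \<zeta>|torus_measure. \<phi> (h \<zeta>))"
    if h: "holomorphic_polydisc h" "continuous_on cpolydisc h" and t: "0 \<le> t" "t < 1"
    for h :: "complex ^ 'n \<Rightarrow> complex" and t
  proof -
    have ch: "continuous_on torus h"
      by (rule continuous_on_subset[OF h(2) torus_cpolydisc])
    have ct: "continuous_on torus (\<lambda>\<zeta>. h (t *\<^sub>R \<zeta>))"
      by (rule continuous_on_subset[OF holomorphic_dilate_continuous[OF h(1) t] torus_cpolydisc])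
    have "ennreal (LINT \<zeta>|torus_measure. \<phi> (h (t *\<^sub>R \<zeta>))) = (\<integral>\<^sup>+ \<zeta>. ennreal (\<phi> (h (t *\<^sub>R \<zeta>))) \<partial>torus_measure)"
      by (rule nn_integral_eq_integral[symmetric]) (use int_\<phi>[OF ct] in \<open>auto simp: \<phi>_def\<close>)
    also have "\<dots> \<le> (\<integral>\<^sup>+ \<zeta>. ennreal (\<phi> (h \<zeta>)) \<partial>torus_measure)"
      using dilate_contraction[OF h(1) has_boundary_value_continuous[OF h(2)] order.refl t, of 1]
      by (simp add: \<phi>_def)
    also have "\<dots> = ennreal (LINT \<zeta>|torus_measure. \<phi> (h \<zeta>))"
      by (rule nn_integral_eq_integral) (use int_\<phi>[OF ch] in \<open>auto simp: \<phi>_def\<close>)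
    finally show ?thesis
      by (subst (asm) ennreal_le_iff) (auto simp: \<phi>_def intro!: integral_nonneg)
  qed
  define M where "M = (SUP r\<in>{0..<1}. \<Phi> r)"
  have bddA: "bdd_above (\<Phi> ` {0..<1})"
    using \<Phi>_le by (intro bdd_aboveI2) auto
  have \<Phi>_M: "\<Phi> r \<le> M" if "0 \<le> r" "r < 1" for r
    unfolding M_def using bddA that by (intro cSUP_upper) auto
  \<comment> \<open>All means \<open>\<Phi> r\<close> are at most \<open>M\<close>, and
    \<open>\<Phi> t\<close> exceeds \<open>M - e\<close>. For \<open>r\<close> and \<open>r'\<close>
    near 1 the dilate by \<open>t\<close> of the midpoint \<open>h\<close> stays within
    \<open>e\<close> of \<open>F t\<close>, so contraction gives \<open>h\<close> a mean of at least
    \<open>M - 2 * e\<close>. Twice this mean is subtracted from two means of at most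
    \<open>M\<close>, whence \<open>4 * e\<close>.\<close>
  have gap: "\<exists>r0. 0 \<le> r0 \<and> r0 < 1 \<and> (\<forall>r r'. r0 < r \<longrightarrow> r < 1 \<longrightarrow> r0 < r' \<longrightarrow> r' < 1 \<longrightarrow>
      (LINT \<zeta>|torus_measure. \<phi> (F r \<zeta>) + \<phi> (F r' \<zeta>) - 2 * \<phi> ((F r \<zeta> + F r' \<zeta>) / 2)) \<le> 4 * e)"
    if "e > 0" for e
  proof -
    have "\<exists>t\<in>{0..<1}. M - e < \<Phi> t"
      using less_cSUP_iff[OF _ bddA, of "M - e"] \<open>e > 0\<close> by (simp add: M_def)
    then obtain t where t: "0 \<le> t" "t < 1" "M - e < \<Phi> t"
      by auto
    have "\<forall>\<^sub>F r in at_left (1::real). \<forall>\<zeta>\<in>torus. norm (f (t *\<^sub>R r *\<^sub>R \<zeta>) - f (t *\<^sub>R \<zeta>)) < e"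
      by (rule dilate_uniform[OF holomorphic_dilate_continuous[OF f t(1,2)] \<open>e > 0\<close>])
    then obtain b where b: "b < 1" "\<And>r. b < r \<Longrightarrow> r < 1 \<Longrightarrow> \<forall>\<zeta>\<in>torus. norm (f (t *\<^sub>R r *\<^sub>R \<zeta>) - f (t *\<^sub>R \<zeta>)) < e"
      unfolding eventually_at_left_field by blast
    show ?thesis
    proof (intro exI conjI allI impI)
      show "0 \<le> max b 0" "max b 0 < 1"
        using b by auto
      fix r r' assume r: "max b 0 < r" "r < 1" and r': "max b 0 < r'" "r' < 1"
      define h where "h \<zeta> = (F r \<zeta> + F r' \<zeta>) / 2" for \<zeta>
      have h_hol: "holomorphic_polydisc h"
      proof -
        have "holomorphic_polydisc (\<lambda>\<zeta>. (F r \<zeta> + F r' \<zeta>) * (1 / 2))"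
          unfolding F_def
          by (rule holomorphic_polydisc_mult[OF holomorphic_polydisc_add[OF holomorphic_polydisc_dilate[OF f, of r]
                holomorphic_polydisc_dilate[OF f, of r']] holomorphic_polydisc_const])
             (use r r' in auto)
        then show ?thesis by (simp add: h_def[abs_def])
      qed
      have h_cont: "continuous_on cpolydisc h"
        unfolding h_def F_def using r r'
        by (intro continuous_intros holomorphic_dilate_continuous f) auto
      have h_torus: "continuous_on torus h"
        by (rule continuous_on_subset[OF h_cont torus_cpolydisc])
      have h_t: "continuous_on torus (\<lambda>\<zeta>. h (t *\<^sub>R \<zeta>))"
        by (rule continuous_on_subset[OF holomorphic_dilate_continuous[OF h_hol t(1,2)] torus_cpolydisc])
      have "M - 2 * e \<le> \<Phi> t - e"
        using t by simp
      also have "\<dots> = (LINT \<zeta>|torus_measure. \<phi> (F t \<zeta>) - e)"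
        using int_\<phi>[OF cont[OF t(1,2)]] by (simp add: \<Phi>_def Bochner_Integration.integral_diff)
      also have "\<dots> \<le> (LINT \<zeta>|torus_measure. \<phi> (h (t *\<^sub>R \<zeta>)))"
      proof (rule integral_mono)
        fix \<zeta> :: "complex ^ 'n" assume "\<zeta> \<in> space torus_measure"
        then have \<zeta>: "\<zeta> \<in> torus" by simp
        have lt: "norm (F r (t *\<^sub>R \<zeta>) - F t \<zeta>) < e" "norm (F r' (t *\<^sub>R \<zeta>) - F t \<zeta>) < e"
          using b(2)[of r] b(2)[of r'] r r' \<zeta> by (auto simp: F_def mult.commute)
        have mid: "h (t *\<^sub>R \<zeta>) - F t \<zeta> = ((F r (t *\<^sub>R \<zeta>) - F t \<zeta>) + (F r' (t *\<^sub>R \<zeta>) - F t \<zeta>)) / 2"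
          by (simp add: h_def field_simps)
        have "norm (h (t *\<^sub>R \<zeta>) - F t \<zeta>) =
            norm ((F r (t *\<^sub>R \<zeta>) - F t \<zeta>) + (F r' (t *\<^sub>R \<zeta>) - F t \<zeta>)) / 2"
          by (simp only: mid norm_divide norm_numeral)
        then have "norm (h (t *\<^sub>R \<zeta>) - F t \<zeta>) \<le> e"
          using norm_triangle_ineq[of "F r (t *\<^sub>R \<zeta>) - F t \<zeta>" "F r' (t *\<^sub>R \<zeta>) - F t \<zeta>"] lt by linarith
        moreover have "\<phi> (F t \<zeta>) \<le> \<phi> (h (t *\<^sub>R \<zeta>)) + norm (h (t *\<^sub>R \<zeta>) - F t \<zeta>)"
        proof -
          have "norm ((1::real, F t \<zeta>) - (1, h (t *\<^sub>R \<zeta>))) = norm (h (t *\<^sub>R \<zeta>) - F t \<zeta>)"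
            by (simp add: norm_minus_commute)
          then show ?thesis
            using norm_triangle_ineq2[of "(1::real, F t \<zeta>)" "(1, h (t *\<^sub>R \<zeta>))"] by (simp add: \<phi>_def)
        qed
        ultimately show "\<phi> (F t \<zeta>) - e \<le> \<phi> (h (t *\<^sub>R \<zeta>))" by simp
      qed (use int_\<phi>[OF h_t] int_\<phi>[OF cont[OF t(1,2)]] in auto)
      also have "\<dots> \<le> (LINT \<zeta>|torus_measure. \<phi> (h \<zeta>))"
        by (rule contraction[OF h_hol h_cont t(1,2)])
      finally have "M - 2 * e \<le> (LINT \<zeta>|torus_measure. \<phi> (h \<zeta>))" .
      moreover have "(LINT \<zeta>|torus_measure. \<phi> (F r \<zeta>) + \<phi> (F r' \<zeta>) - 2 * \<phi> (h \<zeta>)) =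
          \<Phi> r + \<Phi> r' - 2 * (LINT \<zeta>|torus_measure. \<phi> (h \<zeta>))"
        using int_\<phi>[OF h_torus] int_\<phi>[OF cont[of r]] int_\<phi>[OF cont[of r']] r r' by (simp add: \<Phi>_def)
      ultimately show "(LINT \<zeta>|torus_measure. \<phi> (F r \<zeta>) + \<phi> (F r' \<zeta>) - 2 * \<phi> ((F r \<zeta> + F r' \<zeta>) / 2)) \<le> 4 * e"
        using \<Phi>_M[of r] \<Phi>_M[of r'] r r' by (simp add: h_def)
    qed
  qed
  have cauchy: "\<exists>r0. 0 \<le> r0 \<and> r0 < 1 \<and> (\<forall>r r'. r0 < r \<longrightarrow> r < 1 \<longrightarrow> r0 < r' \<longrightarrow> r' < 1 \<longrightarrow>
      (\<integral>\<^sup>+ \<zeta>. ennreal (norm (F r \<zeta> - F r' \<zeta>)) \<partial>torus_measure) \<le> ennreal \<epsilon>)"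
    if \<epsilon>: "\<epsilon> > 0" for \<epsilon>
  proof -
    \<comment> \<open>The choices follow the three terms of \<open>norm_diff_le_gap\<close>:
      \<open>\<Lambda>\<close> makes the tail smaller than \<open>\<epsilon> / 3\<close>,
      \<open>\<eta>\<close> is itself \<open>\<epsilon> / 3\<close>, and \<open>e\<close> makes the
      gap term \<open>4 * e * (\<Lambda> ^ 3 / \<eta>)\<close> equal to
      \<open>\<epsilon> / 3\<close>.\<close>
    define C where "C = 4 powr p * (1 + K' + K')"
    have "C > 0"
      by (auto simp: C_def K'_def intro!: mult_pos_pos add_pos_nonneg)
    have "((\<lambda>x. C * x powr (1 - p)) \<longlongrightarrow> C * 0) at_top"
      by (intro tendsto_mult tendsto_const tendsto_neg_powr filterlim_ident) (use p in auto)
    then have "\<forall>\<^sub>F x in at_top. C * x powr (1 - p) < \<epsilon> / 3"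
      using \<epsilon> by (intro order_tendstoD(2)) auto
    then have "\<forall>\<^sub>F x in at_top. C * x powr (1 - p) < \<epsilon> / 3 \<and> x > (0::real)"
      by (intro eventually_conj eventually_gt_at_top)
    then obtain \<Lambda> where \<Lambda>: "C * \<Lambda> powr (1 - p) < \<epsilon> / 3" "\<Lambda> > 0"
      by (auto simp: eventually_at_top_linorder)
    define \<eta> where "\<eta> = \<epsilon> / 3"
    define e where "e = \<epsilon> / 3 * \<eta> / (4 * \<Lambda> ^ 3)"
    have pos: "\<eta> > 0" "e > 0"
      using \<epsilon> \<Lambda> by (auto simp: \<eta>_def e_def)
    obtain r0 where r0: "0 \<le> r0" "r0 < 1"
      "\<And>r r'. r0 < r \<Longrightarrow> r < 1 \<Longrightarrow> r0 < r' \<Longrightarrow> r' < 1 \<Longrightarrow>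
        (LINT \<zeta>|torus_measure. \<phi> (F r \<zeta>) + \<phi> (F r' \<zeta>) - 2 * \<phi> ((F r \<zeta> + F r' \<zeta>) / 2)) \<le> 4 * e"
      using gap[OF pos(2)] by blast
    show ?thesis
    proof (intro exI conjI allI impI)
      show "0 \<le> r0" "r0 < 1" by fact+
      fix r r' assume r: "r0 < r" "r < 1" and r': "r0 < r'" "r' < 1"
      have nn: "0 \<le> r" "0 \<le> r'"
        using r r' r0 by auto
      define \<delta> where "\<delta> \<zeta> = \<phi> (F r \<zeta>) + \<phi> (F r' \<zeta>) - 2 * \<phi> ((F r \<zeta> + F r' \<zeta>) / 2)" for \<zeta>
      have int_h: "integrable torus_measure (\<lambda>\<zeta>. \<phi> ((F r \<zeta> + F r' \<zeta>) / 2))"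
        by (intro int_\<phi> continuous_intros cont nn r r') auto
      have int_\<delta>: "integrable torus_measure \<delta>"
        unfolding \<delta>_def using int_h int_\<phi>[OF cont[of r]] int_\<phi>[OF cont[of r']] r r' nn by auto
      have int_1: "integrable torus_measure (\<lambda>\<zeta>. norm (F r \<zeta> - F r' \<zeta>))"
        by (intro integrable_torus_continuous continuous_intros cont nn r r')
      note ip = int_powr[OF nn(1) r(2)] int_powr[OF nn(2) r'(2)]
      have "(LINT \<zeta>|torus_measure. norm (F r \<zeta> - F r' \<zeta>)) \<le>
          (LINT \<zeta>|torus_measure. \<eta> + \<delta> \<zeta> * (\<Lambda> ^ 3 / \<eta>) +
            (1 + norm (F r \<zeta>) powr p + norm (F r' \<zeta>) powr p) * (4 powr p * \<Lambda> powr (1 - p)))"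
      proof (rule integral_mono[OF int_1])
        show "integrable torus_measure (\<lambda>\<zeta>. \<eta> + \<delta> \<zeta> * (\<Lambda> ^ 3 / \<eta>) +
            (1 + norm (F r \<zeta>) powr p + norm (F r' \<zeta>) powr p) * (4 powr p * \<Lambda> powr (1 - p)))"
          using int_\<delta> ip by (intro Bochner_Integration.integrable_add integrable_mult_left torus.integrable_const) auto
        show "norm (F r \<zeta> - F r' \<zeta>) \<le> \<eta> + \<delta> \<zeta> * (\<Lambda> ^ 3 / \<eta>) +
            (1 + norm (F r \<zeta>) powr p + norm (F r' \<zeta>) powr p) * (4 powr p * \<Lambda> powr (1 - p))" for \<zeta>
          using norm_diff_le_gap[OF _ pos(1) \<Lambda>(2), of p "F r \<zeta>" "F r' \<zeta>"] p
          by (simp add: \<delta>_def \<phi>_def mult_ac)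
      qed
      also have "\<dots> = \<eta> + (LINT \<zeta>|torus_measure. \<delta> \<zeta>) * (\<Lambda> ^ 3 / \<eta>) +
          (1 + (LINT \<zeta>|torus_measure. norm (F r \<zeta>) powr p) + (LINT \<zeta>|torus_measure. norm (F r' \<zeta>) powr p)) * (4 powr p * \<Lambda> powr (1 - p))"
        using int_\<delta> ip by simp
      also have "\<dots> \<le> \<eta> + 4 * e * (\<Lambda> ^ 3 / \<eta>) + (1 + K' + K') * (4 powr p * \<Lambda> powr (1 - p))"
        using r0(3)[OF r r'] powr_le[OF nn(1) r(2)] powr_le[OF nn(2) r'(2)] \<Lambda>(2) pos
        by (intro add_mono mult_right_mono) (auto simp: \<delta>_def)
      also have "4 * e * (\<Lambda> ^ 3 / \<eta>) = \<epsilon> / 3"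
        using pos \<Lambda> by (simp add: e_def)
      also have "(1 + K' + K') * (4 powr p * \<Lambda> powr (1 - p)) = C * \<Lambda> powr (1 - p)"
        by (simp add: C_def)
      finally have "(LINT \<zeta>|torus_measure. norm (F r \<zeta> - F r' \<zeta>)) \<le> \<epsilon>"
        using \<Lambda> by (simp add: \<eta>_def)
      then show "(\<integral>\<^sup>+ \<zeta>. ennreal (norm (F r \<zeta> - F r' \<zeta>)) \<partial>torus_measure) \<le> ennreal \<epsilon>"
        using int_1 by (subst nn_integral_eq_integral) (auto intro: ennreal_leI)
    qed
  qed
  have "\<forall>k. \<exists>r0. 0 \<le> r0 \<and> r0 < 1 \<and> (\<forall>r r'. r0 < r \<longrightarrow> r < 1 \<longrightarrow> r0 < r' \<longrightarrow> r' < 1 \<longrightarrow>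
      (\<integral>\<^sup>+ \<zeta>. ennreal (norm (F r \<zeta> - F r' \<zeta>)) \<partial>torus_measure) \<le> ennreal ((1 / 2) ^ k))"
    by (intro allI cauchy) simp
  then obtain \<rho> where \<rho>: "\<And>k. 0 \<le> \<rho> k" "\<And>k. \<rho> k < (1::real)"
    "\<And>k r r'. \<rho> k < r \<Longrightarrow> r < 1 \<Longrightarrow> \<rho> k < r' \<Longrightarrow> r' < 1 \<Longrightarrow>
      (\<integral>\<^sup>+ \<zeta>. ennreal (norm (F r \<zeta> - F r' \<zeta>)) \<partial>torus_measure) \<le> ennreal ((1 / 2) ^ k)"
    by (metis (no_types))
  \<comment> \<open>Halfway between 1 and the largest of the first thresholds, so that
    \<open>R k\<close> lies beyond \<open>\<rho> j\<close> for every
    \<open>j \<le> k\<close>.\<close>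
  define R where "R k = (1 + Max (\<rho> ` {..k})) / 2" for k :: nat
  have R_gt: "\<rho> j < R k" if "j \<le> k" for j k
  proof -
    have "\<rho> j \<le> Max (\<rho> ` {..k})"
      using that by (intro Max_ge) auto
    moreover have "\<rho> j < 1" by (rule \<rho>)
    ultimately show ?thesis by (simp add: R_def)
  qed
  have R_lt: "R k < 1" for k
  proof -
    have "Max (\<rho> ` {..k}) < 1"
      using \<rho>(2) by (subst Max_less_iff) auto
    then show ?thesis by (simp add: R_def)
  qed
  have R_nn: "0 \<le> R k" for k
    using R_gt[of k k] \<rho>(1)[of k] by simp
  have meas [measurable]: "F r \<in> borel_measurable torus_measure" if "0 \<le> r" "r < 1" for r
    by (intro measurable_torus_continuous cont that)
  have measR [measurable]: "F (R k) \<in> borel_measurable torus_measure" for k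
    by (intro meas R_nn R_lt)
  have "(\<integral>\<^sup>+ \<zeta>. ennreal (norm (F (R (Suc k)) \<zeta> - F (R k) \<zeta>)) \<partial>torus_measure) \<le> ennreal ((1 / 2) ^ k)" for k
    by (intro \<rho>(3) R_gt R_lt) auto
  from L1_fast_cauchy_limit[OF measR this]
  obtain g where g [measurable]: "g \<in> borel_measurable torus_measure"
    and lim: "AE \<zeta> in torus_measure. (\<lambda>k. F (R k) \<zeta>) \<longlonglongrightarrow> g \<zeta>"
    by blast
  have "has_boundary_value f g"
    unfolding has_boundary_value_iff
  proof (intro conjI allI impI)
    fix e :: real assume "e > 0"
    then obtain j where j: "(1 / 2) ^ j < e"
      using real_arch_pow_inv[of e "1 / 2"] by auto
    have "\<forall>\<^sub>F r in at_left (1::real). \<rho> j < r \<and> r < 1"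
      using eventually_at_left_real[OF \<rho>(2)[of j]] by (auto elim: eventually_mono)
    then show "\<forall>\<^sub>F r in at_left 1. (\<integral>\<^sup>+ \<zeta>. ennreal (norm (f (r *\<^sub>R \<zeta>) - g \<zeta>)) \<partial>torus_measure) < ennreal e"
    proof eventually_elim
      case (elim r)
      then have [measurable]: "F r \<in> borel_measurable torus_measure"
        using \<rho>(1)[of j] by (intro meas) auto
      \<comment> \<open>Convergence is known only along \<open>R k\<close> and almost everywhere.
        Fatou's lemma carries the Cauchy estimate between \<open>F r\<close> and
        \<open>F (R k)\<close> over to \<open>F r\<close> and \<open>g\<close>, for every
        \<open>r\<close> beyond \<open>\<rho> j\<close>.\<close>
      have "(\<integral>\<^sup>+ \<zeta>. ennreal (norm (F r \<zeta> - g \<zeta>)) \<partial>torus_measure) =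
          (\<integral>\<^sup>+ \<zeta>. liminf (\<lambda>k. ennreal (norm (F r \<zeta> - F (R k) \<zeta>))) \<partial>torus_measure)"
      proof (rule nn_integral_cong_AE)
        show "AE \<zeta> in torus_measure. ennreal (norm (F r \<zeta> - g \<zeta>)) = liminf (\<lambda>k. ennreal (norm (F r \<zeta> - F (R k) \<zeta>)))"
          using lim
        proof eventually_elim
          case (elim \<zeta>)
          then have "(\<lambda>k. ennreal (norm (F r \<zeta> - F (R k) \<zeta>))) \<longlonglongrightarrow> ennreal (norm (F r \<zeta> - g \<zeta>))"
            by (intro tendsto_ennrealI tendsto_intros)
          then show ?case
            by (intro lim_imp_Liminf[symmetric]) auto
        qed
      qed
      also have "\<dots> \<le> liminf (\<lambda>k. \<integral>\<^sup>+ \<zeta>. ennreal (norm (F r \<zeta> - F (R k) \<zeta>)) \<partial>torus_measure)"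
        by (rule nn_integral_liminf) measurable
      also have "\<dots> \<le> liminf (\<lambda>k. ennreal ((1 / 2) ^ j))"
      proof (rule Liminf_mono)
        show "\<forall>\<^sub>F k in sequentially. (\<integral>\<^sup>+ \<zeta>. ennreal (norm (F r \<zeta> - F (R k) \<zeta>)) \<partial>torus_measure) \<le> ennreal ((1 / 2) ^ j)"
          using eventually_ge_at_top[of j] by eventually_elim (intro \<rho>(3) R_gt R_lt, use elim in auto)
      qed
      also have "\<dots> = ennreal ((1 / 2) ^ j)"
        by (simp add: Liminf_const)
      also have "\<dots> < ennreal e"
        using j \<open>e > 0\<close> by (intro ennreal_lessI) auto
      finally show ?case
        by (simp add: F_def)
    qed
  qed (rule g)
  then show ?thesis by blast
qed

section \<open>Norms of the reproducing kernels\<close>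

lemma finite_dyadic:
  fixes d :: real
  assumes "0 < d"
  shows "finite {j. 2 ^ j * d \<le> y}"
proof -
  obtain N where N: "y / d < 2 ^ N"
    using real_arch_pow[of 2 "y / d"] by auto
  have "j < N" if "2 ^ j * d \<le> y" for j
  proof (rule ccontr)
    assume "\<not> j < N"
    then have "(2::real) ^ N \<le> 2 ^ j" by (intro power_increasing) auto
    moreover have "2 ^ j \<le> y / d" using that assms by (simp add: field_simps)
    ultimately show False using N by linarith
  qed
  then have "{j. 2 ^ j * d \<le> y} \<subseteq> {..<N}"
    unfolding lessThan_def by blast
  then show ?thesis
    by (rule finite_subset) (rule finite_lessThan)
qed

text \<open>Trades the power \<open>- r\<close> for squares. The largest dyadic multiple
  \<open>t = 2 ^ j * d\<close> not above \<open>X\<close> satisfies \<open>X < 2 * t\<close>, hence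
  \<open>t + X \<le> 3 * t\<close>, and this single term of the sum already dominates; the 9 is the
  square of 3.\<close>

lemma dyadic_bound:
  fixes X d r :: real
  assumes d: "0 < d" "d \<le> X" "X \<le> 2" and r: "0 \<le> r"
  shows "X powr (- r) \<le> (\<Sum>j\<in>{j. 2 ^ j * d \<le> 2}. 9 * (2 ^ j * d) powr (2 - r) / (2 ^ j * d + X)\<^sup>2)"
proof -
  note fin = finite_dyadic[OF d(1)]
  define j where "j = Max {j. 2 ^ j * d \<le> X}"
  have ne: "0 \<in> {j. 2 ^ j * d \<le> X}"
    using d by simp
  have j: "2 ^ j * d \<le> X"
    using Max_in[OF fin, of X] ne unfolding j_def by blast
  have j': "X < 2 * (2 ^ j * d)"
  proof (rule ccontr)
    assume "\<not> X < 2 * (2 ^ j * d)"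
    then have "Suc j \<le> j"
      unfolding j_def by (intro Max_ge fin) (simp add: j_def mult.assoc)
    then show False by simp
  qed
  define t where "t = 2 ^ j * d"
  have t: "t > 0" "t \<le> X" "X < 2 * t"
    using d j j' by (auto simp: t_def)
  have "X powr (- r) \<le> t powr (- r)"
    using t r by (intro powr_mono2') auto
  also have "\<dots> = 9 * t powr (2 - r) / (3 * t)\<^sup>2"
  proof -
    have "t powr (2 - r) = t\<^sup>2 * t powr (- r)"
      using t powr_add[of t 2 "- r"] by (simp add: powr_numeral)
    then show ?thesis
      using t by (simp add: power_mult_distrib)
  qed
  also have "\<dots> \<le> 9 * t powr (2 - r) / (t + X)\<^sup>2"
    using t by (intro divide_left_mono power_mono mult_pos_pos) auto
  also have "\<dots> \<le> (\<Sum>j\<in>{j. 2 ^ j * d \<le> 2}. 9 * (2 ^ j * d) powr (2 - r) / (2 ^ j * d + X)\<^sup>2)"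
    unfolding t_def
    by (rule member_le_sum[of j _ "\<lambda>j. 9 * (2 ^ j * d) powr (2 - r) / (2 ^ j * d + X)\<^sup>2"])
       (use j d fin in auto)
  finally show ?thesis .
qed

lemma dyadic_sum_le:
  fixes d r :: real
  assumes d: "0 < d" and r: "1 < r"
  shows "(\<Sum>j\<in>{j. 2 ^ j * d \<le> 2}. (2 ^ j * d) powr (1 - r)) \<le> d powr (1 - r) / (1 - 2 powr (1 - r))"
proof -
  define q where "q = (2::real) powr (1 - r)"
  have q: "0 < q" "q < 1"
    using r by (auto simp: q_def powr_less_one)
  have "(2 ^ j * d) powr (1 - r) = d powr (1 - r) * q ^ j" for j
    using d by (simp add: powr_mult q_def powr_powr powr_realpow[symmetric] powr_power mult.commute)
  then have "(\<Sum>j\<in>{j. 2 ^ j * d \<le> 2}. (2 ^ j * d) powr (1 - r)) = d powr (1 - r) * (\<Sum>j\<in>{j. 2 ^ j * d \<le> 2}. q ^ j)"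
    by (simp add: sum_distrib_left)
  also have "\<dots> \<le> d powr (1 - r) * (\<Sum>j. q ^ j)"
    using q by (intro mult_left_mono sum_le_suminf finite_dyadic d summable_geometric) auto
  also have "(\<Sum>j. q ^ j) = 1 / (1 - q)"
    using q by (intro suminf_geometric) auto
  finally show ?thesis
    by (simp add: q_def)
qed

text \<open>Moving \<open>x\<close> to \<open>x / (1 + t)\<close> changes the denominator by at most
  \<open>t\<close>, so each quotient in \<open>dyadic_bound\<close> is dominated by a squared kernel
  factor at the moved point. The integral of a squared kernel is known exactly.\<close>

lemma szego_factor_bound:
  fixes x \<zeta> :: complex
  assumes x: "norm x < 1" and \<zeta>: "norm \<zeta> = 1" and r: "0 \<le> r"
  shows "norm (1 / (1 - cnj x * \<zeta>)) powr r \<le>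
    (\<Sum>j\<in>{j. 2 ^ j * (1 - norm x) \<le> 2}. 9 * (2 ^ j * (1 - norm x)) powr (2 - r) *
      (norm (1 / (1 - cnj (x / of_real (1 + 2 ^ j * (1 - norm x))) * \<zeta>)))\<^sup>2)"
proof -
  define d where "d = 1 - norm x"
  define X where "X = norm (1 - cnj x * \<zeta>)"
  have nx: "norm (cnj x * \<zeta>) = norm x"
    by (simp add: norm_mult \<zeta>)
  have d: "0 < d" "d \<le> X" "X \<le> 2"
    using x norm_triangle_ineq2[of 1 "cnj x * \<zeta>"] norm_triangle_ineq4[of 1 "cnj x * \<zeta>"] nx
    by (auto simp: d_def X_def)
  have "norm (1 / (1 - cnj x * \<zeta>)) powr r = X powr (- r)"
    by (simp add: X_def norm_divide powr_minus powr_divide inverse_eq_divide)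
  also have "\<dots> \<le> (\<Sum>j\<in>{j. 2 ^ j * d \<le> 2}. 9 * (2 ^ j * d) powr (2 - r) / (2 ^ j * d + X)\<^sup>2)"
    by (rule dyadic_bound[OF d r])
  also have "\<dots> \<le> (\<Sum>j\<in>{j. 2 ^ j * d \<le> 2}. 9 * (2 ^ j * d) powr (2 - r) *
      (norm (1 / (1 - cnj (x / of_real (1 + 2 ^ j * d)) * \<zeta>)))\<^sup>2)"
  proof (rule sum_mono)
    fix j
    define t where "t = 2 ^ j * d"
    have t: "t > 0" using d by (simp add: t_def)
    define w where "w = 1 - cnj (x / of_real (1 + t)) * \<zeta>"
    have "w = (1 - cnj x * \<zeta>) + of_real (t / (1 + t)) * (cnj x * \<zeta>)"
      using t by (simp add: w_def field_simps del: of_real_add) (simp add: algebra_simps)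
    then have "norm w \<le> X + norm (of_real (t / (1 + t)) * (cnj x * \<zeta>))"
      unfolding X_def by (metis norm_triangle_ineq)
    also have "norm (of_real (t / (1 + t)) * (cnj x * \<zeta>)) = t / (1 + t) * norm x"
      using t by (simp only: norm_mult nx norm_of_real abs_of_pos divide_pos_pos add_pos_pos zero_less_one mult.assoc)
         (simp add: \<zeta>)
    also have "\<dots> \<le> t * 1"
      using t x by (intro mult_mono) (auto simp: field_simps)
    finally have wle: "norm w \<le> t + X" by simp
    have "w \<noteq> 0"
    proof -
      have "norm (cnj (x / of_real (1 + t)) * \<zeta>) = norm x / (1 + t)"
        using t by (simp add: norm_mult norm_divide \<zeta> del: of_real_add)
      also have "\<dots> < 1" using t x by (simp add: field_simps)
      finally show ?thesis unfolding w_def by (rule one_minus_nonzero)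
    qed
    then have "1 / (t + X)\<^sup>2 \<le> 1 / (norm w)\<^sup>2"
      using wle t d by (intro divide_left_mono power_mono mult_pos_pos) auto
    then have "9 * t powr (2 - r) * (1 / (t + X)\<^sup>2) \<le> 9 * t powr (2 - r) * (1 / (norm w)\<^sup>2)"
      by (intro mult_left_mono) auto
    then show "9 * (2 ^ j * d) powr (2 - r) / (2 ^ j * d + X)\<^sup>2 \<le> 9 * (2 ^ j * d) powr (2 - r) *
      (norm (1 / (1 - cnj (x / of_real (1 + 2 ^ j * d)) * \<zeta>)))\<^sup>2"
      unfolding t_def[symmetric] w_def[symmetric] by (simp add: norm_divide power_divide)
  qed
  finally show ?thesis
    unfolding d_def .
qed

text \<open>For scales \<open>t \<le> 2\<close> the squared modulus of the moved point stays below 1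
  by at least \<open>t / 9\<close>, so each term is at most \<open>81 * t powr (1 - r)\<close>. As
  \<open>r > 1\<close>, this is a geometric sum governed by its smallest scale \<open>t = d\<close>,
  and \<open>d\<close> is at least half of \<open>1 - (norm x)\<^sup>2\<close>.\<close>

lemma dyadic_diag_bound:
  fixes x :: complex
  assumes x: "norm x < 1" and r: "1 < r"
  shows "(\<Sum>j\<in>{j. 2 ^ j * (1 - norm x) \<le> 2}. 9 * (2 ^ j * (1 - norm x)) powr (2 - r) *
      (1 / (1 - (norm (x / of_real (1 + 2 ^ j * (1 - norm x))))\<^sup>2)))
    \<le> 81 * 2 powr (r - 1) / (1 - 2 powr (1 - r)) * (1 / (1 - (norm x)\<^sup>2)) powr (r - 1)"
proof -
  define d where "d = 1 - norm x"
  have d: "0 < d" using x by (simp add: d_def)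
  have "(\<Sum>j\<in>{j. 2 ^ j * d \<le> 2}. 9 * (2 ^ j * d) powr (2 - r) *
      (1 / (1 - (norm (x / of_real (1 + 2 ^ j * d)))\<^sup>2))) \<le>
      (\<Sum>j\<in>{j. 2 ^ j * d \<le> 2}. 81 * (2 ^ j * d) powr (1 - r))"
  proof (rule sum_mono)
    fix j assume "j \<in> {j. 2 ^ j * d \<le> 2}"
    define t where "t = 2 ^ j * d"
    have t: "0 < t" "t \<le> 2"
      using d \<open>j \<in> _\<close> by (auto simp: t_def)
    have "norm (x / of_real (1 + t)) = norm x / (1 + t)"
      using t by (simp add: norm_divide del: of_real_add)
    also have "\<dots> \<le> 1 / (1 + t)"
      using x t by (intro divide_right_mono) auto
    finally have "(norm (x / of_real (1 + t)))\<^sup>2 \<le> (1 / (1 + t))\<^sup>2"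
      by (intro power_mono) auto
    moreover have "t / 9 \<le> 1 - (1 / (1 + t))\<^sup>2"
    proof -
      have "1 - (1 / (1 + t))\<^sup>2 = ((1 + t)\<^sup>2 - 1) / (1 + t)\<^sup>2"
        using t by (simp add: power_divide diff_divide_distrib)
      also have "(1 + t)\<^sup>2 - 1 = t * (2 + t)"
        by (simp add: power2_eq_square algebra_simps)
      finally have "1 - (1 / (1 + t))\<^sup>2 = t * (2 + t) / (1 + t)\<^sup>2" .
      moreover have "(1 + t)\<^sup>2 \<le> 9 * (2 + t)"
      proof -
        have "(1 + t)\<^sup>2 \<le> 3\<^sup>2" using t by (intro power_mono) auto
        then show ?thesis using t by simp
      qed
      then have "t * (1 + t)\<^sup>2 \<le> t * (9 * (2 + t))"
        using t by (intro mult_left_mono) auto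
      then have "t / 9 \<le> t * (2 + t) / (1 + t)\<^sup>2"
        using t by (subst pos_le_divide_eq) auto
      ultimately show ?thesis
        by simp
    qed
    ultimately have "t / 9 \<le> 1 - (norm (x / of_real (1 + t)))\<^sup>2"
      by linarith
    then have "1 / (1 - (norm (x / of_real (1 + t)))\<^sup>2) \<le> 1 / (t / 9)"
      using t by (intro divide_left_mono mult_pos_pos) auto
    then have "9 * t powr (2 - r) * (1 / (1 - (norm (x / of_real (1 + t)))\<^sup>2)) \<le> 9 * t powr (2 - r) * (9 / t)"
      by (intro mult_left_mono) auto
    also have "\<dots> = 81 * t powr (1 - r)"
      using t powr_add[of t "1 - r" 1] by (simp add: field_simps)
    finally show "9 * (2 ^ j * d) powr (2 - r) * (1 / (1 - (norm (x / of_real (1 + 2 ^ j * d)))\<^sup>2)) \<le> 81 * (2 ^ j * d) powr (1 - r)"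
      by (simp add: t_def)
  qed
  also have "\<dots> = 81 * (\<Sum>j\<in>{j. 2 ^ j * d \<le> 2}. (2 ^ j * d) powr (1 - r))"
    by (simp add: sum_distrib_left)
  also have "\<dots> \<le> 81 * (d powr (1 - r) / (1 - 2 powr (1 - r)))"
    by (intro mult_left_mono dyadic_sum_le d r) auto
  also have "\<dots> \<le> 81 * (2 powr (r - 1) * (1 / (1 - (norm x)\<^sup>2)) powr (r - 1) / (1 - 2 powr (1 - r)))"
  proof -
    have pos: "0 < 1 - (norm x)\<^sup>2"
      using x by (simp add: abs_square_less_1)
    have "1 - (norm x)\<^sup>2 = d * (1 + norm x)"
      by (simp add: d_def power2_eq_square algebra_simps)
    also have "\<dots> \<le> d * 2"
      using d x by (intro mult_left_mono) auto
    finally have "(1 - (norm x)\<^sup>2) / 2 \<le> d" by simp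
    then have "d powr (1 - r) \<le> ((1 - (norm x)\<^sup>2) / 2) powr (1 - r)"
      using pos r by (intro powr_mono2') auto
    also have "\<dots> = 2 powr (r - 1) * (1 / (1 - (norm x)\<^sup>2)) powr (r - 1)"
      using pos powr_minus_divide[of 2 "r - 1"] powr_minus_divide[of "1 - (norm x)\<^sup>2" "r - 1"]
      by (simp add: powr_divide)
    finally show ?thesis
      using r by (intro mult_left_mono divide_right_mono) (auto simp: less_imp_le powr_less_one)
  qed
  finally show ?thesis
    unfolding d_def by (simp add: mult_ac)
qed

text \<open>After multiplying the one-variable bounds, the product of sums over scales becomes a sum
  over functions \<open>g\<close> that choose one scale per coordinate. Each term is a squared
  kernel at \<open>b g\<close>, with integral \<open>kdiag (b g)\<close>. The integrated sum factors
  again, and \<open>dyadic_diag_bound\<close> handles each factor.\<close>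

lemma nn_integral_szego_kernel_powr:
  assumes r: "1 < r"
  shows "\<exists>C>0. \<forall>a\<in>(polydisc :: (complex ^ 'n) set).
    (\<integral>\<^sup>+ \<zeta>. ennreal (norm (szego_kernel a \<zeta>) powr r) \<partial>torus_measure) \<le> ennreal (C * kdiag a powr (r - 1))"
proof -
  define B where "B = 81 * 2 powr (r - 1) / (1 - 2 powr (1 - r))"
  have B: "B > 0"
    using r by (auto simp: B_def powr_less_one)
  show ?thesis
  proof (intro exI conjI ballI)
    show "0 < B ^ CARD('n)" using B by simp
    fix a :: "complex ^ 'n" assume a: "a \<in> polydisc"
    have na: "norm (a $ i) < 1" for i
      using a by (simp add: polydisc_def)
    define t where "t i j = 2 ^ j * (1 - norm (a $ i))" for i and j :: nat
    define J where "J i = {j. t i j \<le> 2}" for i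
    define c where "c i j = 9 * t i j powr (2 - r)" for i j
    define b where "b g = (\<chi> i. a $ i / of_real (1 + t i (g i)))" for g
    have tpos: "t i j > 0" for i j
      using na by (simp add: t_def)
    have cnn: "0 \<le> c i j" for i j
      by (simp add: c_def)
    have fin: "finite (J i)" for i
      unfolding J_def t_def by (intro finite_dyadic) (use na in simp)
    have b_in: "b g \<in> polydisc" for g
      unfolding polydisc_def
    proof safe
      fix i
      have "norm (b g $ i) = norm (a $ i) / (1 + t i (g i))"
        using tpos[of i "g i"] by (simp add: b_def norm_divide del: of_real_add)
      also have "\<dots> < 1"
        using na[of i] tpos[of i "g i"] by (simp add: field_simps)
      finally show "norm (b g $ i) < 1" .
    qed
    have pw: "norm (szego_kernel a \<zeta>) powr r \<le>
        (\<Sum>g\<in>PiE UNIV J. (\<Prod>i\<in>UNIV. c i (g i)) * (norm (szego_kernel (b g) \<zeta>))\<^sup>2)" if "\<zeta> \<in> torus" for \<zeta>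
    proof -
      have "norm (szego_kernel a \<zeta>) powr r = (\<Prod>i\<in>UNIV. norm (1 / (1 - cnj (a $ i) * \<zeta> $ i)) powr r)"
        unfolding szego_kernel_def prod_norm[symmetric] by (rule prod_powr_distrib)
      also have "\<dots> \<le> (\<Prod>i\<in>UNIV. \<Sum>j\<in>J i. c i j * (norm (1 / (1 - cnj (a $ i / of_real (1 + t i j)) * \<zeta> $ i)))\<^sup>2)"
        using szego_factor_bound[OF na, of "\<zeta> $ _" r] that r
        by (intro prod_mono) (auto simp: t_def J_def c_def torus_def)
      also have "\<dots> = (\<Sum>g\<in>PiE UNIV J. \<Prod>i\<in>UNIV. c i (g i) * (norm (1 / (1 - cnj (a $ i / of_real (1 + t i (g i))) * \<zeta> $ i)))\<^sup>2)"
        using fin by (intro prod_sum_PiE) auto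
      also have "\<dots> = (\<Sum>g\<in>PiE UNIV J. (\<Prod>i\<in>UNIV. c i (g i)) * (norm (szego_kernel (b g) \<zeta>))\<^sup>2)"
        by (simp add: prod.distrib szego_kernel_def b_def prod_norm[symmetric] prod_power_distrib[symmetric])
      finally show ?thesis .
    qed
    have finP: "finite (PiE UNIV J)"
      using fin by (intro finite_PiE) auto
    have cP: "0 \<le> (\<Prod>i\<in>UNIV. c i (g i))" for g
      by (intro prod_nonneg) (simp add: cnn)
    have "(\<integral>\<^sup>+ \<zeta>. ennreal (norm (szego_kernel a \<zeta>) powr r) \<partial>torus_measure) \<le>
        (\<integral>\<^sup>+ \<zeta>. (\<Sum>g\<in>PiE UNIV J. ennreal (\<Prod>i\<in>UNIV. c i (g i)) * ennreal ((norm (szego_kernel (b g) \<zeta>))\<^sup>2)) \<partial>torus_measure)"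
    proof (rule nn_integral_mono)
      fix \<zeta> :: "complex ^ 'n" assume "\<zeta> \<in> space torus_measure"
      then have "ennreal (norm (szego_kernel a \<zeta>) powr r) \<le>
        ennreal (\<Sum>g\<in>PiE UNIV J. (\<Prod>i\<in>UNIV. c i (g i)) * (norm (szego_kernel (b g) \<zeta>))\<^sup>2)"
        by (intro ennreal_leI pw) simp
      also have "\<dots> = (\<Sum>g\<in>PiE UNIV J. ennreal (\<Prod>i\<in>UNIV. c i (g i)) * ennreal ((norm (szego_kernel (b g) \<zeta>))\<^sup>2))"
        using cP by (subst sum_ennreal[symmetric]) (auto intro!: sum.cong simp: ennreal_mult)
      finally show "ennreal (norm (szego_kernel a \<zeta>) powr r) \<le>
          (\<Sum>g\<in>PiE UNIV J. ennreal (\<Prod>i\<in>UNIV. c i (g i)) * ennreal ((norm (szego_kernel (b g) \<zeta>))\<^sup>2))" .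
    qed
    also have "\<dots> = (\<Sum>g\<in>PiE UNIV J. \<integral>\<^sup>+ \<zeta>. ennreal (\<Prod>i\<in>UNIV. c i (g i)) * ennreal ((norm (szego_kernel (b g) \<zeta>))\<^sup>2) \<partial>torus_measure)"
    proof (rule nn_integral_sum)
      fix g
      note [measurable] = szego_kernel_measurable[OF b_in[of g]]
      show "(\<lambda>\<zeta>. ennreal (\<Prod>i\<in>UNIV. c i (g i)) * ennreal ((norm (szego_kernel (b g) \<zeta>))\<^sup>2)) \<in> borel_measurable torus_measure"
        by measurable
    qed
    also have "\<dots> = (\<Sum>g\<in>PiE UNIV J. ennreal ((\<Prod>i\<in>UNIV. c i (g i)) * kdiag (b g)))"
    proof (rule sum.cong[OF refl])
      fix g
      note [measurable] = szego_kernel_measurable[OF b_in[of g]]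
      show "(\<integral>\<^sup>+ \<zeta>. ennreal (\<Prod>i\<in>UNIV. c i (g i)) * ennreal ((norm (szego_kernel (b g) \<zeta>))\<^sup>2) \<partial>torus_measure) =
          ennreal ((\<Prod>i\<in>UNIV. c i (g i)) * kdiag (b g))"
        using cP[of g] kdiag_pos[OF b_in[of g]]
        by (subst nn_integral_cmult) (auto simp: nn_integral_szego_kernel_sq[OF b_in] ennreal_mult)
    qed
    also have "\<dots> = ennreal (\<Sum>g\<in>PiE UNIV J. (\<Prod>i\<in>UNIV. c i (g i)) * kdiag (b g))"
      using cP kdiag_pos[OF b_in] by (intro sum_ennreal mult_nonneg_nonneg) (auto intro: less_imp_le)
    also have "(\<Sum>g\<in>PiE UNIV J. (\<Prod>i\<in>UNIV. c i (g i)) * kdiag (b g)) =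
        (\<Prod>i\<in>UNIV. \<Sum>j\<in>J i. c i j * (1 / (1 - (norm (a $ i / of_real (1 + t i j)))\<^sup>2)))"
    proof -
      have "(\<Prod>i\<in>UNIV. \<Sum>j\<in>J i. c i j * (1 / (1 - (norm (a $ i / of_real (1 + t i j)))\<^sup>2))) =
          (\<Sum>g\<in>PiE UNIV J. \<Prod>i\<in>UNIV. c i (g i) * (1 / (1 - (norm (a $ i / of_real (1 + t i (g i))))\<^sup>2)))"
        using fin by (intro prod_sum_PiE) auto
      then show ?thesis
        by (simp only: prod.distrib kdiag_def b_def vec_lambda_beta)
    qed
    also have "\<dots> \<le> (\<Prod>i\<in>(UNIV :: 'n set). B * (1 / (1 - (norm (a $ i))\<^sup>2)) powr (r - 1))"
    proof (rule prod_mono, rule conjI)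
      fix i :: 'n
      have "(norm (a $ i / of_real (1 + t i j)))\<^sup>2 < 1" for j
        using norm_sq_less_1[OF b_in[of "\<lambda>_. j"], of i] by (simp add: b_def)
      then show "0 \<le> (\<Sum>j\<in>J i. c i j * (1 / (1 - (norm (a $ i / of_real (1 + t i j)))\<^sup>2)))"
        by (intro sum_nonneg mult_nonneg_nonneg cnn) (simp add: less_imp_le)
      show "(\<Sum>j\<in>J i. c i j * (1 / (1 - (norm (a $ i / of_real (1 + t i j)))\<^sup>2))) \<le> B * (1 / (1 - (norm (a $ i))\<^sup>2)) powr (r - 1)"
        using dyadic_diag_bound[OF na r, of i] by (simp only: t_def J_def c_def B_def)
    qed
    also have "\<dots> = B ^ CARD('n) * kdiag a powr (r - 1)"
      unfolding kdiag_def prod.distrib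
      by (subst prod_powr_distrib) (use norm_sq_less_1[OF a] in \<open>auto intro: less_imp_le\<close>)
    finally show "(\<integral>\<^sup>+ \<zeta>. ennreal (norm (szego_kernel a \<zeta>) powr r) \<partial>torus_measure) \<le> ennreal (B ^ CARD('n) * kdiag a powr (r - 1))"
      by (simp add: ennreal_leI)
  qed
qed

section \<open>From integrals to two-sided bounds for the kernel norms\<close>

lemma Lp_norm_le:
  assumes "0 < r" "0 \<le> K" "(\<integral>\<^sup>+ \<zeta>. ennreal (norm (g \<zeta>) powr r) \<partial>torus_measure) \<le> ennreal K"
  shows "Lp_norm (ennreal r) g \<le> ennreal (K powr (1 / r))"
proof -
  define I where "I = (\<integral>\<^sup>+ \<zeta>. ennreal (norm (g \<zeta>) powr r) \<partial>torus_measure)"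
  have "I < \<infinity>"
    using assms(3) unfolding I_def[symmetric] by (rule le_less_trans) simp
  then have "Lp_norm (ennreal r) g = ennreal (enn2real I powr (1 / r))"
    using assms(1) by (simp add: Lp_norm_def I_def[symmetric] Let_def)
  moreover have "enn2real I \<le> K"
    using assms(2,3) unfolding I_def[symmetric] by (simp add: enn2real_leI)
  ultimately show ?thesis
    using assms(1) by (auto intro!: ennreal_leI powr_mono2)
qed

lemma Lp_norm_leD:
  assumes "0 < r" "0 \<le> K" "Lp_norm (ennreal r) g \<le> ennreal K"
  shows "(\<integral>\<^sup>+ \<zeta>. ennreal (norm (g \<zeta>) powr r) \<partial>torus_measure) \<le> ennreal (K powr r)"
proof -
  define I where "I = (\<integral>\<^sup>+ \<zeta>. ennreal (norm (g \<zeta>) powr r) \<partial>torus_measure)"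
  have Lp: "Lp_norm (ennreal r) g = (if I = \<infinity> then \<infinity> else ennreal (enn2real I powr (1 / r)))"
    using assms(1) by (simp add: Lp_norm_def I_def[symmetric] Let_def)
  have fin: "I \<noteq> \<infinity>"
    using assms(3) Lp by (auto simp: top_unique)
  then have "enn2real I powr (1 / r) \<le> K"
    using assms(2,3) Lp by simp
  then have "(enn2real I powr (1 / r)) powr r \<le> K powr r"
    using assms(1) by (intro powr_mono2) auto
  then have "enn2real I \<le> K powr r"
    using assms(1) by (simp add: powr_powr)
  then have "ennreal (enn2real I) \<le> ennreal (K powr r)"
    by (rule ennreal_leI)
  moreover have "ennreal (enn2real I) = I"
    using fin by (simp add: less_top)
  ultimately show ?thesis
    by (simp only: I_def)
qed

lemma hardy_norm_continuous:
  assumes "holomorphic_polydisc f" "continuous_on cpolydisc f"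
  shows "hardy_norm p f = Lp_norm p f"
  by (intro hardy_norm_eq has_boundary_value_continuous assms)

lemma hardy_norm_szego: "a \<in> polydisc \<Longrightarrow> hardy_norm p (szego_kernel a) = Lp_norm p (szego_kernel a)"
  by (intro hardy_norm_continuous szego_kernel_holomorphic szego_kernel_continuous)

lemma integrable_szego_powr:
  assumes "a \<in> polydisc" "0 < r"
  shows "integrable torus_measure (\<lambda>\<zeta>. norm (szego_kernel a \<zeta>) powr r)"
  by (intro integrable_torus_continuous continuous_on_powr' continuous_intros
      continuous_on_subset[OF szego_kernel_continuous torus_cpolydisc] assms) (use assms in auto)

lemma kernel_norm_eq:
  assumes "a \<in> polydisc" "0 < r"
  shows "kernel_norm (ennreal r) a = (LINT \<zeta>|torus_measure. norm (szego_kernel a \<zeta>) powr r) powr (1 / r)"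
proof -
  have "(\<integral>\<^sup>+ \<zeta>. ennreal (norm (szego_kernel a \<zeta>) powr r) \<partial>torus_measure) =
      ennreal (LINT \<zeta>|torus_measure. norm (szego_kernel a \<zeta>) powr r)"
    by (rule nn_integral_eq_integral) (use integrable_szego_powr[OF assms] in auto)
  moreover have "0 \<le> (LINT \<zeta>|torus_measure. norm (szego_kernel a \<zeta>) powr r)"
    by (intro Bochner_Integration.integral_nonneg) auto
  ultimately show ?thesis
    using assms by (simp add: kernel_norm_def hardy_norm_szego Lp_norm_def Let_def)
qed

lemma integral_szego_kernel_powr:
  assumes r: "1 < r"
  obtains C where "C > 0" "\<And>a :: complex ^ 'n. a \<in> polydisc \<Longrightarrow>
    (LINT \<zeta>|torus_measure. norm (szego_kernel a \<zeta>) powr r) \<le> C * kdiag a powr (r - 1)"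
proof -
  obtain C where C: "C > 0" "\<And>a :: complex ^ 'n. a \<in> polydisc \<Longrightarrow>
      (\<integral>\<^sup>+ \<zeta>. ennreal (norm (szego_kernel a \<zeta>) powr r) \<partial>torus_measure) \<le> ennreal (C * kdiag a powr (r - 1))"
    using nn_integral_szego_kernel_powr[OF r] by blast
  have "(LINT \<zeta>|torus_measure. norm (szego_kernel a \<zeta>) powr r) \<le> C * kdiag a powr (r - 1)"
    if a: "a \<in> polydisc" for a :: "complex ^ 'n"
  proof -
    have "ennreal (LINT \<zeta>|torus_measure. norm (szego_kernel a \<zeta>) powr r) = (\<integral>\<^sup>+ \<zeta>. ennreal (norm (szego_kernel a \<zeta>) powr r) \<partial>torus_measure)"
      by (rule nn_integral_eq_integral[symmetric]) (use integrable_szego_powr[OF a] r in auto)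
    also have "\<dots> \<le> ennreal (C * kdiag a powr (r - 1))"
      by (rule C(2)[OF a])
    finally show ?thesis
      using C(1) by simp
  qed
  with C(1) show ?thesis
    by (rule that)
qed

lemma kernel_norm_upper:
  assumes r: "1 < r"
  obtains C where "C > 0" "\<And>a :: complex ^ 'n. a \<in> polydisc \<Longrightarrow>
    kernel_norm (ennreal r) a \<le> C * kdiag a powr (1 - 1 / r)"
proof -
  obtain C where C: "C > 0" "\<And>a :: complex ^ 'n. a \<in> polydisc \<Longrightarrow>
      (LINT \<zeta>|torus_measure. norm (szego_kernel a \<zeta>) powr r) \<le> C * kdiag a powr (r - 1)"
    using integral_szego_kernel_powr[OF r] by blast
  have "kernel_norm (ennreal r) a \<le> C powr (1 / r) * kdiag a powr (1 - 1 / r)" if a: "a \<in> polydisc" for a :: "complex ^ 'n"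
  proof -
    have "kernel_norm (ennreal r) a \<le> (C * kdiag a powr (r - 1)) powr (1 / r)"
      using r a C(2)[OF a] by (simp add: kernel_norm_eq powr_mono2)
    also have "\<dots> = C powr (1 / r) * kdiag a powr ((r - 1) * (1 / r))"
      using C(1) by (simp add: powr_mult powr_powr)
    also have "(r - 1) * (1 / r) = 1 - 1 / r"
      using r by (simp add: field_simps)
    finally show ?thesis .
  qed
  with C(1) show ?thesis
    by (intro that[of "C powr (1 / r)"]) auto
qed

lemma kernel_norm_infinity_le:
  fixes a :: "complex ^ 'n"
  assumes a: "a \<in> polydisc"
  shows "kernel_norm \<infinity> a \<le> 2 ^ CARD('n) * kdiag a"
proof -
  note [measurable] = szego_kernel_measurable[OF a]
  have "Lp_norm \<infinity> (szego_kernel a) \<le> ennreal (2 ^ CARD('n) * kdiag a)"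
    unfolding Lp_norm_def using norm_szego_kernel_le[OF a] torus_cpolydisc
    by (auto intro!: esssup_I AE_I2 ennreal_leI)
  then show ?thesis
    unfolding kernel_norm_def hardy_norm_szego[OF a] using kdiag_pos[OF a]
    by (intro enn2real_leI) auto
qed

lemma conj_exponent_1: "conj_exponent 1 = \<infinity>"
  by (simp add: conj_exponent_def)

lemma conj_exponent_ennreal:
  assumes "1 < s"
  shows "conj_exponent (ennreal s) = ennreal (s / (s - 1))"
proof -
  have "1 - inverse (ennreal s) = ennreal 1 - ennreal (inverse s)"
    using assms by (simp add: inverse_ennreal)
  also have "\<dots> = ennreal (1 - inverse s)"
    using assms by (intro ennreal_minus) auto
  finally have "conj_exponent (ennreal s) = inverse (ennreal (1 - inverse s))"
    by (simp add: conj_exponent_def)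
  also have "\<dots> = ennreal (inverse (1 - inverse s))"
    using assms by (intro inverse_ennreal) (simp add: field_simps)
  also have "inverse (1 - inverse s) = s / (s - 1)"
    using assms by (simp add: field_simps)
  finally show ?thesis .
qed

text \<open>The exponent is \<open>1 - 1 / s'\<close> rewritten as \<open>1 / s\<close>. For
  \<open>s = 1\<close> the conjugate exponent is infinite and the pointwise bound of the kernel
  takes over.\<close>

lemma kernel_norm_conj_upper:
  assumes s: "1 \<le> s"
  obtains C where "C > 0" "\<And>a :: complex ^ 'n. a \<in> polydisc \<Longrightarrow>
    kernel_norm (conj_exponent (ennreal s)) a \<le> C * kdiag a powr (1 / s)"
proof (cases "s = 1")
  case True
  show ?thesis
  proof (rule that[of "2 ^ CARD('n)"])
    fix a :: "complex ^ 'n" assume a: "a \<in> polydisc"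
    show "kernel_norm (conj_exponent (ennreal s)) a \<le> 2 ^ CARD('n) * kdiag a powr (1 / s)"
      using kernel_norm_infinity_le[OF a] kdiag_pos[OF a] by (simp add: True conj_exponent_1)
  qed simp
next
  case False
  then have "1 < s" using s by simp
  then have gt: "1 < s / (s - 1)" and eq: "1 - 1 / (s / (s - 1)) = 1 / s"
    by (auto simp: field_simps)
  obtain C where "C > 0" "\<And>a :: complex ^ 'n. a \<in> polydisc \<Longrightarrow>
      kernel_norm (ennreal (s / (s - 1))) a \<le> C * kdiag a powr (1 - 1 / (s / (s - 1)))"
    using kernel_norm_upper[OF gt] by blast
  then show ?thesis
    unfolding eq conj_exponent_ennreal[OF \<open>1 < s\<close>, symmetric] by (rule that)
qed

text \<open>The squared L^2 norm is exactly \<open>kdiag a\<close>, and an exponent below 2 admits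
  the right upper bound; so the exponent \<open>r \<ge> 2\<close> must carry a fixed share of it.
  Any exponent strictly between 1 and 2 would do; 3/2 leads to square roots.\<close>

lemma kernel_norm_lower:
  assumes r: "2 \<le> r"
  obtains c where "c > 0" "\<And>a :: complex ^ 'n. a \<in> polydisc \<Longrightarrow>
    c * kdiag a powr (1 - 1 / r) \<le> kernel_norm (ennreal r) a"
proof -
  obtain C where C: "C > 0" "\<And>a :: complex ^ 'n. a \<in> polydisc \<Longrightarrow>
      (LINT \<zeta>|torus_measure. norm (szego_kernel a \<zeta>) powr (3 / 2)) \<le> C * kdiag a powr (3 / 2 - 1)"
    by (rule integral_szego_kernel_powr[of "3 / 2"]) auto
  \<comment> \<open>The estimate to come is that \<open>I\<close> is at least
    \<open>L powr (r - 2) * (N / 2)\<close>; \<open>b\<close> collects what remains once the powers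
    of \<open>N\<close> are taken out.\<close>
  define b where "b = (1 / 2) * (1 / (4 * C\<^sup>2)) powr (r - 2)"
  have b: "b > 0"
    using C(1) by (simp add: b_def)
  have "b powr (1 / r) * kdiag a powr (1 - 1 / r) \<le> kernel_norm (ennreal r) a" if a: "a \<in> polydisc" for a :: "complex ^ 'n"
  proof -
    define N where "N = kdiag a"
    have N: "N > 0" unfolding N_def by (rule kdiag_pos[OF a])
    define I where "I = (LINT \<zeta>|torus_measure. norm (szego_kernel a \<zeta>) powr r)"
    \<comment> \<open>Chosen so that the kernel values below \<open>L\<close> contribute at most
      \<open>L powr (1 / 2) * (C * N powr (1 / 2)) = N / 2\<close>, half of the whole
      integral.\<close>
    define L where "L = N / (4 * C\<^sup>2)"
    have L: "L > 0" using N C(1) by (simp add: L_def)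
    \<comment> \<open>Split at the level \<open>L\<close>; the small values are controlled by the exponent \<open>3 / 2 < 2\<close>.\<close>
    have pw: "x\<^sup>2 \<le> L powr (2 - r) * x powr r + L powr (1 / 2) * x powr (3 / 2)" if x: "0 \<le> x" for x :: real
    proof (cases "x = 0")
      case False
      then have x: "x > 0" using x by simp
      show ?thesis
      proof (cases "L \<le> x")
        case True
        have "x\<^sup>2 = x powr (2 - r) * x powr r"
          using x by (simp flip: powr_add add: powr_numeral)
        also have "\<dots> \<le> L powr (2 - r) * x powr r"
          using True L r by (intro mult_right_mono powr_mono2') auto
        finally show ?thesis
          by (simp add: add_increasing2)
      next
        case False
        have "x\<^sup>2 = x powr (1 / 2) * x powr (3 / 2)"
          using x by (simp flip: powr_add add: powr_numeral)
        also have "\<dots> \<le> L powr (1 / 2) * x powr (3 / 2)"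
          using False x by (intro mult_right_mono powr_mono2) auto
        finally show ?thesis
          by (simp add: add_increasing)
      qed
    qed simp
    have int2: "integrable torus_measure (\<lambda>\<zeta>. (norm (szego_kernel a \<zeta>))\<^sup>2)"
      by (intro integrable_torus_continuous continuous_intros continuous_on_subset[OF szego_kernel_continuous[OF a] torus_cpolydisc])
    have "N = (LINT \<zeta>|torus_measure. (norm (szego_kernel a \<zeta>))\<^sup>2)"
      by (simp add: N_def integral_szego_kernel_sq[OF a])
    also have "\<dots> \<le> (LINT \<zeta>|torus_measure. L powr (2 - r) * norm (szego_kernel a \<zeta>) powr r + L powr (1 / 2) * norm (szego_kernel a \<zeta>) powr (3 / 2))"
      using r by (intro integral_mono int2 pw Bochner_Integration.integrable_add integrable_mult_right integrable_szego_powr a) auto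
    also have "\<dots> = L powr (2 - r) * I + L powr (1 / 2) * (LINT \<zeta>|torus_measure. norm (szego_kernel a \<zeta>) powr (3 / 2))"
      using integrable_szego_powr[OF a] r by (subst Bochner_Integration.integral_add) (auto simp: I_def)
    also have "\<dots> \<le> L powr (2 - r) * I + L powr (1 / 2) * (C * N powr (1 / 2))"
      using C(2)[OF a] by (intro add_left_mono mult_left_mono) (auto simp: N_def)
    also have "L powr (1 / 2) * (C * N powr (1 / 2)) = N / 2"
    proof -
      have "L powr (1 / 2) = sqrt N / sqrt (4 * C\<^sup>2)"
        using L N C(1) by (simp add: powr_half_sqrt L_def real_sqrt_divide)
      also have "sqrt (4 * C\<^sup>2) = 2 * C"
        using C(1) by (simp add: real_sqrt_mult)
      finally have e: "L powr (1 / 2) = sqrt N / (2 * C)" .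
      show ?thesis
        unfolding e powr_half_sqrt[OF less_imp_le[OF N]] using N C(1) by simp
    qed
    finally have "N / 2 \<le> L powr (2 - r) * I" by simp
    then have "L powr (r - 2) * (N / 2) \<le> L powr (r - 2) * (L powr (2 - r) * I)"
      by (intro mult_left_mono) auto
    also have "\<dots> = I"
      using L by (simp flip: powr_add mult.assoc)
    also have "L powr (r - 2) * (N / 2) = b * N powr (r - 1)"
    proof -
      have "L powr (r - 2) = (1 / (4 * C\<^sup>2)) powr (r - 2) * N powr (r - 2)"
        using N by (simp add: L_def flip: powr_mult)
      moreover have "N powr (r - 1) = N powr (r - 2) * N"
        using N powr_add[of N "r - 2" 1] by simp
      ultimately show ?thesis by (simp add: b_def)
    qed
    finally have "(b * N powr (r - 1)) powr (1 / r) \<le> I powr (1 / r)"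
      using r b by (intro powr_mono2) auto
    moreover have "(b * N powr (r - 1)) powr (1 / r) = b powr (1 / r) * N powr (1 - 1 / r)"
    proof -
      have "(r - 1) * (1 / r) = 1 - 1 / r"
        using r by (simp add: field_simps)
      then show ?thesis
        using b by (simp add: powr_mult powr_powr)
    qed
    ultimately show ?thesis
      using r a by (simp add: kernel_norm_eq I_def N_def)
  qed
  with b show ?thesis
    by (intro that[of "b powr (1 / r)"]) auto
qed

section \<open>Series of functions with boundary values\<close>

lemma norm_vector_smult_complex: "norm (c *s v) = norm c * norm (v :: complex ^ 'n)"
  by (simp add: norm_vec_def norm_mult L2_set_right_distrib)

text \<open>Cauchy's inequality on the disc of radius \<open>\<delta>\<close> in the complex line
  through \<open>x\<close> in direction \<open>h\<close>; homogeneity passes from the unit vector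
  \<open>v\<close> to \<open>h\<close>.\<close>

lemma norm_derivative_le:
  fixes f :: "complex ^ 'n \<Rightarrow> complex"
  assumes f: "holomorphic_polydisc f" and \<delta>: "0 < \<delta>"
    and sub: "cball x \<delta> \<subseteq> polydisc" and bd: "\<And>z. z \<in> cball x \<delta> \<Longrightarrow> norm (f z) \<le> M"
    and f': "(f has_derivative f') (at x)" "\<And>c v. f' (c *s v) = c * f' v"
  shows "norm (f' h) \<le> M / \<delta> * norm h"
proof (cases "h = 0")
  case True
  then show ?thesis
    using f'(2)[of 0 h] by simp
next
  case False
  define v where "v = of_real (1 / norm h) *s h"
  have nv: "norm v = 1"
    using False by (simp add: v_def norm_vector_smult_complex norm_divide)
  define \<phi> where "\<phi> w = f (x + w *s v)" for w
  have in_ball: "x + w *s v \<in> cball x \<delta>" if "norm w \<le> \<delta>" for w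
    using that by (simp add: dist_norm norm_vector_smult_complex nv)
  have diff: "\<phi> field_differentiable at w" if "norm w \<le> \<delta>" for w
  proof -
    have "x + w *s v \<in> polydisc"
      using in_ball[OF that] sub by blast
    then obtain g' where "(f has_derivative g') (at (x + w *s v))" "\<And>c v. g' (c *s v) = c * g' v"
      using holomorphic_polydiscE[OF f] by blast
    from holomorphic_polydisc_line[OF this] show ?thesis
      unfolding \<phi>_def field_differentiable_def by blast
  qed
  have "\<phi> holomorphic_on cball 0 \<delta>"
    unfolding holomorphic_on_def using diff field_differentiable_at_within by (metis dist_0_norm mem_cball)
  then have "\<phi> holomorphic_on ball 0 \<delta>" "continuous_on (cball 0 \<delta>) \<phi>"
    using holomorphic_on_subset ball_subset_cball holomorphic_on_imp_continuous_on by blast+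
  then have "norm ((deriv ^^ 1) \<phi> 0) \<le> fact 1 * M / \<delta> ^ 1"
    by (rule Cauchy_inequality[OF _ _ \<delta>]) (use in_ball bd in \<open>auto simp: \<phi>_def\<close>)
  moreover have "(\<phi> has_field_derivative f' v) (at 0)"
    unfolding \<phi>_def by (rule holomorphic_polydisc_line) (use f' in auto)
  ultimately have "norm (f' v) \<le> M / \<delta>"
    by (simp add: DERIV_imp_deriv)
  moreover have "f' h = of_real (norm h) * f' v"
  proof -
    have "of_real (norm h) *s v = (of_real (norm h) * of_real (1 / norm h)) *s h"
      by (simp only: v_def vector_smult_assoc)
    also have "\<dots> = h"
      using False by (simp flip: of_real_mult)
    finally show ?thesis
      using f'(2)[of "of_real (norm h)" v] by simp
  qed
  ultimately show ?thesis
    using mult_right_mono[of "norm (f' v)" "M / \<delta>" "norm h"] by (simp add: norm_mult mult.commute)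
qed

lemma kdiag_le:
  fixes z :: "complex ^ 'n"
  assumes "0 \<le> \<rho>" "\<rho> < 1" "\<And>i. norm (z $ i) \<le> \<rho>"
  shows "kdiag z \<le> (1 / (1 - \<rho>\<^sup>2)) ^ CARD('n)"
proof -
  have lt: "\<rho>\<^sup>2 < 1"
    using assms by (simp add: abs_square_less_1)
  have "1 / (1 - (norm (z $ i))\<^sup>2) \<le> 1 / (1 - \<rho>\<^sup>2)" "0 \<le> 1 / (1 - (norm (z $ i))\<^sup>2)" for i
  proof -
    have "(norm (z $ i))\<^sup>2 \<le> \<rho>\<^sup>2"
      using assms by (intro power_mono) auto
    then show "1 / (1 - (norm (z $ i))\<^sup>2) \<le> 1 / (1 - \<rho>\<^sup>2)" "0 \<le> 1 / (1 - (norm (z $ i))\<^sup>2)"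
      using lt by (auto intro!: divide_left_mono mult_pos_pos)
  qed
  then have "kdiag z \<le> (\<Prod>i\<in>(UNIV :: 'n set). 1 / (1 - \<rho>\<^sup>2))"
    unfolding kdiag_def by (intro prod_mono) auto
  then show ?thesis by simp
qed

lemma kdiag_locally_bounded:
  fixes z :: "complex ^ 'n"
  assumes z: "z \<in> polydisc"
  obtains \<delta> K where "0 < \<delta>" "0 < K" "cball z \<delta> \<subseteq> polydisc" "\<And>w. w \<in> cball z \<delta> \<Longrightarrow> kdiag w \<le> K"
proof -
  define m where "m = Max (range (\<lambda>i. norm (z $ i)))"
  have m: "norm (z $ i) \<le> m" for i
    unfolding m_def by (intro Max_ge) auto
  have m1: "m < 1"
    unfolding m_def using z by (subst Max_less_iff) (auto simp: polydisc_def)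
  have m0: "0 \<le> m"
    using m norm_ge_zero order_trans by blast
  \<comment> \<open>The midpoint of 1 and the largest coordinate modulus; a ball whose radius is the
    remaining distance stays within this bound in every coordinate.\<close>
  define \<rho> where "\<rho> = (1 + m) / 2"
  have \<rho>: "0 \<le> \<rho>" "\<rho> < 1"
    using m0 m1 by (auto simp: \<rho>_def)
  have w: "norm (w $ i) \<le> \<rho>" if "w \<in> cball z ((1 - m) / 2)" for w i
  proof -
    have "norm (w $ i) \<le> norm (z $ i) + norm ((w - z) $ i)"
      using norm_triangle_ineq[of "z $ i" "(w - z) $ i"] by simp
    also have "\<dots> \<le> m + norm (w - z)"
      using m Finite_Cartesian_Product.norm_nth_le by (intro add_mono)
    also have "\<dots> \<le> \<rho>"
      using that by (simp add: \<rho>_def dist_norm norm_minus_commute field_simps)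
    finally show ?thesis .
  qed
  show ?thesis
  proof (rule that)
    show "0 < (1 - m) / 2" using m1 by simp
    show "cball z ((1 - m) / 2) \<subseteq> polydisc"
      unfolding polydisc_def by (intro subsetI CollectI allI le_less_trans[OF w \<rho>(2)])
    show "kdiag w \<le> (1 / (1 - \<rho>\<^sup>2)) ^ CARD('n)" if "w \<in> cball z ((1 - m) / 2)" for w
      by (intro kdiag_le \<rho> w that)
    show "0 < (1 / (1 - \<rho>\<^sup>2)) ^ CARD('n)"
      using \<rho> by (simp add: abs_square_less_1)
  qed
qed

text \<open>\<open>kdiag z\<close> is locally bounded, so the series is locally dominated by a
  multiple of \<open>M\<close>. Cauchy estimates on balls of half the radius give the derivatives a
  majorant of the same kind, which permits termwise differentiation; complex homogeneity survives
  the summation.\<close>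

lemma holomorphic_polydisc_suminf:
  fixes f :: "nat \<Rightarrow> complex ^ 'n \<Rightarrow> complex"
  assumes f: "\<And>n. holomorphic_polydisc (f n)" and M: "summable M"
    and bd: "\<And>n z. z \<in> polydisc \<Longrightarrow> norm (f n z) \<le> kdiag z * M n"
  shows "holomorphic_polydisc (\<lambda>z. \<Sum>n. f n z)"
  unfolding holomorphic_polydisc_def
proof
  fix z0 :: "complex ^ 'n" assume z0: "z0 \<in> polydisc"
  have M0: "0 \<le> M n" for n
  proof -
    have "0 \<le> kdiag z0 * M n"
      using bd[OF z0, of n] norm_ge_zero order_trans by blast
    then show ?thesis
      using kdiag_pos[OF z0] by (simp add: zero_le_mult_iff)
  qed
  obtain \<delta> K where \<delta>: "0 < \<delta>" "0 < K" "cball z0 \<delta> \<subseteq> polydisc" "\<And>w. w \<in> cball z0 \<delta> \<Longrightarrow> kdiag w \<le> K"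
    using kdiag_locally_bounded[OF z0] by blast
  define \<epsilon> where "\<epsilon> = \<delta> / 2"
  have \<epsilon>: "0 < \<epsilon>" using \<delta> by (simp add: \<epsilon>_def)
  have sub: "cball x \<epsilon> \<subseteq> cball z0 \<delta>" if "x \<in> ball z0 \<epsilon>" for x
  proof
    fix y assume "y \<in> cball x \<epsilon>"
    then show "y \<in> cball z0 \<delta>"
      using that dist_triangle[of z0 y x] by (simp add: \<epsilon>_def)
  qed
  have x_in: "x \<in> polydisc" if "x \<in> ball z0 \<epsilon>" for x
  proof -
    have "x \<in> cball x \<epsilon>" using \<epsilon> by simp
    then show ?thesis using sub[OF that] \<delta>(3) by blast
  qed
  define D where "D n x = (SOME f'. (f n has_derivative f') (at x) \<and> (\<forall>c v. f' (c *s v) = c * f' v))" for n x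
  have D: "(f n has_derivative D n x) (at x)" "D n x (c *s v) = c * D n x v" if "x \<in> polydisc" for n x c v
  proof -
    have "\<exists>f'. (f n has_derivative f') (at x) \<and> (\<forall>c v. f' (c *s v) = c * f' v)"
      using f[of n] that unfolding holomorphic_polydisc_def by blast
    from someI_ex[OF this] show "(f n has_derivative D n x) (at x)" "D n x (c *s v) = c * D n x v"
      unfolding D_def by blast+
  qed
  have D_le: "norm (D n x h) \<le> (K / \<epsilon> * norm h) * M n" if x: "x \<in> ball z0 \<epsilon>" for n x h
  proof -
    have "norm (D n x h) \<le> (K * M n) / \<epsilon> * norm h"
    proof (rule norm_derivative_le[OF f[of n] \<epsilon> _ _ D(1)[OF x_in[OF x]] D(2)[OF x_in[OF x]]])
      show "cball x \<epsilon> \<subseteq> polydisc"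
        using sub[OF x] \<delta>(3) by blast
      fix z assume "z \<in> cball x \<epsilon>"
      then have z: "z \<in> cball z0 \<delta>"
        using sub[OF x] by blast
      then have "norm (f n z) \<le> kdiag z * M n"
        using \<delta>(3) by (intro bd) auto
      also have "\<dots> \<le> K * M n"
        using \<delta>(4)[OF z] M0 by (intro mult_right_mono) auto
      finally show "norm (f n z) \<le> K * M n" .
    qed
    then show ?thesis by (simp add: field_simps)
  qed
  have summ: "summable (\<lambda>n. norm (D n x h))" if "x \<in> ball z0 \<epsilon>" for x h
    by (rule summable_comparison_test'[OF summable_mult[OF M, of "K / \<epsilon> * norm h"]])
       (use D_le[OF that, of _ h] in simp)
  define g' where "g' x h = (\<Sum>n. D n x h)" for x h
  have summ_f: "summable (\<lambda>n. f n z0)"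
    by (rule summable_norm_cancel, rule summable_comparison_test'[OF summable_mult[OF M, of "kdiag z0"]])
       (use bd[OF z0] in simp)
  have "\<exists>g. \<forall>x\<in>ball z0 \<epsilon>. (\<lambda>n. f n x) sums (g x) \<and> (g has_derivative g' x) (at x within ball z0 \<epsilon>)"
  proof (rule has_derivative_series)
    show "convex (ball z0 \<epsilon>)" by simp
    show "(f n has_derivative D n x) (at x within ball z0 \<epsilon>)" if "x \<in> ball z0 \<epsilon>" for n x
      using D(1)[OF x_in[OF that]] by (rule has_derivative_at_withinI)
    show "z0 \<in> ball z0 \<epsilon>" using \<epsilon> by simp
    show "(\<lambda>n. f n z0) sums (\<Sum>n. f n z0)"
      using summ_f by (rule summable_sums)
    fix e :: real assume e: "e > 0"
    \<comment> \<open>The tolerance for the tail of \<open>M\<close> that becomes \<open>e\<close>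
      after multiplication by the factor \<open>K / \<epsilon>\<close> of
      \<open>D_le\<close>.\<close>
    then have "e * \<epsilon> / K > 0" using \<epsilon> \<delta> by simp
    then obtain N where N: "\<And>n. n \<ge> N \<Longrightarrow> norm (\<Sum>i. M (i + n)) < e * \<epsilon> / K"
      using suminf_exist_split[OF _ M] by blast
    show "\<forall>\<^sub>F n in sequentially. \<forall>x\<in>ball z0 \<epsilon>. \<forall>h. norm (sum (\<lambda>i. D i x h) {..<n} - g' x h) \<le> e * norm h"
      using eventually_ge_at_top[of N]
    proof (eventually_elim, intro ballI allI)
      fix n x h assume n: "N \<le> n" and x: "x \<in> ball z0 \<epsilon>"
      have sN: "summable (\<lambda>i. norm (D (i + n) x h))"
        using summ[OF x] by (rule summable_ignore_initial_segment)
      have sM: "summable (\<lambda>i. M (i + n))"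
        using M by (rule summable_ignore_initial_segment)
      have "g' x h = (\<Sum>i. D (i + n) x h) + (\<Sum>i<n. D i x h)"
        unfolding g'_def by (rule suminf_split_initial_segment[OF summable_norm_cancel[OF summ[OF x]]])
      then have "norm (sum (\<lambda>i. D i x h) {..<n} - g' x h) = norm (\<Sum>i. D (i + n) x h)"
        by simp
      also have "\<dots> \<le> (\<Sum>i. norm (D (i + n) x h))"
        by (rule summable_norm[OF sN])
      also have "\<dots> \<le> (\<Sum>i. (K / \<epsilon> * norm h) * M (i + n))"
        by (intro suminf_le D_le x sN summable_mult sM)
      also have "\<dots> = (K / \<epsilon> * norm h) * (\<Sum>i. M (i + n))"
        by (rule suminf_mult[OF sM])
      also have "\<dots> \<le> (K / \<epsilon> * norm h) * (e * \<epsilon> / K)"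
        using N[OF n] \<delta> \<epsilon> by (intro mult_left_mono) auto
      also have "\<dots> = e * norm h"
        using \<delta> \<epsilon> by simp
      finally show "norm (sum (\<lambda>i. D i x h) {..<n} - g' x h) \<le> e * norm h" .
    qed
  qed
  then obtain g where g: "\<And>x. x \<in> ball z0 \<epsilon> \<Longrightarrow> (\<lambda>n. f n x) sums (g x)"
    "\<And>x. x \<in> ball z0 \<epsilon> \<Longrightarrow> (g has_derivative g' x) (at x within ball z0 \<epsilon>)"
    by blast
  have "(g has_derivative g' z0) (at z0)"
    using g(2)[of z0] \<epsilon> by (simp add: at_within_open[of z0 "ball z0 \<epsilon>"])
  then have "((\<lambda>z. \<Sum>n. f n z) has_derivative g' z0) (at z0)"
    by (rule has_derivative_transform_within_open[of _ _ _ _ "ball z0 \<epsilon>"])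
       (use g(1) \<epsilon> in \<open>auto simp: sums_iff\<close>)
  moreover have "g' z0 (c *s v) = c * g' z0 v" for c v
  proof -
    have "summable (\<lambda>n. norm (D n z0 v))"
      using summ[of z0 v] \<epsilon> by simp
    then show ?thesis
      unfolding g'_def D(2)[OF z0] by (rule suminf_mult[OF summable_norm_cancel])
  qed
  ultimately show "\<exists>f'. ((\<lambda>z. \<Sum>n. f n z) has_derivative f') (at z0) \<and> (\<forall>c v. f' (c *s v) = c * f' v)"
    by blast
qed

text \<open>The point is uniformity in \<open>r\<close>: it controls the tail of a series at all
  dilates at once.\<close>

lemma dilate_L1_contraction:
  fixes f :: "complex ^ 'n \<Rightarrow> complex"
  assumes f: "holomorphic_polydisc f" "has_boundary_value f g" and r: "0 \<le> r" "r < 1"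
  shows "(\<integral>\<^sup>+ \<zeta>. ennreal (norm (f (r *\<^sub>R \<zeta>) - g \<zeta>)) \<partial>torus_measure) \<le> ennreal (2 * (LINT \<zeta>|torus_measure. norm (g \<zeta>)))"
proof -
  note [measurable] = has_boundary_value_measurable[OF f(2)] dilate_measurable[OF f(1) r]
  have g: "(\<integral>\<^sup>+ \<zeta>. ennreal (norm (g \<zeta>)) \<partial>torus_measure) = ennreal (LINT \<zeta>|torus_measure. norm (g \<zeta>))"
    using has_boundary_value_integrable[OF f] by (intro nn_integral_eq_integral) auto
  have "(\<integral>\<^sup>+ \<zeta>. ennreal (norm (f (r *\<^sub>R \<zeta>) - g \<zeta>)) \<partial>torus_measure) \<le>
      (\<integral>\<^sup>+ \<zeta>. ennreal (norm (f (r *\<^sub>R \<zeta>))) + ennreal (norm (g \<zeta>)) \<partial>torus_measure)"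
    by (intro nn_integral_mono) (simp add: norm_triangle_ineq4 flip: ennreal_plus)
  also have "\<dots> = (\<integral>\<^sup>+ \<zeta>. ennreal (norm (f (r *\<^sub>R \<zeta>))) \<partial>torus_measure) + (\<integral>\<^sup>+ \<zeta>. ennreal (norm (g \<zeta>)) \<partial>torus_measure)"
    by (rule nn_integral_add) measurable
  also have "\<dots> \<le> (\<integral>\<^sup>+ \<zeta>. ennreal (norm (g \<zeta>)) \<partial>torus_measure) + (\<integral>\<^sup>+ \<zeta>. ennreal (norm (g \<zeta>)) \<partial>torus_measure)"
    using dilate_contraction[OF f order.refl r, of 0] by (intro add_right_mono) simp
  also have "\<dots> = ennreal (2 * (LINT \<zeta>|torus_measure. norm (g \<zeta>)))"
    unfolding g by (simp flip: ennreal_plus)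
  finally show ?thesis .
qed

text \<open>As \<open>r\<close> tends to 1, finitely many terms converge one by one, and the others
  are small uniformly in \<open>r\<close> by \<open>dilate_L1_contraction\<close>. The argument
  stays in L^1 and so provides a boundary function for the extension also when \<open>s = 1\<close>,
  outside the range of \<open>hardy_boundary_value_exists\<close>.\<close>

lemma boundary_value_series:
  fixes f :: "nat \<Rightarrow> complex ^ 'n \<Rightarrow> complex"
  assumes f: "\<And>n. holomorphic_polydisc (f n)" and g: "\<And>n. has_boundary_value (f n) (g n)"
    and summ: "summable (\<lambda>n. LINT \<zeta>|torus_measure. norm (g n \<zeta>))"
  shows "holomorphic_polydisc (\<lambda>z. \<Sum>n. f n z)"
    and "\<And>z. z \<in> polydisc \<Longrightarrow> summable (\<lambda>n. norm (f n z))"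
    and "AE \<zeta> in torus_measure. summable (\<lambda>n. norm (g n \<zeta>))"
    and "has_boundary_value (\<lambda>z. \<Sum>n. f n z) (\<lambda>\<zeta>. \<Sum>n. g n \<zeta>)"
proof -
  define M where "M n = (LINT \<zeta>|torus_measure. norm (g n \<zeta>))" for n
  have M0: "0 \<le> M n" for n
    unfolding M_def by (intro Bochner_Integration.integral_nonneg) auto
  have sM: "summable M"
    using summ by (simp add: M_def[abs_def])
  note [measurable] = has_boundary_value_measurable[OF g]
  have bd: "norm (f n z) \<le> kdiag z * (2 ^ CARD('n) * M n)" if "z \<in> polydisc" for n z
    using norm_boundary_value_le[OF f g that, of n] by (simp add: M_def mult_ac)
  show "holomorphic_polydisc (\<lambda>z. \<Sum>n. f n z)"
    by (rule holomorphic_polydisc_suminf[OF f summable_mult[OF sM] bd])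
  show summ_f: "summable (\<lambda>n. norm (f n z))" if "z \<in> polydisc" for z
    by (rule summable_comparison_test'[OF summable_mult[OF summable_mult[OF sM]]]) (use bd[OF that] in auto)
  have "(\<integral>\<^sup>+ \<zeta>. (\<Sum>n. ennreal (norm (g n \<zeta>))) \<partial>torus_measure) = (\<Sum>n. \<integral>\<^sup>+ \<zeta>. ennreal (norm (g n \<zeta>)) \<partial>torus_measure)"
    by (rule nn_integral_suminf) measurable
  also have "\<dots> = (\<Sum>n. ennreal (M n))"
    using has_boundary_value_integrable[OF f g] by (intro suminf_cong) (simp add: nn_integral_eq_integral M_def)
  also have "\<dots> = ennreal (\<Sum>n. M n)"
    by (rule suminf_ennreal2[OF M0 sM])
  finally have "(\<integral>\<^sup>+ \<zeta>. (\<Sum>n. ennreal (norm (g n \<zeta>))) \<partial>torus_measure) \<noteq> \<infinity>"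
    by simp
  then have "AE \<zeta> in torus_measure. (\<Sum>n. ennreal (norm (g n \<zeta>))) \<noteq> \<infinity>"
    by (intro nn_integral_PInf_AE) measurable
  then show summ_g: "AE \<zeta> in torus_measure. summable (\<lambda>n. norm (g n \<zeta>))"
    by eventually_elim (intro summable_suminf_not_top, auto)
  show "has_boundary_value (\<lambda>z. \<Sum>n. f n z) (\<lambda>\<zeta>. \<Sum>n. g n \<zeta>)"
    unfolding has_boundary_value_iff
  proof (intro conjI allI impI)
    show "(\<lambda>\<zeta>. \<Sum>n. g n \<zeta>) \<in> borel_measurable torus_measure"
      by measurable
    fix e :: real assume e: "e > 0"
    define a where "a n r = (\<integral>\<^sup>+ \<zeta>. ennreal (norm (f n (r *\<^sub>R \<zeta>) - g n \<zeta>)) \<partial>torus_measure)" for n r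
    \<comment> \<open>\<open>e / 4\<close> because \<open>dilate_L1_contraction\<close> doubles the
      tail; the head receives the other \<open>e / 2\<close>.\<close>
    obtain N where N: "norm (\<Sum>i. M (i + N)) < e / 4"
      using suminf_exist_split[OF _ sM, of "e / 4"] e by auto
    have "((\<lambda>r. \<Sum>n<N. a n r) \<longlongrightarrow> (\<Sum>n<N. 0)) (at_left 1)"
      using g unfolding a_def has_boundary_value_def by (intro tendsto_sum) auto
    then have "\<forall>\<^sub>F r in at_left 1. (\<Sum>n<N. a n r) < ennreal (e / 2)"
      using e by (intro order_tendstoD(2)) auto
    with eventually_at_left_1
    show "\<forall>\<^sub>F r in at_left 1. (\<integral>\<^sup>+ \<zeta>. ennreal (norm ((\<Sum>n. f n (r *\<^sub>R \<zeta>)) - (\<Sum>n. g n \<zeta>))) \<partial>torus_measure) < ennreal e"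
    proof eventually_elim
      case (elim r)
      then have r: "0 \<le> r" "r < 1" by auto
      note [measurable] = dilate_measurable[OF f r]
      have "(\<integral>\<^sup>+ \<zeta>. ennreal (norm ((\<Sum>n. f n (r *\<^sub>R \<zeta>)) - (\<Sum>n. g n \<zeta>))) \<partial>torus_measure) \<le>
          (\<integral>\<^sup>+ \<zeta>. (\<Sum>n. ennreal (norm (f n (r *\<^sub>R \<zeta>) - g n \<zeta>))) \<partial>torus_measure)"
      proof (rule nn_integral_mono_AE)
        show "AE \<zeta> in torus_measure. ennreal (norm ((\<Sum>n. f n (r *\<^sub>R \<zeta>)) - (\<Sum>n. g n \<zeta>))) \<le>
            (\<Sum>n. ennreal (norm (f n (r *\<^sub>R \<zeta>) - g n \<zeta>)))"
          using summ_g AE_space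
        proof eventually_elim
          case (elim \<zeta>)
          then have sf: "summable (\<lambda>n. norm (f n (r *\<^sub>R \<zeta>)))"
            by (intro summ_f torus_scaled r) simp
          have sd: "summable (\<lambda>n. norm (f n (r *\<^sub>R \<zeta>) - g n \<zeta>))"
            by (rule summable_comparison_test'[OF summable_add[OF sf elim(1)]]) (simp add: norm_triangle_ineq4)
          have "(\<Sum>n. f n (r *\<^sub>R \<zeta>)) - (\<Sum>n. g n \<zeta>) = (\<Sum>n. f n (r *\<^sub>R \<zeta>) - g n \<zeta>)"
            by (rule suminf_diff) (use sf elim(1) in \<open>auto intro: summable_norm_cancel\<close>)
          then have "ennreal (norm ((\<Sum>n. f n (r *\<^sub>R \<zeta>)) - (\<Sum>n. g n \<zeta>))) \<le> ennreal (\<Sum>n. norm (f n (r *\<^sub>R \<zeta>) - g n \<zeta>))"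
            using summable_norm[OF sd] by (simp add: ennreal_leI)
          also have "\<dots> = (\<Sum>n. ennreal (norm (f n (r *\<^sub>R \<zeta>) - g n \<zeta>)))"
            by (rule suminf_ennreal2[symmetric, OF _ sd]) simp
          finally show ?case .
        qed
      qed
      also have "\<dots> = (\<Sum>n. a n r)"
        unfolding a_def by (rule nn_integral_suminf) measurable
      also have "\<dots> = (\<Sum>n. a (n + N) r) + (\<Sum>n<N. a n r)"
        by (rule suminf_offset) simp
      also have "(\<Sum>n. a (n + N) r) \<le> (\<Sum>n. ennreal (2 * M (n + N)))"
        unfolding a_def M_def by (intro suminf_le dilate_L1_contraction f g r) auto
      also have "\<dots> = ennreal (\<Sum>n. 2 * M (n + N))"
        using M0 sM by (intro suminf_ennreal2 summable_mult summable_ignore_initial_segment) auto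
      also have "(\<Sum>n. 2 * M (n + N)) = 2 * (\<Sum>n. M (n + N))"
        by (rule suminf_mult[OF summable_ignore_initial_segment[OF sM]])
      finally have "(\<integral>\<^sup>+ \<zeta>. ennreal (norm ((\<Sum>n. f n (r *\<^sub>R \<zeta>)) - (\<Sum>n. g n \<zeta>))) \<partial>torus_measure)
          \<le> ennreal (2 * (\<Sum>n. M (n + N))) + (\<Sum>n<N. a n r)"
        by (simp add: add_right_mono)
      also have "\<dots> \<le> ennreal (e / 2) + (\<Sum>n<N. a n r)"
        using N by (intro add_right_mono ennreal_leI) auto
      also have "\<dots> < ennreal (e / 2) + ennreal (e / 2)"
        using elim by (intro ennreal_add_left_cancel_less[THEN iffD2]) auto
      also have "\<dots> = ennreal e"
        using e by (simp flip: ennreal_plus)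
      finally show ?case .
    qed
  qed
qed

section \<open>Square functions and Carleson sequences\<close>

lemma sum_powr_le:
  fixes x :: "'a \<Rightarrow> real"
  assumes A: "finite A" and x: "\<And>a. a \<in> A \<Longrightarrow> 0 \<le> x a" and t: "0 < t" "t \<le> 1"
  shows "(\<Sum>a\<in>A. x a) powr t \<le> (\<Sum>a\<in>A. x a powr t)"
proof -
  have two: "(u + v) powr t \<le> u powr t + v powr t" if uv: "0 \<le> u" "0 \<le> v" for u v :: real
  proof (cases "u = 0 \<or> v = 0")
    case False
    then have pos: "0 < u" "0 < v" using uv by auto
    \<comment> \<open>One factor \<open>u + v\<close> is split off; the remaining power has exponent
      \<open>t - 1 \<le> 0\<close> and so decreases in its base.\<close>
    have "(u + v) powr t = u * (u + v) powr (t - 1) + v * (u + v) powr (t - 1)"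
      using pos powr_add[of "u + v" 1 "t - 1"] by (simp add: distrib_right)
    also have "\<dots> \<le> u * u powr (t - 1) + v * v powr (t - 1)"
      using pos t by (intro add_mono mult_left_mono powr_mono2') auto
    also have "\<dots> = u powr t + v powr t"
      using pos powr_add[of u 1 "t - 1"] powr_add[of v 1 "t - 1"] by simp
    finally show ?thesis .
  qed auto
  show ?thesis
    using A x
  proof (induction A rule: finite_induct)
    case (insert a A)
    then have "(x a + (\<Sum>a\<in>A. x a)) powr t \<le> x a powr t + (\<Sum>a\<in>A. x a) powr t"
      by (intro two sum_nonneg) auto
    also have "\<dots> \<le> x a powr t + (\<Sum>a\<in>A. x a powr t)"
      using insert by simp
    finally show ?case
      using insert by simp
  qed simp
qed

lemma powr_midpoint:
  fixes u v t :: real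
  assumes "0 \<le> u" "0 \<le> v" "1 \<le> t"
  shows "((u + v) / 2) powr t \<le> (u powr t + v powr t) / 2"
proof (cases "u = 0 \<or> v = 0")
  case True
  have "2 powr 1 \<le> (2 :: real) powr t"
    using assms by (intro powr_mono) auto
  then have "(x / 2) powr t \<le> x powr t / 2" if "0 \<le> x" for x :: real
    unfolding powr_divide using that by (intro divide_left_mono) auto
  with True assms show ?thesis by auto
next
  case False
  then show ?thesis
    using convex_onD[OF powr_convex[OF assms(3)], of "1 / 2" u v] assms by (simp add: add_divide_distrib)
qed

text \<open>One half of Khinchine's inequality, with constant 1. The free summand \<open>x\<close>
  makes the induction work: by the parallelogram law, adding the square of \<open>c b\<close>
  amounts to averaging over \<open>x - c b\<close> and \<open>x + c b\<close>, and convexity of the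
  power \<open>r / 2\<close> takes the average outside. This is where \<open>r \<ge> 2\<close>
  enters. The set \<open>B\<close> marks the positive signs.\<close>

lemma square_function_sign_average:
  fixes c :: "'a \<Rightarrow> complex"
  assumes A: "finite A" and r: "2 \<le> r"
  shows "((norm x)\<^sup>2 + (\<Sum>a\<in>A. (norm (c a))\<^sup>2)) powr (r / 2) \<le>
    (\<Sum>B\<in>Pow A. norm (x + (\<Sum>a\<in>A. if a \<in> B then c a else - c a)) powr r) / 2 ^ card A"
  using A
proof (induction A arbitrary: x rule: finite_induct)
  case empty
  then show ?case
    by (simp add: powr_powr flip: powr_numeral)
next
  case (insert b A)
  define S where "S = (\<Sum>a\<in>A. (norm (c a))\<^sup>2)"
  have S: "0 \<le> S" by (auto simp: S_def intro: sum_nonneg)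
  define T where "T y = (\<Sum>B\<in>Pow A. norm (y + (\<Sum>a\<in>A. if a \<in> B then c a else - c a)) powr r)" for y
  have "(norm x)\<^sup>2 + (\<Sum>a\<in>insert b A. (norm (c a))\<^sup>2) = (((norm (x - c b))\<^sup>2 + S) + ((norm (x + c b))\<^sup>2 + S)) / 2"
  proof -
    have "(norm (x - c b))\<^sup>2 + (norm (x + c b))\<^sup>2 = 2 * (norm x)\<^sup>2 + 2 * (norm (c b))\<^sup>2"
      by (simp add: power2_norm_eq_inner inner_diff_left inner_diff_right inner_add_left inner_add_right)
    then show ?thesis
      using insert by (simp add: S_def)
  qed
  also have "\<dots> powr (r / 2) \<le> (((norm (x - c b))\<^sup>2 + S) powr (r / 2) + ((norm (x + c b))\<^sup>2 + S) powr (r / 2)) / 2"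
    using S r by (intro powr_midpoint) auto
  also have "\<dots> \<le> (T (x - c b) / 2 ^ card A + T (x + c b) / 2 ^ card A) / 2"
    unfolding S_def T_def by (intro divide_right_mono add_mono insert.IH) auto
  also have "\<dots> = (T (x - c b) + T (x + c b)) / 2 ^ card (insert b A)"
    using insert by (simp add: add_divide_distrib)
  \<comment> \<open>Subsets of \<open>insert b A\<close> without \<open>b\<close> give
    \<open>c b\<close> a negative sign, those containing \<open>b\<close> a positive one; together
    they exhaust \<open>Pow (insert b A)\<close>.\<close>
  also have "T (x - c b) = (\<Sum>B\<in>Pow A. norm (x + (\<Sum>a\<in>insert b A. if a \<in> B then c a else - c a)) powr r)"
    unfolding T_def using insert by (intro sum.cong refl) (auto simp: algebra_simps subset_iff)
  also have "T (x + c b) = (\<Sum>B\<in>insert b ` Pow A. norm (x + (\<Sum>a\<in>insert b A. if a \<in> B then c a else - c a)) powr r)"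
  proof -
    have inj: "inj_on (insert b) (Pow A)"
      using insert.hyps by (auto simp: inj_on_def)
    have "(\<Sum>a\<in>insert b A. if a \<in> insert b B then c a else - c a) = c b + (\<Sum>a\<in>A. if a \<in> B then c a else - c a)" if "B \<in> Pow A" for B
    proof -
      have "(\<Sum>a\<in>A. if a \<in> insert b B then c a else - c a) = (\<Sum>a\<in>A. if a \<in> B then c a else - c a)"
        using insert.hyps by (intro sum.cong) auto
      then show ?thesis
        using insert.hyps by simp
    qed
    then show ?thesis
      unfolding T_def by (subst sum.reindex[OF inj]) (auto intro!: sum.cong simp: add.assoc)
  qed
  also have "(\<Sum>B\<in>Pow A. norm (x + (\<Sum>a\<in>insert b A. if a \<in> B then c a else - c a)) powr r) +
      (\<Sum>B\<in>insert b ` Pow A. norm (x + (\<Sum>a\<in>insert b A. if a \<in> B then c a else - c a)) powr r) =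
      (\<Sum>B\<in>Pow (insert b A). norm (x + (\<Sum>a\<in>insert b A. if a \<in> B then c a else - c a)) powr r)"
    unfolding Pow_insert using insert.hyps by (intro sum.union_disjoint[symmetric]) auto
  finally show ?case .
qed

text \<open>Averaging costs no constant: every choice of signs obeys the same bound
  \<open>K\<close>, hence so does the mean. In a Carleson inequality such a bound is at hand, since
  changing signs leaves the norm of the coefficients unchanged.\<close>

lemma nn_integral_square_function:
  fixes \<kappa> :: "'a \<Rightarrow> 'b \<Rightarrow> complex" and \<beta> :: "'a \<Rightarrow> real"
  assumes A: "finite A" and r: "2 \<le> r" and [measurable]: "\<And>a. a \<in> A \<Longrightarrow> \<kappa> a \<in> borel_measurable M"
    and bd: "\<And>\<sigma>. (\<And>a. \<sigma> a = 1 \<or> \<sigma> a = -1) \<Longrightarrow>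
      (\<integral>\<^sup>+ x. ennreal (norm (\<Sum>a\<in>A. of_real (\<sigma> a * \<beta> a) * \<kappa> a x) powr r) \<partial>M) \<le> K"
  shows "(\<integral>\<^sup>+ x. ennreal ((\<Sum>a\<in>A. (\<beta> a)\<^sup>2 * (norm (\<kappa> a x))\<^sup>2) powr (r / 2)) \<partial>M) \<le> K"
proof -
  define \<sigma> where "\<sigma> B a = (if a \<in> B then 1 else -1 :: real)" for B and a :: 'a
  have meas [measurable]: "(\<lambda>x. ennreal (norm (\<Sum>a\<in>A. of_real (\<sigma> B a * \<beta> a) * \<kappa> a x) powr r)) \<in> borel_measurable M" for B
    by measurable
  have pw: "ennreal ((\<Sum>a\<in>A. (\<beta> a)\<^sup>2 * (norm (\<kappa> a x))\<^sup>2) powr (r / 2)) \<le>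
      ennreal (1 / 2 ^ card A) * (\<Sum>B\<in>Pow A. ennreal (norm (\<Sum>a\<in>A. of_real (\<sigma> B a * \<beta> a) * \<kappa> a x) powr r))" for x
  proof -
    have "(\<Sum>a\<in>A. (\<beta> a)\<^sup>2 * (norm (\<kappa> a x))\<^sup>2) powr (r / 2) \<le>
        (\<Sum>B\<in>Pow A. norm (\<Sum>a\<in>A. if a \<in> B then of_real (\<beta> a) * \<kappa> a x else - (of_real (\<beta> a) * \<kappa> a x)) powr r) / 2 ^ card A"
      using square_function_sign_average[OF A r, of 0 "\<lambda>a. of_real (\<beta> a) * \<kappa> a x"]
      by (simp add: norm_mult power_mult_distrib)
    also have "\<dots> = (1 / 2 ^ card A) * (\<Sum>B\<in>Pow A. norm (\<Sum>a\<in>A. of_real (\<sigma> B a * \<beta> a) * \<kappa> a x) powr r)"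
      unfolding \<sigma>_def by (simp add: if_distrib[of "\<lambda>y. y * _"] if_distrib[of of_real] cong: if_cong)
    finally have "ennreal ((\<Sum>a\<in>A. (\<beta> a)\<^sup>2 * (norm (\<kappa> a x))\<^sup>2) powr (r / 2)) \<le>
        ennreal ((1 / 2 ^ card A) * (\<Sum>B\<in>Pow A. norm (\<Sum>a\<in>A. of_real (\<sigma> B a * \<beta> a) * \<kappa> a x) powr r))"
      by (rule ennreal_leI)
    also have "\<dots> = ennreal (1 / 2 ^ card A) * ennreal (\<Sum>B\<in>Pow A. norm (\<Sum>a\<in>A. of_real (\<sigma> B a * \<beta> a) * \<kappa> a x) powr r)"
      by (intro ennreal_mult) (auto intro: sum_nonneg)
    also have "ennreal (\<Sum>B\<in>Pow A. norm (\<Sum>a\<in>A. of_real (\<sigma> B a * \<beta> a) * \<kappa> a x) powr r) =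
        (\<Sum>B\<in>Pow A. ennreal (norm (\<Sum>a\<in>A. of_real (\<sigma> B a * \<beta> a) * \<kappa> a x) powr r))"
      by (rule sum_ennreal[symmetric]) simp
    finally show ?thesis .
  qed
  have "(\<integral>\<^sup>+ x. ennreal ((\<Sum>a\<in>A. (\<beta> a)\<^sup>2 * (norm (\<kappa> a x))\<^sup>2) powr (r / 2)) \<partial>M) \<le>
      (\<integral>\<^sup>+ x. ennreal (1 / 2 ^ card A) * (\<Sum>B\<in>Pow A. ennreal (norm (\<Sum>a\<in>A. of_real (\<sigma> B a * \<beta> a) * \<kappa> a x) powr r)) \<partial>M)"
    by (intro nn_integral_mono pw)
  also have "\<dots> = ennreal (1 / 2 ^ card A) * (\<Sum>B\<in>Pow A. \<integral>\<^sup>+ x. ennreal (norm (\<Sum>a\<in>A. of_real (\<sigma> B a * \<beta> a) * \<kappa> a x) powr r) \<partial>M)"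
    by (simp only: nn_integral_cmult nn_integral_sum meas borel_measurable_sum)
  also have "\<dots> \<le> ennreal (1 / 2 ^ card A) * (\<Sum>B\<in>Pow A. K)"
    by (intro mult_left_mono sum_mono bd) (auto simp: \<sigma>_def)
  also have "\<dots> = ennreal (1 / 2 ^ card A) * (ennreal (2 ^ card A) * K)"
    using A by (simp add: card_Pow ennreal_power[symmetric])
  also have "\<dots> = K"
    by (simp flip: mult.assoc ennreal_mult)
  finally show ?thesis .
qed

section \<open>The Carleson inequality for finite sums and for square functions\<close>

lemma finite_support_ell:
  fixes \<mu> :: "'a \<Rightarrow> complex"
  assumes "finite A" "A \<subseteq> S" "\<And>a. a \<notin> A \<Longrightarrow> \<mu> a = 0" "0 < q"
  shows "\<mu> \<in> ell q S" and "ell_norm q S \<mu> = (\<Sum>a\<in>A. norm (\<mu> a) powr q) powr (1 / q)"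
proof -
  have "(\<lambda>a. norm (\<mu> a) powr q) summable_on S \<longleftrightarrow> (\<lambda>a. norm (\<mu> a) powr q) summable_on A"
    by (rule summable_on_cong_neutral) (use assms in auto)
  then show "\<mu> \<in> ell q S"
    using assms by (auto simp: ell_def)
  have "(\<Sum>\<^sub>\<infinity>a\<in>S. norm (\<mu> a) powr q) = (\<Sum>\<^sub>\<infinity>a\<in>A. norm (\<mu> a) powr q)"
    by (rule infsum_cong_neutral) (use assms in auto)
  then show "ell_norm q S \<mu> = (\<Sum>a\<in>A. norm (\<mu> a) powr q) powr (1 / q)"
    using assms by (simp add: ell_norm_def)
qed

lemma normalized_kernel_continuous:
  assumes "a \<in> polydisc"
  shows "continuous_on cpolydisc (normalized_kernel q a)"
  unfolding normalized_kernel_def[abs_def] divide_inverse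
  by (intro continuous_on_mult continuous_on_const szego_kernel_continuous assms)

lemma normalized_kernel_holomorphic:
  assumes "a \<in> polydisc"
  shows "holomorphic_polydisc (normalized_kernel q a)"
  unfolding normalized_kernel_def[abs_def] divide_inverse
  by (intro holomorphic_polydisc_mult[OF szego_kernel_holomorphic[OF assms] holomorphic_polydisc_const])

lemma normalized_kernel_measurable:
  "a \<in> polydisc \<Longrightarrow> normalized_kernel q a \<in> borel_measurable torus_measure"
  by (intro measurable_cpolydisc_continuous normalized_kernel_continuous)

text \<open>For coefficients supported in \<open>A\<close>, uniqueness of sums identifies the
  function \<open>F\<close> of the Carleson condition with the finite sum \<open>P\<close> inside
  the polydisc. \<open>P\<close> is continuous up to the boundary, so it is its own boundary
  function and the norm bound becomes an integral over the torus.\<close>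

lemma carleson_finite_sum:
  fixes S :: "(complex ^ 'n) set"
  assumes S: "S \<subseteq> polydisc" and q: "1 < q" and car: "q_carleson q S"
  obtains D where "D > 0" "\<And>A \<mu>. finite A \<Longrightarrow> A \<subseteq> S \<Longrightarrow>
    (\<integral>\<^sup>+ \<zeta>. ennreal (norm (\<Sum>a\<in>A. \<mu> a * normalized_kernel (ennreal q) a \<zeta>) powr q) \<partial>torus_measure)
      \<le> ennreal (D * (\<Sum>a\<in>A. norm (\<mu> a) powr q))"
proof -
  obtain D where D: "D > 0" "\<And>\<mu>. \<mu> \<in> ell q S \<Longrightarrow> \<exists>F\<in>hardy_space (ennreal q).
        (\<forall>z\<in>polydisc. ((\<lambda>a. \<mu> a * normalized_kernel (ennreal q) a z) has_sum F z) S) \<and>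
        hardy_norm (ennreal q) F \<le> ennreal (D * ell_norm q S \<mu>)"
    using car unfolding q_carleson_def by blast
  show ?thesis
  proof (rule that)
    show "D powr q > 0" using D by simp
    fix A and \<mu>' :: "complex ^ 'n \<Rightarrow> complex"
    assume A: "finite A" "A \<subseteq> S"
    define \<mu> where "\<mu> a = (if a \<in> A then \<mu>' a else 0)" for a
    have \<mu>: "\<mu> \<in> ell q S" "ell_norm q S \<mu> = (\<Sum>a\<in>A. norm (\<mu> a) powr q) powr (1 / q)"
      using finite_support_ell[OF A, of \<mu> q] q by (simp_all add: \<mu>_def)
    define P where "P z = (\<Sum>a\<in>A. \<mu> a * normalized_kernel (ennreal q) a z)" for z
    obtain F where F: "F \<in> hardy_space (ennreal q)"
        "\<And>z. z \<in> polydisc \<Longrightarrow> ((\<lambda>a. \<mu> a * normalized_kernel (ennreal q) a z) has_sum F z) S"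
        "hardy_norm (ennreal q) F \<le> ennreal (D * ell_norm q S \<mu>)"
      using D(2)[OF \<mu>(1)] by blast
    have FP: "F z = P z" if z: "z \<in> polydisc" for z
    proof -
      let ?h = "\<lambda>a. \<mu> a * normalized_kernel (ennreal q) a z"
      have "(?h has_sum P z) A"
        unfolding P_def by (rule has_sum_finite[OF A(1)])
      moreover have "(?h has_sum P z) A \<longleftrightarrow> (?h has_sum P z) S"
        by (rule has_sum_cong_neutral) (use A in \<open>auto simp: \<mu>_def\<close>)
      ultimately have "(?h has_sum P z) S"
        by blast
      then show ?thesis
        using F(2)[OF z] has_sum_unique by blast
    qed
    have Pc: "continuous_on cpolydisc P"
      unfolding P_def using A S by (intro continuous_on_sum continuous_on_mult continuous_on_const normalized_kernel_continuous) auto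
    have "has_boundary_value F P"
      using has_boundary_value_cong[of F P P] FP has_boundary_value_continuous[OF Pc] by blast
    then have "hardy_norm (ennreal q) F = Lp_norm (ennreal q) P"
      using F(1) by (intro hardy_norm_eq) (simp add: hardy_space_def)
    then have "(\<integral>\<^sup>+ \<zeta>. ennreal (norm (P \<zeta>) powr q) \<partial>torus_measure) \<le> ennreal ((D * ell_norm q S \<mu>) powr q)"
      using F(3) q D(1) by (intro Lp_norm_leD) (auto simp: ell_norm_def)
    also have "(D * ell_norm q S \<mu>) powr q = D powr q * (\<Sum>a\<in>A. norm (\<mu> a) powr q)"
      using q D(1) by (simp add: \<mu>(2) powr_mult powr_powr sum_nonneg)
    finally show "(\<integral>\<^sup>+ \<zeta>. ennreal (norm (\<Sum>a\<in>A. \<mu>' a * normalized_kernel (ennreal q) a \<zeta>) powr q) \<partial>torus_measure)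
      \<le> ennreal (D powr q * (\<Sum>a\<in>A. norm (\<mu>' a) powr q))"
      by (simp add: P_def \<mu>_def cong: sum.cong)
  qed
qed

text \<open>\<open>B\<close> bounds the p-th power of the norm of the map sending
  \<open>\<alpha>\<close> to the square function of the family, from l^p to L^p. Testing on finite
  sets postpones all questions of convergence to the final series.\<close>

definition square_bound ::
  "real \<Rightarrow> ('a \<Rightarrow> complex ^ 'n \<Rightarrow> complex) \<Rightarrow> 'a set \<Rightarrow> real \<Rightarrow> bool" where
  "square_bound p R S B \<longleftrightarrow> (\<forall>A \<alpha>. finite A \<longrightarrow> A \<subseteq> S \<longrightarrow> (\<forall>a. 0 \<le> \<alpha> a) \<longrightarrow>
    (\<integral>\<^sup>+ \<zeta>. ennreal ((\<Sum>a\<in>A. (\<alpha> a)\<^sup>2 * (norm (R a \<zeta>))\<^sup>2) powr (p / 2)) \<partial>torus_measure)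
      \<le> ennreal (B * (\<Sum>a\<in>A. \<alpha> a powr p)))"

lemma square_boundD:
  assumes "square_bound p R S B" "finite A" "A \<subseteq> S" "\<And>a. 0 \<le> \<alpha> a"
  shows "(\<integral>\<^sup>+ \<zeta>. ennreal ((\<Sum>a\<in>A. (\<alpha> a)\<^sup>2 * (norm (R a \<zeta>))\<^sup>2) powr (p / 2)) \<partial>torus_measure)
      \<le> ennreal (B * (\<Sum>a\<in>A. \<alpha> a powr p))"
  using assms unfolding square_bound_def by blast

lemma carleson_square_function:
  fixes S :: "(complex ^ 'n) set"
  assumes S: "S \<subseteq> polydisc" and q: "2 \<le> q" and car: "q_carleson q S"
  obtains D where "D > 0" "square_bound q (normalized_kernel (ennreal q)) S D"
proof -
  obtain D where D: "D > 0" "\<And>A \<mu>. finite A \<Longrightarrow> A \<subseteq> S \<Longrightarrow>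
    (\<integral>\<^sup>+ \<zeta>. ennreal (norm (\<Sum>a\<in>A. \<mu> a * normalized_kernel (ennreal q) a \<zeta>) powr q) \<partial>torus_measure)
      \<le> ennreal (D * (\<Sum>a\<in>A. norm (\<mu> a) powr q))"
    using carleson_finite_sum[OF S _ car] q by auto
  show ?thesis
  proof (rule that[OF D(1)], unfold square_bound_def, intro allI impI)
    fix A and \<beta> :: "complex ^ 'n \<Rightarrow> real"
    assume A: "finite A" "A \<subseteq> S"
      and \<beta>: "\<forall>a. 0 \<le> \<beta> a"
    show "(\<integral>\<^sup>+ \<zeta>. ennreal ((\<Sum>a\<in>A. (\<beta> a)\<^sup>2 * (norm (normalized_kernel (ennreal q) a \<zeta>))\<^sup>2) powr (q / 2)) \<partial>torus_measure)
      \<le> ennreal (D * (\<Sum>a\<in>A. \<beta> a powr q))"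
    proof (rule nn_integral_square_function[OF A(1) q])
      show "normalized_kernel (ennreal q) a \<in> borel_measurable torus_measure" if "a \<in> A" for a
        using that A S by (intro normalized_kernel_measurable) auto
      fix \<sigma> :: "complex ^ 'n \<Rightarrow> real" assume \<sigma>: "\<And>a. \<sigma> a = 1 \<or> \<sigma> a = - 1"
      have "norm (complex_of_real (\<sigma> a * \<beta> a)) = \<beta> a" for a
        using \<sigma>[of a] \<beta> by (auto simp: norm_mult)
      then show "(\<integral>\<^sup>+ \<zeta>. ennreal (norm (\<Sum>a\<in>A. complex_of_real (\<sigma> a * \<beta> a) * normalized_kernel (ennreal q) a \<zeta>) powr q) \<partial>torus_measure)
        \<le> ennreal (D * (\<Sum>a\<in>A. \<beta> a powr q))"
        using D(2)[OF A, of "\<lambda>a. complex_of_real (\<sigma> a * \<beta> a)"] by (simp only:)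
    qed
  qed
qed

text \<open>With \<open>l = \<alpha> * \<beta>\<close>, the Cauchy-Schwarz inequality separates the
  two square functions. Young's inequality then does the work of Hoelder's without loss of
  homogeneity: \<open>\<alpha> powr p\<close> and \<open>\<beta> powr q\<close> both equal
  \<open>l powr s\<close>, so the two bounds have the same right side up to the constants, which are
  simply added.\<close>

lemma nn_integral_bilinear_sum:
  fixes R \<kappa> :: "'a \<Rightarrow> complex ^ 'n \<Rightarrow> complex" and l :: "'a \<Rightarrow> real"
  assumes A: "finite A" "A \<subseteq> S" and exps: "0 < s" "0 < p" "0 < q" "1 / s = 1 / p + 1 / q"
    and meas: "\<And>a. a \<in> S \<Longrightarrow> R a \<in> borel_measurable torus_measure" "\<And>a. a \<in> S \<Longrightarrow> \<kappa> a \<in> borel_measurable torus_measure"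
    and B: "0 \<le> B1" "0 \<le> B2" and R: "square_bound p R S B1" and \<kappa>: "square_bound q \<kappa> S B2"
    and l: "\<And>a. 0 \<le> l a"
  shows "(\<integral>\<^sup>+ \<zeta>. ennreal ((\<Sum>a\<in>A. l a * (norm (R a \<zeta>) * norm (\<kappa> a \<zeta>))) powr s) \<partial>torus_measure) \<le>
    ennreal ((B1 + B2) * (\<Sum>a\<in>A. l a powr s))"
proof -
  define \<alpha> where "\<alpha> a = l a powr (s / p)" for a
  define \<beta> where "\<beta> a = l a powr (s / q)" for a
  have sum1: "s / p + s / q = 1"
  proof -
    have "s / p + s / q = s * (1 / p + 1 / q)"
      by (simp add: distrib_left)
    also have "\<dots> = 1"
      using exps(1) by (simp flip: exps(4))
    finally show ?thesis .
  qed
  have l_eq: "l a = \<alpha> a * \<beta> a" for a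
    using l[of a] sum1 by (simp add: \<alpha>_def \<beta>_def flip: powr_add)
  have \<alpha>p: "\<alpha> a powr p = l a powr s" and \<beta>q: "\<beta> a powr q = l a powr s" for a
    using exps by (simp_all add: \<alpha>_def \<beta>_def powr_powr)
  define U where "U x = (\<Sum>a\<in>A. (\<alpha> a)\<^sup>2 * (norm (R a x))\<^sup>2)" for x
  define V where "V x = (\<Sum>a\<in>A. (\<beta> a)\<^sup>2 * (norm (\<kappa> a x))\<^sup>2)" for x
  have UV: "0 \<le> U x" "0 \<le> V x" for x
    by (auto simp: U_def V_def intro: sum_nonneg)
  have [measurable]: "R a \<in> borel_measurable torus_measure" "\<kappa> a \<in> borel_measurable torus_measure" if "a \<in> A" for a
    using that A meas by auto
  have [measurable]: "U \<in> borel_measurable torus_measure" "V \<in> borel_measurable torus_measure"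
    unfolding U_def V_def by measurable
  have pw: "(\<Sum>a\<in>A. l a * (norm (R a x) * norm (\<kappa> a x))) powr s \<le> U x powr (p / 2) + V x powr (q / 2)" for x
  proof -
    define Z where "Z = (\<Sum>a\<in>A. l a * (norm (R a x) * norm (\<kappa> a x)))"
    have Z0: "0 \<le> Z"
      unfolding Z_def using l by (intro sum_nonneg mult_nonneg_nonneg) auto
    have "Z = (\<Sum>a\<in>A. (\<alpha> a * norm (R a x)) * (\<beta> a * norm (\<kappa> a x)))"
      unfolding Z_def l_eq by (simp add: mult_ac)
    then have "Z\<^sup>2 \<le> (\<Sum>a\<in>A. (\<alpha> a * norm (R a x))\<^sup>2) * (\<Sum>a\<in>A. (\<beta> a * norm (\<kappa> a x))\<^sup>2)"
      using Cauchy_Schwarz_ineq_sum[of "\<lambda>a. \<alpha> a * norm (R a x)" "\<lambda>a. \<beta> a * norm (\<kappa> a x)" A] by simp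
    then have Z2: "Z\<^sup>2 \<le> U x * V x"
      by (simp add: U_def V_def power_mult_distrib)
    show ?thesis
      unfolding Z_def[symmetric]
    proof (cases "Z = 0")
      case False
      then have "0 < U x * V x"
        using Z2 by (meson less_le_trans zero_less_power2)
      then have pos: "0 < U x" "0 < V x"
        using UV by (auto simp: zero_less_mult_iff less_le)
      have "Z powr s = (Z\<^sup>2) powr (s / 2)"
        using Z0 False by (simp add: powr_powr flip: powr_numeral)
      also have "\<dots> \<le> (U x * V x) powr (s / 2)"
        using Z2 exps by (intro powr_mono2) auto
      also have "\<dots> = (U x powr (p / 2)) powr (s / p) * (V x powr (q / 2)) powr (s / q)"
        using exps pos by (simp add: powr_mult powr_powr)
      also have "\<dots> \<le> s / p * U x powr (p / 2) + s / q * V x powr (q / 2)"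
        by (rule Youngs_inequality_0) (use exps pos sum1 in auto)
      also have "\<dots> \<le> 1 * U x powr (p / 2) + 1 * V x powr (q / 2)"
      proof (intro add_mono mult_right_mono)
        have "0 < s / p" "0 < s / q" using exps by auto
        then show "s / p \<le> 1" "s / q \<le> 1" using sum1 by linarith+
      qed auto
      finally show "Z powr s \<le> U x powr (p / 2) + V x powr (q / 2)" by simp
    qed simp
  qed
  have "(\<integral>\<^sup>+ x. ennreal ((\<Sum>a\<in>A. l a * (norm (R a x) * norm (\<kappa> a x))) powr s) \<partial>torus_measure) \<le>
      (\<integral>\<^sup>+ x. ennreal (U x powr (p / 2)) + ennreal (V x powr (q / 2)) \<partial>torus_measure)"
    by (intro nn_integral_mono) (simp add: pw ennreal_leI flip: ennreal_plus)
  also have "\<dots> = (\<integral>\<^sup>+ x. ennreal (U x powr (p / 2)) \<partial>torus_measure) + (\<integral>\<^sup>+ x. ennreal (V x powr (q / 2)) \<partial>torus_measure)"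
    by (rule nn_integral_add) measurable
  also have "\<dots> \<le> ennreal (B1 * (\<Sum>a\<in>A. \<alpha> a powr p)) + ennreal (B2 * (\<Sum>a\<in>A. \<beta> a powr q))"
    unfolding U_def V_def by (intro add_mono square_boundD[OF R A] square_boundD[OF \<kappa> A]) (auto simp: \<alpha>_def \<beta>_def)
  also have "\<dots> = ennreal ((B1 + B2) * (\<Sum>a\<in>A. l a powr s))"
    unfolding \<alpha>p \<beta>q using B by (subst ennreal_plus[symmetric]) (auto simp: distrib_right sum_nonneg)
  finally show ?thesis .
qed

text \<open>For \<open>p \<le> 2\<close> the power \<open>p / 2\<close> is subadditive, so the
  square function is controlled term by term by the norms of the single functions.\<close>

lemma square_bound_type:
  fixes R :: "'a \<Rightarrow> complex ^ 'n \<Rightarrow> complex"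
  assumes p: "0 < p" "p \<le> 2" and meas: "\<And>a. a \<in> S \<Longrightarrow> R a \<in> borel_measurable torus_measure"
    and K: "0 \<le> K" "\<And>a. a \<in> S \<Longrightarrow> (\<integral>\<^sup>+ \<zeta>. ennreal (norm (R a \<zeta>) powr p) \<partial>torus_measure) \<le> ennreal K"
  shows "square_bound p R S K"
  unfolding square_bound_def
proof (intro allI impI)
  fix A and \<alpha> :: "'a \<Rightarrow> real"
  assume A: "finite A" "A \<subseteq> S" and \<alpha>: "\<forall>a. 0 \<le> \<alpha> a"
  have [measurable]: "R a \<in> borel_measurable torus_measure" if "a \<in> A" for a
    using that A meas by auto
  have sq: "(u\<^sup>2 * v\<^sup>2) powr (p / 2) = u powr p * v powr p" if "0 \<le> u" "0 \<le> v" for u v :: real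
  proof -
    have "(u\<^sup>2) powr (p / 2) = u powr p" if "0 \<le> u" for u :: real
      using that by (cases "u = 0") (auto simp: powr_powr simp flip: powr_numeral)
    with that show ?thesis by (simp add: powr_mult)
  qed
  have "(\<integral>\<^sup>+ x. ennreal ((\<Sum>a\<in>A. (\<alpha> a)\<^sup>2 * (norm (R a x))\<^sup>2) powr (p / 2)) \<partial>torus_measure) \<le>
      (\<integral>\<^sup>+ x. (\<Sum>a\<in>A. ennreal (\<alpha> a powr p) * ennreal (norm (R a x) powr p)) \<partial>torus_measure)"
  proof (rule nn_integral_mono)
    fix x
    have "(\<Sum>a\<in>A. (\<alpha> a)\<^sup>2 * (norm (R a x))\<^sup>2) powr (p / 2) \<le> (\<Sum>a\<in>A. ((\<alpha> a)\<^sup>2 * (norm (R a x))\<^sup>2) powr (p / 2))"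
      using p by (intro sum_powr_le A(1)) auto
    also have "\<dots> = (\<Sum>a\<in>A. \<alpha> a powr p * norm (R a x) powr p)"
      using \<alpha> by (intro sum.cong refl sq) auto
    finally have "ennreal ((\<Sum>a\<in>A. (\<alpha> a)\<^sup>2 * (norm (R a x))\<^sup>2) powr (p / 2)) \<le> ennreal (\<Sum>a\<in>A. \<alpha> a powr p * norm (R a x) powr p)"
      by (rule ennreal_leI)
    also have "\<dots> = (\<Sum>a\<in>A. ennreal (\<alpha> a powr p * norm (R a x) powr p))"
      by (rule sum_ennreal[symmetric]) auto
    finally show "ennreal ((\<Sum>a\<in>A. (\<alpha> a)\<^sup>2 * (norm (R a x))\<^sup>2) powr (p / 2)) \<le>
        (\<Sum>a\<in>A. ennreal (\<alpha> a powr p) * ennreal (norm (R a x) powr p))"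
      by (simp add: ennreal_mult)
  qed
  also have "\<dots> = (\<Sum>a\<in>A. ennreal (\<alpha> a powr p) * (\<integral>\<^sup>+ x. ennreal (norm (R a x) powr p) \<partial>torus_measure))"
    by (subst nn_integral_sum) (auto intro!: sum.cong nn_integral_cmult)
  also have "\<dots> \<le> (\<Sum>a\<in>A. ennreal (\<alpha> a powr p) * ennreal K)"
    using A(2) by (intro sum_mono mult_left_mono K) auto
  also have "\<dots> = ennreal (K * (\<Sum>a\<in>A. \<alpha> a powr p))"
    using K(1) by (simp add: sum_distrib_left mult.commute flip: ennreal_mult)
  finally show "(\<integral>\<^sup>+ x. ennreal ((\<Sum>a\<in>A. (\<alpha> a)\<^sup>2 * (norm (R a x))\<^sup>2) powr (p / 2)) \<partial>torus_measure)
      \<le> ennreal (K * (\<Sum>a\<in>A. \<alpha> a powr p))" .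
qed

section \<open>The linear extension operator\<close>

lemma holomorphic_polydisc_cong:
  assumes "holomorphic_polydisc f" "\<And>z. z \<in> polydisc \<Longrightarrow> f z = g z"
  shows "holomorphic_polydisc g"
  unfolding holomorphic_polydisc_def
proof
  fix z :: "complex ^ 'a" assume z: "z \<in> polydisc"
  obtain f' where f': "(f has_derivative f') (at z)" "\<And>c v. f' (c *s v) = c * f' v"
    using holomorphic_polydiscE[OF assms(1) z] by blast
  have "(g has_derivative f') (at z)"
    by (rule has_derivative_transform_within_open[OF f'(1) open_polydisc z assms(2)])
  with f'(2) show "\<exists>f'. (g has_derivative f') (at z) \<and> (\<forall>c v. f' (c *s v) = c * f' v)"
    by blast
qed

text \<open>Links the unordered sum over \<open>S\<close> with the ordered series that
  \<open>boundary_value_series\<close> handles. Indices outside \<open>I\<close> contribute 0, so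
  finite and infinite \<open>S\<close> are treated alike.\<close>

lemma has_sum_enumeration:
  fixes h :: "'a \<Rightarrow> complex"
  assumes e: "bij_betw e I S" and summ: "summable (\<lambda>n. norm (if n \<in> I then h (e n) else 0))"
  shows "(h has_sum (\<Sum>n::nat. if n \<in> I then h (e n) else 0)) S"
proof -
  let ?v = "\<lambda>n. if n \<in> I then h (e n) else 0"
  have "?v sums (\<Sum>n. ?v n)"
    by (rule summable_sums[OF summable_norm_cancel[OF summ]])
  then have "(?v has_sum (\<Sum>n. ?v n)) UNIV"
    by (rule norm_summable_imp_has_sum[OF summ])
  moreover have "(?v has_sum (\<Sum>n. ?v n)) UNIV \<longleftrightarrow> ((\<lambda>n. h (e n)) has_sum (\<Sum>n. ?v n)) I"
    by (rule has_sum_cong_neutral) auto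
  moreover have "((\<lambda>n. h (e n)) has_sum (\<Sum>n. ?v n)) I \<longleftrightarrow> (h has_sum (\<Sum>n. ?v n)) S"
    by (rule has_sum_reindex_bij_betw[OF e])
  ultimately show ?thesis by simp
qed

text \<open>The hypothesis \<open>bound\<close> concerns finite sums of moduli. It yields both the
  absolute convergence needed to form a boundary function and, through Fatou's lemma, the norm
  estimate in the limit.\<close>

lemma linear_extension_series:
  fixes S :: "(complex ^ 'n) set" and w W :: "complex ^ 'n \<Rightarrow> complex ^ 'n \<Rightarrow> complex"
  assumes S: "countable S" and s: "1 \<le> s"
    and w: "\<And>a. a \<in> S \<Longrightarrow> holomorphic_polydisc (w a)" "\<And>a. a \<in> S \<Longrightarrow> has_boundary_value (w a) (W a)"
    and B: "0 \<le> B"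
    and bound: "\<And>A l. finite A \<Longrightarrow> A \<subseteq> S \<Longrightarrow> (\<And>a. 0 \<le> l a) \<Longrightarrow>
      (\<integral>\<^sup>+ \<zeta>. ennreal ((\<Sum>a\<in>A. l a * norm (W a \<zeta>)) powr s) \<partial>torus_measure) \<le> ennreal (B * (\<Sum>a\<in>A. l a powr s))"
    and l: "l \<in> ell s S"
  shows "\<And>z. z \<in> polydisc \<Longrightarrow> (\<lambda>a. l a * w a z) summable_on S"
    and "(\<lambda>z. \<Sum>\<^sub>\<infinity>a\<in>S. l a * w a z) \<in> hardy_space (ennreal s)"
    and "hardy_norm (ennreal s) (\<lambda>z. \<Sum>\<^sub>\<infinity>a\<in>S. l a * w a z) \<le> ennreal (B powr (1 / s) * ell_norm s S l)"
proof -
  define \<Lambda> where "\<Lambda> = (\<Sum>\<^sub>\<infinity>a\<in>S. norm (l a) powr s)"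
  have \<Lambda>: "0 \<le> \<Lambda>"
    unfolding \<Lambda>_def by (rule infsum_nonneg) simp
  have fin_le: "(\<Sum>a\<in>A. norm (l a) powr s) \<le> \<Lambda>" if "finite A" "A \<subseteq> S" for A
    unfolding \<Lambda>_def using l that by (intro finite_sum_le_infsum) (auto simp: ell_def)
  obtain enc :: "complex ^ 'n \<Rightarrow> nat" where enc: "inj_on enc S"
    using S unfolding countable_def by blast
  define I where "I = enc ` S"
  define e where "e = inv_into S enc"
  have e: "bij_betw e I S"
    unfolding e_def I_def by (rule bij_betw_inv_into[OF inj_on_imp_bij_betw[OF enc]])
  have eS: "e n \<in> S" if "n \<in> I" for n
    using bij_betwE[OF e] that by blast
  define f where "f n z = (if n \<in> I then l (e n) * w (e n) z else 0)" for n z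
  define g where "g n \<zeta> = (if n \<in> I then l (e n) * W (e n) \<zeta> else 0)" for n \<zeta>
  have f_hol: "holomorphic_polydisc (f n)" for n
    by (cases "n \<in> I")
       (auto simp: f_def[abs_def] intro!: holomorphic_polydisc_const holomorphic_polydisc_mult[OF holomorphic_polydisc_const] w eS)
  have f_bv: "has_boundary_value (f n) (g n)" for n
  proof (cases "n \<in> I")
    case True
    then have "has_boundary_value (\<lambda>z. w (e n) z * l (e n)) (\<lambda>z. W (e n) z * l (e n))"
      by (intro has_boundary_value_mult w eS continuous_on_const)
    then show ?thesis
      using True by (simp add: f_def[abs_def] g_def[abs_def] mult.commute)
  next
    case False
    then show ?thesis
      using has_boundary_value_continuous[of "\<lambda>_. 0"] by (simp add: f_def[abs_def] g_def[abs_def])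
  qed
  note [measurable] = has_boundary_value_measurable[OF f_bv]
  have part: "(\<integral>\<^sup>+ \<zeta>. ennreal ((\<Sum>n<N. norm (g n \<zeta>)) powr s) \<partial>torus_measure) \<le> ennreal (B * \<Lambda>)" for N
  proof -
    define A where "A = e ` ({..<N} \<inter> I)"
    have A: "finite A" "A \<subseteq> S"
      using eS by (auto simp: A_def)
    have inj: "inj_on e ({..<N} \<inter> I)"
      using e by (auto simp: bij_betw_def intro: inj_on_subset)
    have "(\<Sum>n<N. norm (g n \<zeta>)) = (\<Sum>a\<in>A. norm (l a) * norm (W a \<zeta>))" for \<zeta>
    proof -
      have "(\<Sum>n<N. norm (g n \<zeta>)) = (\<Sum>n\<in>{..<N} \<inter> I. norm (g n \<zeta>))"
        by (rule sum.mono_neutral_right) (auto simp: g_def)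
      also have "\<dots> = (\<Sum>n\<in>{..<N} \<inter> I. norm (l (e n)) * norm (W (e n) \<zeta>))"
        by (intro sum.cong) (auto simp: g_def norm_mult)
      also have "\<dots> = (\<Sum>a\<in>A. norm (l a) * norm (W a \<zeta>))"
        unfolding A_def by (subst sum.reindex[OF inj]) simp
      finally show ?thesis .
    qed
    then have "(\<integral>\<^sup>+ \<zeta>. ennreal ((\<Sum>n<N. norm (g n \<zeta>)) powr s) \<partial>torus_measure) \<le> ennreal (B * (\<Sum>a\<in>A. norm (l a) powr s))"
      using bound[OF A, of "\<lambda>a. norm (l a)"] by simp
    also have "\<dots> \<le> ennreal (B * \<Lambda>)"
      using fin_le[OF A] B by (intro ennreal_leI mult_left_mono)
    finally show ?thesis .
  qed
  have summ: "summable (\<lambda>n. LINT \<zeta>|torus_measure. norm (g n \<zeta>))"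
  proof (rule summableI_nonneg_bounded)
    show "0 \<le> (LINT \<zeta>|torus_measure. norm (g n \<zeta>))" for n
      by (rule Bochner_Integration.integral_nonneg) simp
    fix N
    have int: "integrable torus_measure (\<lambda>\<zeta>. norm (g n \<zeta>))" for n
      using has_boundary_value_integrable[OF f_hol f_bv] by auto
    have "ennreal (\<Sum>n<N. LINT \<zeta>|torus_measure. norm (g n \<zeta>)) = ennreal (LINT \<zeta>|torus_measure. (\<Sum>n<N. norm (g n \<zeta>)))"
      by (subst Bochner_Integration.integral_sum) (use int in auto)
    also have "\<dots> = (\<integral>\<^sup>+ \<zeta>. ennreal (\<Sum>n<N. norm (g n \<zeta>)) \<partial>torus_measure)"
      using int by (intro nn_integral_eq_integral[symmetric] Bochner_Integration.integrable_sum AE_I2 sum_nonneg) auto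
    \<comment> \<open>On a probability space the elementary bound
      \<open>X \<le> 1 + X powr s\<close> turns the uniform L^s estimate into a uniform L^1
      estimate.\<close>
    also have "\<dots> \<le> (\<integral>\<^sup>+ \<zeta>. ennreal 1 + ennreal ((\<Sum>n<N. norm (g n \<zeta>)) powr s) \<partial>torus_measure)"
    proof (rule nn_integral_mono)
      fix \<zeta>
      define X where "X = (\<Sum>n<N. norm (g n \<zeta>))"
      have "X \<le> 1 + X powr s"
      proof (cases "X \<le> 1")
        case False
        then have "X powr 1 \<le> X powr s"
          using s by (intro powr_mono) auto
        then show ?thesis using False by simp
      qed (simp add: add_increasing2)
      then have "ennreal X \<le> ennreal (1 + X powr s)"
        by (rule ennreal_leI)
      also have "\<dots> = ennreal 1 + ennreal (X powr s)"
        by (rule ennreal_plus) auto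
      finally show "ennreal (\<Sum>n<N. norm (g n \<zeta>)) \<le> ennreal 1 + ennreal ((\<Sum>n<N. norm (g n \<zeta>)) powr s)"
        unfolding X_def .
    qed
    also have "\<dots> = (\<integral>\<^sup>+ \<zeta>. ennreal 1 \<partial>(torus_measure :: (complex ^ 'n) measure)) + (\<integral>\<^sup>+ \<zeta>. ennreal ((\<Sum>n<N. norm (g n \<zeta>)) powr s) \<partial>torus_measure)"
      by (rule nn_integral_add) measurable
    also have "\<dots> \<le> ennreal 1 + ennreal (B * \<Lambda>)"
      unfolding nn_integral_torus_const by (intro add_left_mono part)
    also have "\<dots> = ennreal (1 + B * \<Lambda>)"
      using B \<Lambda> by (intro ennreal_plus[symmetric]) auto
    finally show "(\<Sum>n<N. LINT \<zeta>|torus_measure. norm (g n \<zeta>)) \<le> 1 + B * \<Lambda>"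
      using B \<Lambda> by (subst (asm) ennreal_le_iff) auto
  qed
  note series = boundary_value_series[OF f_hol f_bv summ]
  have hs: "((\<lambda>a. l a * w a z) has_sum (\<Sum>n. f n z)) S" if "z \<in> polydisc" for z
    using has_sum_enumeration[OF e, of "\<lambda>a. l a * w a z"] series(2)[OF that] unfolding f_def .
  show "(\<lambda>a. l a * w a z) summable_on S" if "z \<in> polydisc" for z
    using hs[OF that] by (rule has_sum_imp_summable)
  define F where "F = (\<lambda>z. \<Sum>\<^sub>\<infinity>a\<in>S. l a * w a z)"
  have eq: "(\<Sum>n. f n z) = F z" if "z \<in> polydisc" for z
    unfolding F_def using hs[OF that] by (rule infsumI[symmetric])
  have F_hol: "holomorphic_polydisc F"
    by (rule holomorphic_polydisc_cong[OF series(1) eq])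
  have F_bv: "has_boundary_value F (\<lambda>\<zeta>. \<Sum>n. g n \<zeta>)"
    using series(4) has_boundary_value_cong[of "\<lambda>z. \<Sum>n. f n z" F] eq by blast
  \<comment> \<open>The partial sums converge almost everywhere by absolute summability of the
    boundary functions, so Fatou's lemma passes their common bound to the limit.\<close>
  have G: "(\<integral>\<^sup>+ \<zeta>. ennreal (norm (\<Sum>n. g n \<zeta>) powr s) \<partial>torus_measure) \<le> ennreal (B * \<Lambda>)"
  proof -
    have "(\<integral>\<^sup>+ \<zeta>. ennreal (norm (\<Sum>n. g n \<zeta>) powr s) \<partial>torus_measure) =
        (\<integral>\<^sup>+ \<zeta>. liminf (\<lambda>N. ennreal (norm (\<Sum>n<N. g n \<zeta>) powr s)) \<partial>torus_measure)"
    proof (rule nn_integral_cong_AE)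
      show "AE \<zeta> in torus_measure. ennreal (norm (\<Sum>n. g n \<zeta>) powr s) = liminf (\<lambda>N. ennreal (norm (\<Sum>n<N. g n \<zeta>) powr s))"
        using series(3)
      proof eventually_elim
        case (elim \<zeta>)
        then have "(\<lambda>N. \<Sum>n<N. g n \<zeta>) \<longlonglongrightarrow> (\<Sum>n. g n \<zeta>)"
          by (rule summable_LIMSEQ[OF summable_norm_cancel])
        then have "(\<lambda>N. ennreal (norm (\<Sum>n<N. g n \<zeta>) powr s)) \<longlonglongrightarrow> ennreal (norm (\<Sum>n. g n \<zeta>) powr s)"
          using s by (intro tendsto_ennrealI tendsto_powr' tendsto_norm tendsto_const) auto
        then show ?case
          by (intro lim_imp_Liminf[symmetric]) auto
      qed
    qed
    also have "\<dots> \<le> liminf (\<lambda>N. \<integral>\<^sup>+ \<zeta>. ennreal (norm (\<Sum>n<N. g n \<zeta>) powr s) \<partial>torus_measure)"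
      by (rule nn_integral_liminf) measurable
    also have "\<dots> \<le> liminf (\<lambda>N. ennreal (B * \<Lambda>))"
    proof (intro Liminf_mono always_eventually allI)
      fix N
      have "(\<integral>\<^sup>+ \<zeta>. ennreal (norm (\<Sum>n<N. g n \<zeta>) powr s) \<partial>torus_measure) \<le> (\<integral>\<^sup>+ \<zeta>. ennreal ((\<Sum>n<N. norm (g n \<zeta>)) powr s) \<partial>torus_measure)"
        using s by (intro nn_integral_mono ennreal_leI powr_mono2 norm_sum) auto
      also have "\<dots> \<le> ennreal (B * \<Lambda>)" by (rule part)
      finally show "(\<integral>\<^sup>+ \<zeta>. ennreal (norm (\<Sum>n<N. g n \<zeta>) powr s) \<partial>torus_measure) \<le> ennreal (B * \<Lambda>)" .
    qed
    also have "\<dots> = ennreal (B * \<Lambda>)"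
      by (simp add: Liminf_const)
    finally show ?thesis .
  qed
  \<comment> \<open>Membership in the Hardy space concerns dilates; their means are controlled by
    the boundary function through \<open>dilate_contraction\<close>.\<close>
  have "Lp_norm (ennreal s) (\<lambda>\<zeta>. F (r *\<^sub>R \<zeta>)) \<le> ennreal ((B * \<Lambda>) powr (1 / s))" if "r \<in> {0..<1}" for r
  proof (rule Lp_norm_le)
    have "(\<integral>\<^sup>+ \<zeta>. ennreal (norm (F (r *\<^sub>R \<zeta>)) powr s) \<partial>torus_measure) \<le> (\<integral>\<^sup>+ \<zeta>. ennreal (norm (\<Sum>n. g n \<zeta>) powr s) \<partial>torus_measure)"
      using dilate_contraction[OF F_hol F_bv s, of r 0] that by simp
    also note G
    finally show "(\<integral>\<^sup>+ \<zeta>. ennreal (norm (F (r *\<^sub>R \<zeta>)) powr s) \<partial>torus_measure) \<le> ennreal (B * \<Lambda>)" .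
  qed (use s B \<Lambda> in auto)
  then have "(SUP r\<in>{0..<1}. Lp_norm (ennreal s) (\<lambda>\<zeta>. F (r *\<^sub>R \<zeta>))) \<le> ennreal ((B * \<Lambda>) powr (1 / s))"
    by (rule SUP_least)
  also have "\<dots> < \<infinity>" by simp
  finally have "(SUP r\<in>{0..<1}. Lp_norm (ennreal s) (\<lambda>\<zeta>. F (r *\<^sub>R \<zeta>))) < \<infinity>" .
  with F_hol show "F \<in> hardy_space (ennreal s)"
    by (simp add: hardy_space_def)
  have "hardy_norm (ennreal s) F = Lp_norm (ennreal s) (\<lambda>\<zeta>. \<Sum>n. g n \<zeta>)"
    by (rule hardy_norm_eq[OF F_hol F_bv])
  also have "\<dots> \<le> ennreal ((B * \<Lambda>) powr (1 / s))"
    by (rule Lp_norm_le[OF _ _ G]) (use s B \<Lambda> in auto)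
  also have "(B * \<Lambda>) powr (1 / s) = B powr (1 / s) * ell_norm s S l"
    using B \<Lambda> by (simp add: powr_mult ell_norm_def \<Lambda>_def)
  finally show "hardy_norm (ennreal s) F \<le> ennreal (B powr (1 / s) * ell_norm s S l)" .
qed

text \<open>The conclusion of \<open>theorem2p7\<close> as a predicate, shared by the two cases of
  \<open>p\<close>.\<close>

definition has_linear_extension :: "real \<Rightarrow> (complex ^ 'n) set \<Rightarrow> bool" where
  "has_linear_extension s S \<longleftrightarrow> hardy_interpolating s S \<and>
    (\<exists>E. bounded_linear_ell_hardy s S E \<and>
       (\<forall>l\<in>ell s S. \<forall>a\<in>S.
          E l a = l a * complex_of_real (kernel_norm (conj_exponent (ennreal s)) a)))"

lemma has_linear_extension_series:
  fixes S :: "(complex ^ 'n) set" and w W :: "complex ^ 'n \<Rightarrow> complex ^ 'n \<Rightarrow> complex"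
  assumes S: "countable S" "S \<subseteq> polydisc" and s: "1 \<le> s"
    and w: "\<And>a. a \<in> S \<Longrightarrow> holomorphic_polydisc (w a)" "\<And>a. a \<in> S \<Longrightarrow> has_boundary_value (w a) (W a)"
    and val: "\<And>a b. a \<in> S \<Longrightarrow> b \<in> S \<Longrightarrow>
      w a b = (if a = b then complex_of_real (kernel_norm (conj_exponent (ennreal s)) b) else 0)"
    and B: "0 \<le> B"
    and bound: "\<And>A l. finite A \<Longrightarrow> A \<subseteq> S \<Longrightarrow> (\<And>a. 0 \<le> l a) \<Longrightarrow>
      (\<integral>\<^sup>+ \<zeta>. ennreal ((\<Sum>a\<in>A. l a * norm (W a \<zeta>)) powr s) \<partial>torus_measure) \<le> ennreal (B * (\<Sum>a\<in>A. l a powr s))"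
  shows "has_linear_extension s S"
proof -
  \<comment> \<open>An unordered sum is linear in \<open>l\<close> wherever the terms are summable,
    and at a point of \<open>S\<close> it reduces to a single term.\<close>
  define E where "E l z = (\<Sum>\<^sub>\<infinity>a\<in>S. l a * w a z)" for l z
  note ser = linear_extension_series[OF S(1) s w B bound]
  have mem: "E l \<in> hardy_space (ennreal s)" if "l \<in> ell s S" for l
    unfolding E_def by (rule ser(2)[OF _ _ _ _ _ that])
  have nrm: "hardy_norm (ennreal s) (E l) \<le> ennreal (B powr (1 / s) * ell_norm s S l)" if "l \<in> ell s S" for l
    unfolding E_def by (rule ser(3)[OF _ _ _ _ _ that])
  have summ: "(\<lambda>a. l a * w a z) summable_on S" if "l \<in> ell s S" "z \<in> polydisc" for l z
    by (rule ser(1)[OF _ _ _ _ _ that])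
  have E_val: "E l b = l b * complex_of_real (kernel_norm (conj_exponent (ennreal s)) b)" if "b \<in> S" for l b
  proof -
    have "E l b = (\<Sum>\<^sub>\<infinity>a\<in>{b}. l a * w a b)"
      unfolding E_def by (rule infsum_cong_neutral) (use that val in auto)
    then show ?thesis
      using val[OF that that] by simp
  qed
  have "bounded_linear_ell_hardy s S E"
    unfolding bounded_linear_ell_hardy_def
  proof (intro conjI ballI allI exI)
    show "E l \<in> hardy_space (ennreal s)" if "l \<in> ell s S" for l
      by (rule mem[OF that])
    show "E (\<lambda>a. l a + m a) z = E l z + E m z" if "l \<in> ell s S" "m \<in> ell s S" "z \<in> polydisc" for l m z
      unfolding E_def distrib_right using that by (intro infsum_add summ)
    show "E (\<lambda>a. c * l a) z = c * E l z" for c l z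
      unfolding E_def mult.assoc by (rule infsum_cmult_right')
    show "hardy_norm (ennreal s) (E l) \<le> ennreal (B powr (1 / s) * ell_norm s S l)" if "l \<in> ell s S" for l
      by (rule nrm[OF that])
  qed
  with mem E_val show ?thesis
    unfolding has_linear_extension_def hardy_interpolating_def by blast
qed

lemma normalized_kernel_diag:
  "normalized_kernel q a a = complex_of_real (kdiag a / kernel_norm q a)"
  by (simp add: normalized_kernel_def szego_kernel_diag)

text \<open>The common form of both cases. The dual functions may take any diagonal values
  \<open>m a\<close>, provided these are at least of the size \<open>kdiag a powr (1 / p)\<close>.
  In the applications \<open>m a\<close> is the kernel norm for the exponent conjugate to
  \<open>p\<close>, or \<open>kdiag a / kernel_norm (ennreal q) a\<close>.\<close>

lemma has_linear_extension_dual: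
  fixes S :: "(complex ^ 'n) set" and \<rho> R :: "complex ^ 'n \<Rightarrow> complex ^ 'n \<Rightarrow> complex"
  assumes S: "countable S" "S \<subseteq> polydisc"
    and exps: "1 \<le> s" "0 < p" "2 \<le> q" "1 / s = 1 / p + 1 / q" and car: "q_carleson q S"
    and \<rho>: "\<And>a. a \<in> S \<Longrightarrow> holomorphic_polydisc (\<rho> a)" "\<And>a. a \<in> S \<Longrightarrow> has_boundary_value (\<rho> a) (R a)"
    and val: "\<And>a b. a \<in> S \<Longrightarrow> b \<in> S \<Longrightarrow> \<rho> a b = (if a = b then complex_of_real (m b) else 0)"
    and c0: "0 < c0" "\<And>a. a \<in> S \<Longrightarrow> c0 * kdiag a powr (1 / p) \<le> m a"
    and B1: "0 \<le> B1" "square_bound p R S B1"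
  shows "has_linear_extension s S"
proof -
  define s' where "s' = conj_exponent (ennreal s)"
  define \<kappa> where "\<kappa> a = normalized_kernel (ennreal q) a" for a :: "complex ^ 'n"
  \<comment> \<open>Dictated by the value at \<open>a\<close>: the product of \<open>m a\<close>, of
    \<open>kdiag a / kernel_norm (ennreal q) a\<close> and of \<open>c a\<close> has to equal
    \<open>kernel_norm s' a\<close>.\<close>
  define c where "c a = kernel_norm s' a * kernel_norm (ennreal q) a / (m a * kdiag a)" for a
  obtain B2 where B2: "B2 > 0" "square_bound q \<kappa> S B2"
    using carleson_square_function[OF S(2) exps(3) car] unfolding \<kappa>_def by blast
  obtain C1 where C1: "C1 > 0" "\<And>a :: complex ^ 'n. a \<in> polydisc \<Longrightarrow> kernel_norm s' a \<le> C1 * kdiag a powr (1 / s)"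
    unfolding s'_def using kernel_norm_conj_upper[OF exps(1)] by blast
  have q1: "1 < q" using exps by simp
  obtain C2 where C2: "C2 > 0" "\<And>a :: complex ^ 'n. a \<in> polydisc \<Longrightarrow> kernel_norm (ennreal q) a \<le> C2 * kdiag a powr (1 - 1 / q)"
    using kernel_norm_upper[OF q1] by blast
  \<comment> \<open>The lower bound guarantees a positive norm: division by a norm 0 would give 0
    and spoil the value at \<open>a\<close>.\<close>
  obtain c2 where c2: "c2 > 0" "\<And>a :: complex ^ 'n. a \<in> polydisc \<Longrightarrow> c2 * kdiag a powr (1 - 1 / q) \<le> kernel_norm (ennreal q) a"
    using kernel_norm_lower[OF exps(3)] by blast
  have kq_pos: "0 < kernel_norm (ennreal q) a" if "a \<in> polydisc" for a :: "complex ^ 'n"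
    using c2(2)[OF that] c2(1) kdiag_pos[OF that] by (intro less_le_trans[OF _ c2(2)[OF that]] mult_pos_pos) auto
  have m_pos: "0 < m a" if "a \<in> S" for a
    using that S(2) kdiag_pos[of a] c0(1) by (intro less_le_trans[OF _ c0(2)[OF that]] mult_pos_pos) auto
  have ks_nonneg: "0 \<le> kernel_norm s' a" for a :: "complex ^ 'n"
    by (simp add: kernel_norm_def)
  define C where "C = C1 * C2 / c0"
  have C: "C > 0" using C1 C2 c0 by (simp add: C_def)
  have c_nonneg: "0 \<le> c a" if "a \<in> S" for a
    unfolding c_def using m_pos[OF that] kq_pos[of a] kdiag_pos[of a] ks_nonneg that S(2)
    by (intro divide_nonneg_nonneg mult_nonneg_nonneg) (auto intro: less_imp_le)
  \<comment> \<open>The powers of the diagonal kernel value cancel because \<open>1 / s = 1 / p + 1 / q\<close>.\<close>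
  have c_le: "c a \<le> C" if a: "a \<in> S" for a
  proof -
    have ap: "a \<in> polydisc" using a S(2) by blast
    define N where "N = kdiag a"
    have N: "N > 0" unfolding N_def by (rule kdiag_pos[OF ap])
    have "kernel_norm s' a * kernel_norm (ennreal q) a \<le> (C1 * N powr (1 / s)) * (C2 * N powr (1 - 1 / q))"
      unfolding N_def using C1 C2 ks_nonneg kq_pos[OF ap] ap by (intro mult_mono) (auto intro: less_imp_le)
    also have "\<dots> = (C1 * C2) * (N powr (1 / p) * N)"
    proof -
      have "N powr (1 / s) * N powr (1 - 1 / q) = N powr (1 / p + 1)"
        unfolding powr_add[symmetric] using exps(4) by simp
      then show ?thesis
        using N by (simp add: powr_add mult_ac)
    qed
    also have "\<dots> = C * ((c0 * N powr (1 / p)) * N)"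
      using c0(1) by (simp add: C_def)
    also have "\<dots> \<le> C * (m a * N)"
      using c0(2)[OF a] N C by (intro mult_left_mono mult_right_mono) (auto simp: N_def)
    finally show ?thesis
      using m_pos[OF a] N by (simp add: c_def N_def divide_le_eq)
  qed
  define w where "w a z = \<rho> a z * (\<kappa> a z * complex_of_real (c a))" for a z
  define W where "W a \<zeta> = R a \<zeta> * (\<kappa> a \<zeta> * complex_of_real (c a))" for a \<zeta>
  have \<kappa>c: "continuous_on cpolydisc (\<lambda>z. \<kappa> a z * complex_of_real (c a))" if "a \<in> S" for a
    unfolding \<kappa>_def using that S(2) by (intro continuous_on_mult continuous_on_const normalized_kernel_continuous) auto
  have \<kappa>h: "holomorphic_polydisc (\<lambda>z. \<kappa> a z * complex_of_real (c a))" if "a \<in> S" for a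
    unfolding \<kappa>_def using that S(2)
    by (intro holomorphic_polydisc_mult[OF normalized_kernel_holomorphic holomorphic_polydisc_const]) auto
  show ?thesis
  proof (rule has_linear_extension_series[OF S exps(1), of w W "(B1 + B2) * C powr s"])
    show "holomorphic_polydisc (w a)" if "a \<in> S" for a
      unfolding w_def by (rule holomorphic_polydisc_mult[OF \<rho>(1)[OF that] \<kappa>h[OF that]])
    show "has_boundary_value (w a) (W a)" if "a \<in> S" for a
      unfolding w_def W_def by (rule has_boundary_value_mult[OF \<rho>(1)[OF that] \<rho>(2)[OF that] \<kappa>c[OF that]])
    show "w a b = (if a = b then complex_of_real (kernel_norm (conj_exponent (ennreal s)) b) else 0)" if "a \<in> S" "b \<in> S" for a b
    proof (cases "a = b")
      case True
      have bp: "b \<in> polydisc" using that S(2) by blast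
      have "m b * (kdiag b / kernel_norm (ennreal q) b * c b) = kernel_norm s' b"
        using m_pos[OF that(2)] kdiag_pos[OF bp] kq_pos[OF bp] by (simp add: c_def)
      then have "complex_of_real (m b) * (complex_of_real (kdiag b / kernel_norm (ennreal q) b) * complex_of_real (c b)) = complex_of_real (kernel_norm s' b)"
        by (simp only: of_real_mult[symmetric])
      then show ?thesis
        using val[OF that] True by (simp add: w_def \<kappa>_def normalized_kernel_diag s'_def)
    qed (use val[OF that] in \<open>simp add: w_def\<close>)
    show "0 \<le> (B1 + B2) * C powr s"
      using B1(1) B2(1) by (intro mult_nonneg_nonneg) auto
    fix A and l :: "complex ^ 'n \<Rightarrow> real"
    assume A: "finite A" "A \<subseteq> S" and l: "\<And>a. 0 \<le> l a"
    \<comment> \<open>The bounded weights \<open>c a\<close> are absorbed by replacing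
      \<open>l a\<close> with \<open>l a * C\<close>, which accounts for the factor
      \<open>C powr s\<close>.\<close>
    have "(\<integral>\<^sup>+ \<zeta>. ennreal ((\<Sum>a\<in>A. l a * norm (W a \<zeta>)) powr s) \<partial>torus_measure) \<le>
        (\<integral>\<^sup>+ \<zeta>. ennreal ((\<Sum>a\<in>A. (l a * C) * (norm (R a \<zeta>) * norm (\<kappa> a \<zeta>))) powr s) \<partial>torus_measure)"
    proof (intro nn_integral_mono ennreal_leI powr_mono2 sum_mono sum_nonneg)
      show "0 \<le> s" using exps by simp
      show "0 \<le> l a * norm (W a \<zeta>)" for a \<zeta> using l by simp
      fix \<zeta> a assume "a \<in> A"
      then have "norm (W a \<zeta>) \<le> C * (norm (R a \<zeta>) * norm (\<kappa> a \<zeta>))"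
        using c_nonneg[of a] c_le[of a] A(2) mult_right_mono[of "c a" C "norm (R a \<zeta>) * norm (\<kappa> a \<zeta>)"]
        by (auto simp: W_def norm_mult mult_ac)
      then show "l a * norm (W a \<zeta>) \<le> (l a * C) * (norm (R a \<zeta>) * norm (\<kappa> a \<zeta>))"
        using mult_left_mono[OF _ l[of a]] by (simp add: mult.assoc)
    qed
    also have "\<dots> \<le> ennreal ((B1 + B2) * (\<Sum>a\<in>A. (l a * C) powr s))"
    proof (rule nn_integral_bilinear_sum[OF A _ exps(2) _ exps(4) _ _ B1(1) _ B1(2) B2(2)])
      show "0 < s" "0 < q" "0 \<le> B2" using exps B2 by auto
      show "R a \<in> borel_measurable torus_measure" if "a \<in> S" for a
        by (rule has_boundary_value_measurable[OF \<rho>(2)[OF that]])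
      show "\<kappa> a \<in> borel_measurable torus_measure" if "a \<in> S" for a
        unfolding \<kappa>_def using that S(2) by (intro normalized_kernel_measurable) auto
      show "0 \<le> l a * C" for a using l C by simp
    qed
    also have "(\<Sum>a\<in>A. (l a * C) powr s) = C powr s * (\<Sum>a\<in>A. l a powr s)"
      using l C by (simp add: powr_mult sum_distrib_left mult.commute)
    finally show "(\<integral>\<^sup>+ \<zeta>. ennreal ((\<Sum>a\<in>A. l a * norm (W a \<zeta>)) powr s) \<partial>torus_measure) \<le>
        ennreal ((B1 + B2) * C powr s * (\<Sum>a\<in>A. l a powr s))"
      by (simp add: mult.assoc)
  qed
qed

lemma hardy_space_boundary_value:
  fixes f :: "complex ^ 'n \<Rightarrow> complex"
  assumes p: "1 < p" and f: "f \<in> hardy_space (ennreal p)"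
  shows "\<exists>g. has_boundary_value f g"
proof -
  define X where "X = (SUP r\<in>{0..<1}. Lp_norm (ennreal p) (\<lambda>\<zeta>. f (r *\<^sub>R \<zeta>)))"
  have hol: "holomorphic_polydisc f" and X: "X < \<infinity>"
    using f by (auto simp: hardy_space_def X_def)
  have eX: "X = ennreal (enn2real X)"
    using X by simp
  have "Lp_norm (ennreal p) (\<lambda>\<zeta>. f (r *\<^sub>R \<zeta>)) \<le> ennreal (enn2real X)" if "0 \<le> r" "r < 1" for r
    unfolding eX[symmetric] unfolding X_def using that by (intro SUP_upper) auto
  then show ?thesis
    using p by (intro hardy_boundary_value_exists[OF hol p, of "enn2real X powr p"] Lp_norm_leD) auto
qed

lemma has_linear_extension_finite_exponent:
  fixes S :: "(complex ^ 'n) set"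
  assumes S: "countable S" "S \<subseteq> polydisc" and car: "carleson_sequence S"
    and p: "1 < p" "p \<le> 2" and s: "1 \<le> s" "s < p" and dual: "dual_bounded (ennreal p) S"
  shows "has_linear_extension s S"
proof -
  define p' where "p' = p / (p - 1)"
  have p': "2 \<le> p'" "1 - 1 / p' = 1 / p" "conj_exponent (ennreal p) = ennreal p'"
    using p conj_exponent_ennreal[OF p(1)] by (auto simp: p'_def field_simps)
  obtain \<rho> where \<rho>: "\<And>a. a \<in> S \<Longrightarrow> \<rho> a \<in> hardy_space (ennreal p)"
    "(SUP a\<in>S. hardy_norm (ennreal p) (\<rho> a)) < \<infinity>"
    "\<And>a b. a \<in> S \<Longrightarrow> b \<in> S \<Longrightarrow> hardy_pairing (\<rho> a) (normalized_kernel (ennreal p') b) = (if a = b then 1 else 0)"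
    using dual unfolding dual_bounded_def p'(3)[symmetric] by auto
  have hol: "holomorphic_polydisc (\<rho> a)" if "a \<in> S" for a
    using \<rho>(1)[OF that] by (simp add: hardy_space_def)
  define R where "R a = boundary_value (\<rho> a)" for a
  have bv: "has_boundary_value (\<rho> a) (R a)" if a: "a \<in> S" for a
    using hardy_space_boundary_value[OF p(1) \<rho>(1)[OF a]] boundary_value_AE(1)[OF hol[OF a]] unfolding R_def by blast
  obtain c0 where c0: "c0 > 0" "\<And>a :: complex ^ 'n. a \<in> polydisc \<Longrightarrow> c0 * kdiag a powr (1 / p) \<le> kernel_norm (ennreal p') a"
    using kernel_norm_lower[OF p'(1)] unfolding p'(2) by blast
  have kpos: "0 < kernel_norm (ennreal p') a" if "a \<in> polydisc" for a :: "complex ^ 'n"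
    using c0(1) kdiag_pos[OF that] by (intro less_le_trans[OF _ c0(2)[OF that]] mult_pos_pos) auto
  \<comment> \<open>By Cauchy's formula, pairing with the normalized kernel at \<open>b\<close> is
    evaluation at \<open>b\<close> divided by the kernel norm, so the duality condition becomes one
    on values.\<close>
  have val: "\<rho> a b = (if a = b then complex_of_real (kernel_norm (ennreal p') b) else 0)" if "a \<in> S" "b \<in> S" for a b
  proof -
    have bp: "b \<in> polydisc" using that S(2) by blast
    note [measurable] = has_boundary_value_measurable[OF bv[OF that(1)]] szego_kernel_measurable[OF bp]
    define k where "k = kernel_norm (ennreal p') b"
    have k: "k > 0" unfolding k_def by (rule kpos[OF bp])
    have nk: "has_boundary_value (normalized_kernel (ennreal p') b) (normalized_kernel (ennreal p') b)"
      by (intro has_boundary_value_continuous normalized_kernel_continuous bp)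
    note nkb = boundary_value_AE[OF normalized_kernel_holomorphic[OF bp] nk]
    note [measurable] = has_boundary_value_measurable[OF nkb(1)]
    have "hardy_pairing (\<rho> a) (normalized_kernel (ennreal p') b) =
        (LINT \<zeta>|torus_measure. R a \<zeta> * cnj (boundary_value (normalized_kernel (ennreal p') b) \<zeta>))"
      by (simp add: hardy_pairing_def R_def)
    also have "\<dots> = (LINT \<zeta>|torus_measure. (R a \<zeta> * cnj (szego_kernel b \<zeta>)) / complex_of_real k)"
    proof (rule integral_cong_AE)
      show "AE \<zeta> in torus_measure. R a \<zeta> * cnj (boundary_value (normalized_kernel (ennreal p') b) \<zeta>) =
          (R a \<zeta> * cnj (szego_kernel b \<zeta>)) / complex_of_real k"
        using nkb(2) by eventually_elim (simp add: normalized_kernel_def k_def)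
    qed measurable
    also have "\<dots> = \<rho> a b / complex_of_real k"
      by (simp add: cauchy_boundary_value(1)[OF hol[OF that(1)] bv[OF that(1)] bp])
    finally have "\<rho> a b / complex_of_real k = (if a = b then 1 else 0)"
      using \<rho>(3)[OF that] by simp
    then show ?thesis
      using k by (auto simp: k_def[symmetric] field_simps split: if_splits)
  qed
  define X where "X = enn2real (SUP a\<in>S. hardy_norm (ennreal p) (\<rho> a))"
  have "hardy_norm (ennreal p) (\<rho> a) \<le> ennreal X" if "a \<in> S" for a
  proof -
    have "ennreal X = (SUP a\<in>S. hardy_norm (ennreal p) (\<rho> a))"
      using \<rho>(2) by (simp add: X_def)
    with SUP_upper[OF that, of "\<lambda>a. hardy_norm (ennreal p) (\<rho> a)"] show ?thesis
      by simp
  qed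
  then have K: "(\<integral>\<^sup>+ \<zeta>. ennreal (norm (R a \<zeta>) powr p) \<partial>torus_measure) \<le> ennreal (X powr p)" if "a \<in> S" for a
    using that p unfolding hardy_norm_def R_def by (intro Lp_norm_leD) (auto simp: X_def)
  \<comment> \<open>Solves \<open>1 / s = 1 / p + 1 / q\<close>. The divisor is positive because
    \<open>s < p\<close>, and at most 1/2 because \<open>1 / s \<le> 1\<close> and
    \<open>1 / 2 \<le> 1 / p\<close>.\<close>
  define q where "q = 1 / (1 / s - 1 / p)"
  have inv: "0 < 1 / s - 1 / p" "1 / s - 1 / p \<le> 1 / 2"
  proof -
    show "0 < 1 / s - 1 / p" using s by (simp add: field_simps)
    have "1 / s \<le> 1" "1 / 2 \<le> 1 / p" using s p by (auto simp: field_simps)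
    then show "1 / s - 1 / p \<le> 1 / 2" by linarith
  qed
  have q: "2 \<le> q" "1 / s = 1 / p + 1 / q"
  proof -
    have "1 / (1 / 2) \<le> q"
      unfolding q_def using inv by (intro divide_left_mono) auto
    then show "2 \<le> q" by simp
    show "1 / s = 1 / p + 1 / q" by (simp add: q_def)
  qed
  show ?thesis
  proof (rule has_linear_extension_dual[OF S s(1) _ q _ hol bv val c0(1)])
    show "0 < p" using p by simp
    show "q_carleson q S"
      using car q(1) by (auto simp: carleson_sequence_def)
    show "c0 * kdiag a powr (1 / p) \<le> kernel_norm (ennreal p') a" if "a \<in> S" for a
      using that S(2) by (intro c0(2)) auto
    show "0 \<le> X powr p" by simp
    show "square_bound p R S (X powr p)"
      using p by (intro square_bound_type K has_boundary_value_measurable[OF bv]) auto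
  qed
qed

lemma has_linear_extension_infinite_exponent:
  fixes S :: "(complex ^ 'n) set"
  assumes S: "countable S" "S \<subseteq> polydisc" and car: "carleson_sequence S"
    and s: "1 \<le> s" and dual: "dual_bounded \<infinity> S"
  shows "has_linear_extension s S"
proof -
  obtain \<rho> where \<rho>: "\<And>a. a \<in> S \<Longrightarrow> \<rho> a \<in> hardy_space \<infinity>"
    "(SUP a\<in>S. hardy_norm \<infinity> (\<rho> a)) < \<infinity>"
    "\<And>a b. a \<in> S \<Longrightarrow> b \<in> S \<Longrightarrow> \<rho> a b = (if a = b then 1 else 0)"
    using dual unfolding dual_bounded_def by auto
  have hol: "holomorphic_polydisc (\<rho> a)" if "a \<in> S" for a
    using \<rho>(1)[OF that] by (simp add: hardy_space_def)
  define R where "R a = boundary_value (\<rho> a)" for a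
  have bv: "has_boundary_value (\<rho> a) (R a)" if a: "a \<in> S" for a
  proof -
    \<comment> \<open>A bounded function has bounded means of every order; 2 is an order that
      \<open>hardy_boundary_value_exists\<close> accepts.\<close>
    obtain K where K: "K > 0" "\<And>z. z \<in> polydisc \<Longrightarrow> norm (\<rho> a z) \<le> K"
      using \<rho>(1)[OF a] by (auto simp: hardy_space_def bounded_pos)
    have "(\<integral>\<^sup>+ \<zeta>. ennreal (norm (\<rho> a (r *\<^sub>R \<zeta>)) powr 2) \<partial>torus_measure) \<le> ennreal (K powr 2)" if "0 \<le> r" "r < 1" for r
    proof -
      have "(\<integral>\<^sup>+ \<zeta>. ennreal (norm (\<rho> a (r *\<^sub>R \<zeta>)) powr 2) \<partial>torus_measure) \<le> (\<integral>\<^sup>+ \<zeta>. ennreal (K powr 2) \<partial>(torus_measure :: (complex ^ 'n) measure))"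
        using that K by (intro nn_integral_mono ennreal_leI powr_mono2 K torus_scaled) auto
      then show ?thesis
        by (simp only: nn_integral_torus_const)
    qed
    then have "\<exists>g. has_boundary_value (\<rho> a) g"
      by (intro hardy_boundary_value_exists[OF hol[OF a], of 2 "K powr 2"]) auto
    then show ?thesis
      unfolding R_def using boundary_value_AE(1)[OF hol[OF a]] by blast
  qed
  define X where "X = enn2real (SUP a\<in>S. hardy_norm \<infinity> (\<rho> a))"
  have R_le: "AE \<zeta> in torus_measure. norm (R a \<zeta>) \<le> X" if a: "a \<in> S" for a
  proof -
    have "ennreal X = (SUP a\<in>S. hardy_norm \<infinity> (\<rho> a))"
      using \<rho>(2) by (simp add: X_def)
    then have "esssup torus_measure (\<lambda>\<zeta>. ennreal (norm (R a \<zeta>))) \<le> ennreal X"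
      using a SUP_upper[of a S "\<lambda>a. hardy_norm \<infinity> (\<rho> a)"] by (simp add: hardy_norm_def Lp_norm_def R_def)
    moreover have "AE \<zeta> in torus_measure. ennreal (norm (R a \<zeta>)) \<le> esssup torus_measure (\<lambda>\<zeta>. ennreal (norm (R a \<zeta>)))"
      by (rule esssup_AE)
    ultimately show ?thesis
      by (auto elim!: eventually_mono dest: order_trans simp: X_def)
  qed
  have X: "0 \<le> X" by (simp add: X_def)
  \<comment> \<open>Both factors of a term are to carry the same exponent, so
    \<open>1 / s = 1 / q + 1 / q\<close>; then \<open>s \<ge> 1\<close> gives
    \<open>q \<ge> 2\<close>.\<close>
  define q where "q = 2 * s"
  have q: "2 \<le> q" "1 / s = 1 / q + 1 / q" "1 < q" "0 < q"
    using s by (auto simp: q_def)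
  have carq: "q_carleson q S"
    using car q by (auto simp: carleson_sequence_def)
  define \<kappa> where "\<kappa> a = normalized_kernel (ennreal q) a" for a :: "complex ^ 'n"
  obtain D where D: "D > 0" "square_bound q \<kappa> S D"
    using carleson_square_function[OF S(2) q(1) carq] unfolding \<kappa>_def by blast
  obtain C where C: "C > 0" "\<And>a :: complex ^ 'n. a \<in> polydisc \<Longrightarrow> kernel_norm (ennreal q) a \<le> C * kdiag a powr (1 - 1 / q)"
    using kernel_norm_upper[OF q(3)] by blast
  obtain c2 where c2: "c2 > 0" "\<And>a :: complex ^ 'n. a \<in> polydisc \<Longrightarrow> c2 * kdiag a powr (1 - 1 / q) \<le> kernel_norm (ennreal q) a"
    using kernel_norm_lower[OF q(1)] by blast
  have kpos: "0 < kernel_norm (ennreal q) a" if "a \<in> polydisc" for a :: "complex ^ 'n"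
    using c2(1) kdiag_pos[OF that] by (intro less_le_trans[OF _ c2(2)[OF that]] mult_pos_pos) auto
  \<comment> \<open>Multiplying by normalized kernels turns the bounded dual system into one with exponent \<open>2 * s\<close>.\<close>
  show ?thesis
  proof (rule has_linear_extension_dual[OF S s q(4) q(1,2) carq, of "\<lambda>a z. \<rho> a z * \<kappa> a z" "\<lambda>a \<zeta>. R a \<zeta> * \<kappa> a \<zeta>"
        "\<lambda>a. kdiag a / kernel_norm (ennreal q) a" "1 / C" "D * X powr q"])
    show "holomorphic_polydisc (\<lambda>z. \<rho> a z * \<kappa> a z)" if "a \<in> S" for a
      unfolding \<kappa>_def using that S(2) by (intro holomorphic_polydisc_mult hol normalized_kernel_holomorphic) auto
    show "has_boundary_value (\<lambda>z. \<rho> a z * \<kappa> a z) (\<lambda>\<zeta>. R a \<zeta> * \<kappa> a \<zeta>)" if "a \<in> S" for a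
      unfolding \<kappa>_def using that S(2) by (intro has_boundary_value_mult hol bv normalized_kernel_continuous) auto
    show "\<rho> a b * \<kappa> a b = (if a = b then complex_of_real (kdiag b / kernel_norm (ennreal q) b) else 0)" if "a \<in> S" "b \<in> S" for a b
      using \<rho>(3)[OF that] by (auto simp: \<kappa>_def normalized_kernel_diag)
    show "0 < 1 / C" using C by simp
    \<comment> \<open>The upper bound for \<open>kernel_norm (ennreal q) a\<close> turns into a
      lower bound for the diagonal values of the new dual functions, as the exponents
      \<open>1 / q\<close> and \<open>1 - 1 / q\<close> add up to 1.\<close>
    show "1 / C * kdiag a powr (1 / q) \<le> kdiag a / kernel_norm (ennreal q) a" if "a \<in> S" for a
    proof -
      have ap: "a \<in> polydisc" using that S(2) by blast
      note N = kdiag_pos[OF ap]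
      have "kdiag a powr (1 / q) * kernel_norm (ennreal q) a \<le> kdiag a powr (1 / q) * (C * kdiag a powr (1 - 1 / q))"
        by (intro mult_left_mono C(2) ap) auto
      also have "\<dots> = C * kdiag a"
        using N by (simp flip: powr_add)
      finally show ?thesis
        using C(1) kpos[OF ap] by (simp add: field_simps)
    qed
    show "0 \<le> D * X powr q" using D by simp
    show "square_bound q (\<lambda>a \<zeta>. R a \<zeta> * \<kappa> a \<zeta>) S (D * X powr q)"
      unfolding square_bound_def
    proof (intro allI impI)
      fix A and \<alpha> :: "complex ^ 'n \<Rightarrow> real"
      assume A: "finite A" "A \<subseteq> S" and \<alpha>: "\<forall>a. 0 \<le> \<alpha> a"
      have "(\<integral>\<^sup>+ \<zeta>. ennreal ((\<Sum>a\<in>A. (\<alpha> a)\<^sup>2 * (norm (R a \<zeta> * \<kappa> a \<zeta>))\<^sup>2) powr (q / 2)) \<partial>torus_measure) \<le>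
          (\<integral>\<^sup>+ \<zeta>. ennreal ((\<Sum>a\<in>A. (\<alpha> a * X)\<^sup>2 * (norm (\<kappa> a \<zeta>))\<^sup>2) powr (q / 2)) \<partial>torus_measure)"
      proof (rule nn_integral_mono_AE)
        \<comment> \<open>The exceptional null set depends on \<open>a\<close>; as \<open>A\<close>
          is finite, all of them can be discarded together.\<close>
        have "AE \<zeta> in torus_measure. \<forall>a\<in>A. norm (R a \<zeta>) \<le> X"
          using A R_le by (intro AE_finite_allI) auto
        then show "AE \<zeta> in torus_measure. ennreal ((\<Sum>a\<in>A. (\<alpha> a)\<^sup>2 * (norm (R a \<zeta> * \<kappa> a \<zeta>))\<^sup>2) powr (q / 2)) \<le>
            ennreal ((\<Sum>a\<in>A. (\<alpha> a * X)\<^sup>2 * (norm (\<kappa> a \<zeta>))\<^sup>2) powr (q / 2))"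
        proof eventually_elim
          case (elim \<zeta>)
          have "(\<alpha> a)\<^sup>2 * (norm (R a \<zeta> * \<kappa> a \<zeta>))\<^sup>2 \<le> (\<alpha> a * X)\<^sup>2 * (norm (\<kappa> a \<zeta>))\<^sup>2" if "a \<in> A" for a
          proof -
            have "(norm (R a \<zeta>))\<^sup>2 \<le> X\<^sup>2"
              using elim that by (intro power_mono) auto
            then have "((\<alpha> a)\<^sup>2 * (norm (\<kappa> a \<zeta>))\<^sup>2) * (norm (R a \<zeta>))\<^sup>2 \<le> ((\<alpha> a)\<^sup>2 * (norm (\<kappa> a \<zeta>))\<^sup>2) * X\<^sup>2"
              by (intro mult_left_mono) auto
            then show ?thesis
              by (simp add: norm_mult power_mult_distrib mult_ac)
          qed
          then show ?case
            using q by (intro ennreal_leI powr_mono2 sum_mono sum_nonneg) auto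
        qed
      qed
      also have "\<dots> \<le> ennreal (D * (\<Sum>a\<in>A. (\<alpha> a * X) powr q))"
        using \<alpha> X by (intro square_boundD[OF D(2) A]) auto
      also have "D * (\<Sum>a\<in>A. (\<alpha> a * X) powr q) = D * X powr q * (\<Sum>a\<in>A. \<alpha> a powr q)"
        using \<alpha> X by (simp add: powr_mult sum_distrib_left mult_ac)
      finally show "(\<integral>\<^sup>+ \<zeta>. ennreal ((\<Sum>a\<in>A. (\<alpha> a)\<^sup>2 * (norm (R a \<zeta> * \<kappa> a \<zeta>))\<^sup>2) powr (q / 2)) \<partial>torus_measure) \<le>
          ennreal (D * X powr q * (\<Sum>a\<in>A. \<alpha> a powr q))" .
    qed
  qed
qed

theorem theorem2p7:
  fixes S :: "(complex ^ 'n) set" and p :: ennreal and s :: real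
  assumes "countable S" and "S \<subseteq> polydisc"
    and "carleson_sequence S"
    and "p = \<infinity> \<or> (1 < p \<and> p \<le> 2)"
    and "dual_bounded p S"
    and "1 \<le> s" and "ennreal s < p"
  shows "hardy_interpolating s S \<and>
    (\<exists>E. bounded_linear_ell_hardy s S E \<and>
       (\<forall>l\<in>ell s S. \<forall>a\<in>S.
          E l a = l a * complex_of_real (kernel_norm (conj_exponent (ennreal s)) a)))"
proof (cases "p = \<infinity>")
  case True
  then show ?thesis
    using has_linear_extension_infinite_exponent[OF assms(1-3,6)] assms(5)
    unfolding has_linear_extension_def by blast
next
  case False
  then have p: "1 < p" "p \<le> 2"
    using assms(4) by auto
  define r where "r = enn2real p"
  have pr: "p = ennreal r" and "0 \<le> r"
    using False by (auto simp: r_def less_top)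
  have "1 < r" "r \<le> 2" "s < r"
    using p assms(6,7) \<open>0 \<le> r\<close> unfolding pr
    by (auto simp: ennreal_less_iff simp flip: ennreal_1 ennreal_numeral)
  then show ?thesis
    using has_linear_extension_finite_exponent[OF assms(1-3) _ _ assms(6)] assms(5)
    unfolding has_linear_extension_def pr by blast
qed

end
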